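(* Let $\Lambda\colon V\times V\to\mathbb{K}$ be an even continuous bilinear form and let $R\ge\frac12$. (i) If $\mathbb{K}=\mathbb{R}$, then for every $a,b\in\widehat{\mathcal{W}}_R(V)$ the map $\mathbb{R}\ni z\mapsto a\star_{z\Lambda}b\in\widehat{\mathcal{W}}_R(V)$ is real-analytic with Taylor expansion around $z=0$ given by $a\star_{z\Lambda}b=\sum_{k=0}^\infty\frac{z^k}{k!}\mu\circ P_\Lambda^k(a\otimes b)$. (ii) If $\mathbb{K}=\mathbb{C}$, then for every $a,b\in\widehat{\mathcal{W}}_R(V)$ the map $\mathbb{C}\ni z\mapsto a\star_{z\Lambda}b\in\widehat{\mathcal{W}}_R(V)$ is holomorphic (even entire) with Taylor expansion around $z=0$ given by $a\star_{z\Lambda}b=\sum_{k=0}^\infty\frac{z^k}{k!}\mu\circ P_\Lambda^k(a\otimes b)$. The collection of Weyl algebras $\{\widehat{\mathcal{W}}_R(V,\star_{z\Lambda})\}_{z\in\mathbb{C}}$ provides a holomorphic (even entire) deformation of $\widehat{\mathcal{W}}_R(V,\mu)$, where $\mu=\star_{z\Lambda}|_{z=0}$ is the symmetric tensor product.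
   Context: $\mathbb{K}=\mathbb{R}$ or $\mathbb{C}$, and $V=V_{\mathbf 0}\oplus V_{\mathbf 1}$ is a $\mathbb{Z}_2$-graded Hausdorff locally convex $\mathbb{K}$-vector space such that the projections onto $V_{\mathbf 0}$ and $V_{\mathbf 1}$ are continuous. In exponents of $-1$ a homogeneous vector denotes its parity. Symmetric algebra: $S_n$ acts from the right on $V^{\otimes n}$ by $(v_1\otimes\cdots\otimes v_n)\triangleleft\sigma=\pm\, v_{\sigma(1)}\otimes\cdots\otimes v_{\sigma(n)}$ for homogeneous $v_i$, where $\pm$ is the Koszul sign ($-1$ to the number of pairs $i<j$ with $\sigma(i)>\sigma(j)$ and $v_{\sigma(i)},v_{\sigma(j)}$ both odd). $\mathcal{S}_n(v)=\frac1{n!}\sum_{\sigma} v\triangleleft\sigma$, $\mathrm{S}^n(V)=\operatorname{im}\mathcal{S}_n\subseteq V^{\otimes n}$, $\mathrm{S}^0(V)=\mathbb{K}$, $\mathrm{S}^\bullet(V)=\bigoplus_n \mathrm{S}^n(V)$, with product $\mu(v\otimes w)=vw=\mathcal{S}(v\otimes w)$, $\mathcal{S}=\bigoplus_n\mathcal{S}_n$. Star product: $\Lambda$ is even if $\Lambda(v,w)=0$ for homogeneous $v,w$ of different parity. $P_\Lambda\colon \mathrm{S}^\bullet(V)\otimes \mathrm{S}^\bullet(V)\to \mathrm{S}^{\bullet-1}(V)\otimes \mathrm{S}^{\bullet-1}(V)$ is the linear extension of $$P_\Lambda(v_1\cdots v_n\otimes w_1\cdots w_m)=\sum_{k=1}^n\sum_{\ell=1}^m(-1)^{v_k(v_{k+1}+\cdots+v_n)+w_\ell(w_1+\cdots+w_{\ell-1})}\Lambda(v_k,w_\ell)\,v_1\cdots\widehat{v_k}\cdots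 v_n\otimes w_1\cdots\widehat{w_\ell}\cdots w_m$$ (homogeneous vectors; hats denote omission; $P_\Lambda$ vanishes if one factor is in $\mathrm{S}^0(V)$). On $\mathrm{S}^\bullet(V)$ one sets $a\star_{z\Lambda}b=\sum_{k\ge0}\frac{z^k}{k!}\mu(P_\Lambda^k(a\otimes b))$, a finite sum. Topology: for a continuous seminorm $p$ on $V$ let $p^n$ be the projective tensor seminorm on $V^{\otimes n}$ ($p^0=|\cdot|$) and $p_R(v)=\sum_{n\ge0}p^n(v_n)\,n!^R$ for $v=\sum_nv_n$. $\mathcal{W}_R(V,\star_{z\Lambda})$ is $\mathrm{S}^\bullet(V)$ with product $\star_{z\Lambda}$ and the topology of all $p_R$ ($p$ a continuous seminorm on $V$); the topology is independent of $z$. For $R\ge\frac12$ the product is continuous and extends to the completion $\widehat{\mathcal{W}}_R(V,\star_{z\Lambda})$, whose underlying locally convex space is denoted $\widehat{\mathcal{W}}_R(V)$. Each bilinear map $(a,b)\mapsto\mu\circ P_\Lambda^k(a\otimes b)$ is continuous and denotes its continuous extension to the completion. A holomorphic (entire) deformation of a locally convex algebra $(A,\mu)$ is here a family of continuous associative products $\star_z$, $z\in\mathbb{C}$, on the fixed locally convex space $A$ such that $z\mapsto a\star_zb$ is holomorphic on $\mathbb{C}$ for all $a,b\in A$ and $\star_0=\mu$. *)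

theory Defs
  imports "HOL-Analysis.Analysis" "HOL-Library.Function_Algebras"
begin

section \<open>Locally convex spaces over the real or complex numbers\<close>

text \<open>The scalar field is only required to be a \<^class>\<open>real_normed_field\<close>; it is meant to be
  instantiated with \<^typ>\<open>real\<close> or \<^typ>\<open>complex\<close>.  The scalar multiplication is an explicit
  parameter because the library has no class of complex topological vector spaces.\<close>

locale locally_convex_space = vector_space scale
  for scale :: "'k::real_normed_field \<Rightarrow> 'v::{topological_ab_group_add, t2_space} \<Rightarrow> 'v" +
  assumes continuous_scale: "continuous_on UNIV (\<lambda>(c, v). scale c v)"
    and convex_neighbourhoods:
      "\<lbrakk>open U; 0 \<in> U\<rbrakk> \<Longrightarrow>
         \<exists>C. open C \<and> 0 \<in> C \<and> C \<subseteq> U \<and>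
             (\<forall>x\<in>C. \<forall>y\<in>C. \<forall>t::real. 0 \<le> t \<and> t \<le> 1 \<longrightarrow>
                scale (of_real (1 - t)) x + scale (of_real t) y \<in> C)"

definition seminorm :: "('k::real_normed_field \<Rightarrow> 'a::ab_group_add \<Rightarrow> 'a) \<Rightarrow> ('a \<Rightarrow> real) \<Rightarrow> bool" where
  "seminorm s p \<longleftrightarrow>
     (\<forall>x y. p (x + y) \<le> p x + p y) \<and> (\<forall>c x. p (s c x) = norm c * p x)"

definition bilinear_map ::
  "('k::field \<Rightarrow> 'a::ab_group_add \<Rightarrow> 'a) \<Rightarrow> ('k \<Rightarrow> 'b::ab_group_add \<Rightarrow> 'b) \<Rightarrow>
   ('k \<Rightarrow> 'c::ab_group_add \<Rightarrow> 'c) \<Rightarrow> ('a \<Rightarrow> 'b \<Rightarrow> 'c) \<Rightarrow> bool" where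
  "bilinear_map sa sb sc f \<longleftrightarrow>
     (\<forall>x. Vector_Spaces.linear sb sc (\<lambda>y. f x y)) \<and>
     (\<forall>y. Vector_Spaces.linear sa sc (\<lambda>x. f x y))"

text \<open>\<open>linear_ext sa sb I u g\<close> is the linear extension of \<open>u i \<mapsto> g i\<close> (\<open>i \<in> I\<close>).  Its values are
  determined on the span of \<open>u ` I\<close> only, and it is only applied there.\<close>

definition linear_ext ::
  "('k::field \<Rightarrow> 'a::ab_group_add \<Rightarrow> 'a) \<Rightarrow> ('k \<Rightarrow> 'b::ab_group_add \<Rightarrow> 'b) \<Rightarrow>
   'i set \<Rightarrow> ('i \<Rightarrow> 'a) \<Rightarrow> ('i \<Rightarrow> 'b) \<Rightarrow> 'a \<Rightarrow> 'b" where
  "linear_ext sa sb I u g =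
     (SOME L. Vector_Spaces.linear sa sb L \<and> (\<forall>i\<in>I. L (u i) = g i))"


section \<open>Tensors\<close>

text \<open>Algebraic tensor products are realised as spaces of evaluation functionals: \<open>v \<otimes> w\<close> is the
  functional \<open>f \<mapsto> f v w\<close> on the bilinear forms, and the tensor product is the span of these
  functionals.  As multilinear forms separate the points of an algebraic tensor product of vector
  spaces, this is the usual tensor product.  The tensor algebra is obtained in the same way from
  the functions on lists that are multilinear in each length separately, so that the list
  \<open>[v\<^sub>1, \<dots>, v\<^sub>n]\<close> yields \<open>v\<^sub>1 \<otimes> \<dots> \<otimes> v\<^sub>n\<close> and tensors of different degrees are independent.
  The functionals are set to zero on forms that are not multilinear.\<close>

type_synonym ('k, 'v) tensor = "('v list \<Rightarrow> 'k) \<Rightarrow> 'k"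
type_synonym ('k, 'v) tensor2 =
  "(('k, 'v) tensor \<Rightarrow> ('k, 'v) tensor \<Rightarrow> 'k) \<Rightarrow> 'k"

definition fscale :: "'k::field \<Rightarrow> ('x \<Rightarrow> 'k) \<Rightarrow> ('x \<Rightarrow> 'k)" where
  "fscale c \<phi> = (\<lambda>f. c * \<phi> f)"

definition tensor_prod ::
  "('k::field, 'v) tensor \<Rightarrow> ('k, 'v) tensor \<Rightarrow> ('k, 'v) tensor2" (infixl \<open>\<otimes>\<close> 70) where
  "s \<otimes> t = (\<lambda>f. if bilinear_map fscale fscale (*) f then f s t else 0)"

text \<open>The component of a vector in the first summand of a direct sum decomposition.\<close>

definition component_along :: "'v::ab_group_add set \<Rightarrow> 'v set \<Rightarrow> 'v \<Rightarrow> 'v" where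
  "component_along U W v = (THE x. x \<in> U \<and> v - x \<in> W)"


section \<open>Weyl algebras\<close>

locale graded_lcs = locally_convex_space scale
  for scale :: "'k::real_normed_field \<Rightarrow> 'v::{topological_ab_group_add, t2_space} \<Rightarrow> 'v" +
  fixes V0 V1 :: "'v set"
  assumes subspace_V0: "subspace V0" and subspace_V1: "subspace V1"
    and direct: "V0 \<inter> V1 = {0}"
    and decomposition: "\<And>v. \<exists>v0\<in>V0. \<exists>v1\<in>V1. v = v0 + v1"
    and continuous_proj0: "continuous_on UNIV (component_along V0 V1)"
    and continuous_proj1: "continuous_on UNIV (component_along V1 V0)"
begin

definition multilinear :: "('v list \<Rightarrow> 'k) \<Rightarrow> bool" where
  "multilinear f \<longleftrightarrow> (\<forall>xs ys. Vector_Spaces.linear scale (*) (\<lambda>v. f (xs @ v # ys)))"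

definition tens :: "'v list \<Rightarrow> ('k, 'v) tensor" where
  "tens vs = (\<lambda>f. if multilinear f then f vs else 0)"

definition tensor_power :: "nat \<Rightarrow> ('k, 'v) tensor set" where
  "tensor_power n = module.span fscale (tens ` {vs. length vs = n})"

definition degree_part :: "nat \<Rightarrow> ('k, 'v) tensor \<Rightarrow> ('k, 'v) tensor" where
  "degree_part n =
     linear_ext fscale fscale UNIV tens (\<lambda>vs. if length vs = n then tens vs else 0)"

text \<open>The zero vector is homogeneous of both parities; it is counted
  as even here, which is immaterial because all formulas below vanish if one entry is zero.\<close>

definition homogeneous :: "'v list \<Rightarrow> bool" where
  "homogeneous vs \<longleftrightarrow> set vs \<subseteq> V0 \<union> V1"

definition parity :: "'v \<Rightarrow> nat" where
  "parity v = (if v \<in> V0 then 0 else 1)"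

subsection \<open>Symmetric algebra\<close>

text \<open>Indices start at 0, hence permutations are those of \<open>{..<n}\<close>.\<close>

definition koszul_sign :: "(nat \<Rightarrow> nat) \<Rightarrow> 'v list \<Rightarrow> 'k" where
  "koszul_sign \<sigma> vs =
     (- 1) ^ card {(i, j). i < j \<and> j < length vs \<and> \<sigma> i > \<sigma> j \<and>
                           parity (vs ! \<sigma> i) = 1 \<and> parity (vs ! \<sigma> j) = 1}"

definition perm_action :: "nat \<Rightarrow> (nat \<Rightarrow> nat) \<Rightarrow> ('k, 'v) tensor \<Rightarrow> ('k, 'v) tensor" where
  "perm_action n \<sigma> =
     linear_ext fscale fscale {vs. homogeneous vs \<and> length vs = n} tens
       (\<lambda>vs. fscale (koszul_sign \<sigma> vs) (tens (map (\<lambda>i. vs ! \<sigma> i) [0..<n])))"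

definition symmetrizer_n :: "nat \<Rightarrow> ('k, 'v) tensor \<Rightarrow> ('k, 'v) tensor" where
  "symmetrizer_n n t = fscale (1 / fact n) (\<Sum>\<sigma> | \<sigma> permutes {..<n}. perm_action n \<sigma> t)"

definition symmetrizer :: "('k, 'v) tensor \<Rightarrow> ('k, 'v) tensor" where
  "symmetrizer t = (\<Sum>n | degree_part n t \<noteq> 0. symmetrizer_n n (degree_part n t))"

definition sym_power :: "nat \<Rightarrow> ('k, 'v) tensor set" where
  "sym_power n = symmetrizer_n n ` tensor_power n"

definition sym_algebra :: "('k, 'v) tensor set" where
  "sym_algebra = module.span fscale (\<Union>n. sym_power n)"

text \<open>The isomorphism from \<open>V\<^sup>\<otimes>\<^sup>n \<otimes> V\<^sup>\<otimes>\<^sup>m\<close> to \<open>V\<^sup>\<otimes>\<^sup>(\<^sup>n\<^sup>+\<^sup>m\<^sup>)\<close>, in all degrees simultaneously.\<close>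

definition concat_tensor :: "('k, 'v) tensor2 \<Rightarrow> ('k, 'v) tensor" where
  "concat_tensor =
     linear_ext fscale fscale UNIV (\<lambda>(vs, ws). tens vs \<otimes> tens ws) (\<lambda>(vs, ws). tens (vs @ ws))"

definition mu :: "('k, 'v) tensor2 \<Rightarrow> ('k, 'v) tensor" where
  "mu x = symmetrizer (concat_tensor x)"

text \<open>\<open>sym_prod [v\<^sub>1, \<dots>, v\<^sub>n]\<close> is the iterated product \<open>v\<^sub>1 \<cdots> v\<^sub>n\<close>; \<open>tens []\<close> is the unit.\<close>

definition sym_prod :: "'v list \<Rightarrow> ('k, 'v) tensor" where
  "sym_prod vs = foldr (\<lambda>v t. mu (tens [v] \<otimes> t)) vs (tens [])"

subsection \<open>Star product\<close>

definition even_form :: "('v \<Rightarrow> 'v \<Rightarrow> 'k) \<Rightarrow> bool" where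
  "even_form \<Lambda> \<longleftrightarrow> (\<forall>v\<in>V0. \<forall>w\<in>V1. \<Lambda> v w = 0 \<and> \<Lambda> w v = 0)"

definition P :: "('v \<Rightarrow> 'v \<Rightarrow> 'k) \<Rightarrow> ('k, 'v) tensor2 \<Rightarrow> ('k, 'v) tensor2" where
  "P \<Lambda> =
     linear_ext fscale fscale {(vs, ws). homogeneous vs \<and> homogeneous ws}
       (\<lambda>(vs, ws). sym_prod vs \<otimes> sym_prod ws)
       (\<lambda>(vs, ws). \<Sum>k<length vs. \<Sum>l<length ws.
          fscale ((- 1) ^ (parity (vs ! k) * sum_list (map parity (drop (Suc k) vs)) +
                           parity (ws ! l) * sum_list (map parity (take l ws)))
                  * \<Lambda> (vs ! k) (ws ! l))
            (sym_prod (take k vs @ drop (Suc k) vs) \<otimes> sym_prod (take l ws @ drop (Suc l) ws)))"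

definition mu_P :: "('v \<Rightarrow> 'v \<Rightarrow> 'k) \<Rightarrow> nat \<Rightarrow> ('k, 'v) tensor \<Rightarrow> ('k, 'v) tensor \<Rightarrow> ('k, 'v) tensor" where
  "mu_P \<Lambda> k a b = mu ((P \<Lambda> ^^ k) (a \<otimes> b))"

text \<open>\<open>star \<Lambda> z\<close> is the product \<open>\<star>\<^bsub>z\<Lambda>\<^esub>\<close>.\<close>

definition star :: "('v \<Rightarrow> 'v \<Rightarrow> 'k) \<Rightarrow> 'k \<Rightarrow> ('k, 'v) tensor \<Rightarrow> ('k, 'v) tensor \<Rightarrow> ('k, 'v) tensor" where
  "star \<Lambda> z a b = (\<Sum>k | (P \<Lambda> ^^ k) (a \<otimes> b) \<noteq> 0. fscale (z ^ k / fact k) (mu_P \<Lambda> k a b))"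

subsection \<open>Topology and completion\<close>

text \<open>Scalar coefficients are allowed in the representations as sums of elementary tensors; they are
  needed to obtain the absolute value in degree 0 and can be absorbed in all other degrees.\<close>

definition proj_seminorm :: "('v \<Rightarrow> real) \<Rightarrow> nat \<Rightarrow> ('k, 'v) tensor \<Rightarrow> real" where
  "proj_seminorm p n t =
     Inf {(\<Sum>(c, vs)\<leftarrow>L. norm c * prod_list (map p vs)) | L.
            (\<forall>(c, vs)\<in>set L. length vs = n) \<and> t = (\<Sum>(c, vs)\<leftarrow>L. fscale c (tens vs))}"

definition weyl_seminorm :: "real \<Rightarrow> ('v \<Rightarrow> real) \<Rightarrow> ('k, 'v) tensor \<Rightarrow> real" where
  "weyl_seminorm R p t =
     (\<Sum>n | degree_part n t \<noteq> 0. proj_seminorm p n (degree_part n t) * fact n powr R)"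

definition weyl_topology :: "real \<Rightarrow> ('k, 'v) tensor topology" where
  "weyl_topology R =
     topology_generated_by
       {{y \<in> sym_algebra. weyl_seminorm R p (y - x) < e} | p x e.
          seminorm scale p \<and> continuous_on UNIV p \<and> x \<in> sym_algebra \<and> e > 0}"

text \<open>A completion of the symmetric algebra with the Weyl topology: a complete Hausdorff locally
  convex space \<open>'w\<close> with a linear topological embedding \<open>\<iota>\<close> of the symmetric algebra onto a dense
  subspace.  The uniformity of \<open>'w\<close> is the one of its additive group.\<close>

definition weyl_completion ::
  "real \<Rightarrow> ('k \<Rightarrow> 'w::{uniform_space, topological_ab_group_add, t2_space} \<Rightarrow> 'w) \<Rightarrow>
   (('k, 'v) tensor \<Rightarrow> 'w) \<Rightarrow> bool" where
  "weyl_completion R scaleW \<iota> \<longleftrightarrow>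
     locally_convex_space scaleW \<and>
     (uniformity :: ('w \<times> 'w) filter) = filtercomap (\<lambda>(x, y). x - y) (nhds 0) \<and>
     complete (UNIV :: 'w set) \<and>
     (\<forall>x\<in>sym_algebra. \<forall>y\<in>sym_algebra. \<iota> (x + y) = \<iota> x + \<iota> y) \<and>
     (\<forall>c. \<forall>x\<in>sym_algebra. \<iota> (fscale c x) = scaleW c (\<iota> x)) \<and>
     embedding_map (weyl_topology R) euclidean \<iota> \<and>
     closure (\<iota> ` sym_algebra) = UNIV"

text \<open>The continuous extension to the completion of an operation on the symmetric algebra; it is
  unique because the range of \<open>\<iota>\<close> is dense.\<close>

definition extension ::
  "(('k, 'v) tensor \<Rightarrow> 'w::t2_space) \<Rightarrow>
   (('k, 'v) tensor \<Rightarrow> ('k, 'v) tensor \<Rightarrow> ('k, 'v) tensor) \<Rightarrow> 'w \<Rightarrow> 'w \<Rightarrow> 'w" where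
  "extension \<iota> B =
     (THE F. continuous_on UNIV (\<lambda>(a, b). F a b) \<and>
             (\<forall>x\<in>sym_algebra. \<forall>y\<in>sym_algebra. F (\<iota> x) (\<iota> y) = \<iota> (B x y)))"

end


section \<open>Vector-valued analytic functions and deformations\<close>

text \<open>Analyticity is meant in the strong sense: local expansions into power series that converge in
  the given topology.  Entire functions are those that are complex differentiable at every point.\<close>

definition real_analytic ::
  "(real \<Rightarrow> 'w::{topological_space, ab_group_add} \<Rightarrow> 'w) \<Rightarrow> (real \<Rightarrow> 'w) \<Rightarrow> bool" where
  "real_analytic s f \<longleftrightarrow>
     (\<forall>x0. \<exists>c. \<exists>r>0. \<forall>x. \<bar>x - x0\<bar> < r \<longrightarrow> (\<lambda>k. s ((x - x0) ^ k) (c k)) sums f x)"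

definition entire ::
  "(complex \<Rightarrow> 'w::{topological_space, ab_group_add} \<Rightarrow> 'w) \<Rightarrow> (complex \<Rightarrow> 'w) \<Rightarrow> bool" where
  "entire s f \<longleftrightarrow> (\<forall>z0. \<exists>d. ((\<lambda>z. s (1 / (z - z0)) (f z - f z0)) \<longlongrightarrow> d) (at z0))"

definition holomorphic_deformation ::
  "(complex \<Rightarrow> 'w::{topological_ab_group_add, t2_space} \<Rightarrow> 'w) \<Rightarrow> ('w \<Rightarrow> 'w \<Rightarrow> 'w) \<Rightarrow>
   (complex \<Rightarrow> 'w \<Rightarrow> 'w \<Rightarrow> 'w) \<Rightarrow> bool" where
  "holomorphic_deformation s m pr \<longleftrightarrow>
     locally_convex_space s \<and>
     (\<forall>z. bilinear_map s s s (pr z) \<and>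
          continuous_on UNIV (\<lambda>(a, b). pr z a b) \<and>
          (\<forall>a b c. pr z (pr z a b) c = pr z a (pr z b c))) \<and>
     (\<forall>a b. entire s (\<lambda>z. pr z a b)) \<and>
     pr 0 = m"

end

theory Submission
  imports Defs
begin

text \<open>
  On symmetric tensors \<open>P \<Lambda>\<close> is a contraction of the last factor on the left with the first factor on
  the right, weighted by the degrees.  Star multiplication by a single vector from the
  left is symmetric multiplication plus \<open>z\<close> times an insertion, and it commutes with star
  multiplication from the right.  As these operators generate the algebra from its unit, \<open>\<star>\<close> is
  associative.

  For continuity one may enlarge a seminorm \<open>p\<close> so that it is additive along the grading and \<open>\<Lambda>\<close> is
  bounded by \<open>p(v) p(w)\<close>.  The \<open>k\<close>-fold contraction of tensors of degrees \<open>n\<close> and \<open>m\<close> produces the factor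
  \<open>n! m! / ((n - k)! (m - k)!)\<close>, which for \<open>R \<ge> 1/2\<close> is absorbed by the weights \<open>n!\<^sup>R m!\<^sup>R\<close> up to
  \<open>k!\<close> and an exponential factor.  After rescaling the seminorm the terms of the series for \<open>\<star>\<close>
  decay faster than any prescribed geometric sequence, with bounds that are bilinear in \<open>p_R(a)\<close> and
  \<open>p_R(b)\<close>.  Such bounds pass to the completion by density, and with them the power series expansions
  around every point, the difference quotients and the associative law.
\<close>

section \<open>Linear maps between function spaces\<close>

text \<open>The given operators are fixed only by choices on spanning sets, inside a type of
  functionals that contains much more than tensors. Nothing is linear until a linear map with the
  prescribed values has been exhibited: hence the lifts of multilinear functions of words, and hence
  operators (\<open>Sym\<close>, \<open>mult\<close>, \<open>Pc\<close>) that are linear on the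
  whole type and agree with the given ones where these are determined. The second obstacle is the
  Koszul signs, which depend on the parities of letters and not linearly on the letters. They are
  controlled by peeling single letters off a word; once symmetrised words satisfy a recursion of
  this kind, the algebraic identities no longer involve permutations. In the analysis, all sums on
  the algebra itself are finite, so convergence there says nothing about the completion. What has to
  be carried over is a rate that is uniform in both factors, and the exponential series leaves room
  for a single \<open>fact k\<close> in it; this is what limits \<open>R\<close>. Expansions are set
  up around every \<open>z\<close>, because analyticity is demanded at every point.\<close>

text \<open>As simplification rules, the pointwise laws would eta-expand sums of tensors.\<close>

lemmas pointwise = plus_fun_apply zero_fun_apply minus_apply uminus_apply

declare pointwise [simp del]

lemma vector_space_fscale: "vector_space (fscale :: 'k::field \<Rightarrow> ('x \<Rightarrow> 'k) \<Rightarrow> 'x \<Rightarrow> 'k)"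
  by standard (auto simp: fscale_def fun_eq_iff pointwise algebra_simps)

interpretation fs: vector_space "fscale :: 'k::field \<Rightarrow> ('x \<Rightarrow> 'k) \<Rightarrow> 'x \<Rightarrow> 'k"
  by (rule vector_space_fscale)

interpretation fsp: vector_space_pair
  "fscale :: 'k::field \<Rightarrow> ('x \<Rightarrow> 'k) \<Rightarrow> 'x \<Rightarrow> 'k" "fscale :: 'k::field \<Rightarrow> ('y \<Rightarrow> 'k) \<Rightarrow> 'y \<Rightarrow> 'k"
  by unfold_locales

abbreviation flinear :: "(('x \<Rightarrow> 'k::field) \<Rightarrow> ('y \<Rightarrow> 'k)) \<Rightarrow> bool" where
  "flinear \<equiv> Vector_Spaces.linear fscale fscale"

lemma flinearI:
  assumes "\<And>x y. L (x + y) = L x + L y" "\<And>c x. L (fscale c x) = fscale c (L x)"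
  shows "flinear L"
  unfolding Vector_Spaces.linear_iff using assms by (intro conjI allI vector_space_fscale)

lemma flinear_add: "flinear L \<Longrightarrow> L (x + y) = L x + L y"
  and flinear_scale: "flinear L \<Longrightarrow> L (fscale c x) = fscale c (L x)"
  unfolding Vector_Spaces.linear_iff by blast+

lemma flinear_0: "flinear L \<Longrightarrow> L 0 = 0"
  by (rule fsp.linear_0)

lemma flinear_sum: "flinear L \<Longrightarrow> L (\<Sum>i\<in>I. x i) = (\<Sum>i\<in>I. L (x i))"
  by (rule fsp.linear_sum)

lemma flinear_sum_list:
  assumes "flinear L"
  shows "L (\<Sum>i\<leftarrow>I. x i) = (\<Sum>i\<leftarrow>I. L (x i))"
  by (induction I) (simp_all add: flinear_0[OF assms] flinear_add[OF assms])

lemma flinear_id: "flinear (\<lambda>x. x)"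
  by (rule flinearI) auto

lemma flinear_zero: "flinear (\<lambda>x. 0)"
  by (rule flinearI) auto

lemma flinear_compose:
  assumes "flinear L" "flinear M"
  shows "flinear (\<lambda>x. L (M x))"
  by (rule flinearI) (simp_all add: assms[THEN flinear_add] assms[THEN flinear_scale])

lemma flinear_plus:
  assumes "flinear L" "flinear M"
  shows "flinear (\<lambda>x. L x + M x)"
  by (rule flinearI)
    (simp_all add: assms[THEN flinear_add] assms[THEN flinear_scale] fs.scale_right_distrib)

lemma flinear_fscale:
  assumes "flinear L"
  shows "flinear (\<lambda>x. fscale c (L x))"
  by (rule flinearI)
    (simp_all add: flinear_add[OF assms] flinear_scale[OF assms] fs.scale_right_distrib mult.commute)

lemma flinear_setsum:
  assumes "\<And>i. i \<in> I \<Longrightarrow> flinear (L i)"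
  shows "flinear (\<lambda>x. \<Sum>i\<in>I. L i x)"
  by (rule flinearI)
    (simp_all add: assms[THEN flinear_add] assms[THEN flinear_scale] fs.scale_sum_right sum.distrib
      cong: sum.cong)

lemma flinear_funpow: "flinear (L :: ('x \<Rightarrow> 'k::field) \<Rightarrow> ('x \<Rightarrow> 'k)) \<Longrightarrow> flinear (L ^^ n)"
proof (induction n)
  case 0
  then show ?case by (simp add: id_def flinear_id)
next
  case (Suc n)
  then show ?case using flinear_compose[of L "L ^^ n"] by (simp add: comp_def)
qed

lemma flinear_eq_on_span:
  assumes "flinear L" "flinear M" "x \<in> fs.span B" "\<And>b. b \<in> B \<Longrightarrow> L b = M b"
  shows "L x = M x"
  using fsp.linear_eq_on_span[OF assms(1,2)] assms(3,4) by blast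

lemma flinear_span_into:
  assumes "flinear L" "\<And>b. b \<in> B \<Longrightarrow> L b \<in> fs.span C" "x \<in> fs.span B"
  shows "L x \<in> fs.span C"
  using assms(3)
proof (induction rule: fs.span_induct_alt)
  case base
  show ?case unfolding flinear_0[OF assms(1)] by (rule fs.span_zero)
next
  case (step c x y)
  then show ?case
    unfolding flinear_add[OF assms(1)] flinear_scale[OF assms(1)]
    using assms(2) by (intro fs.span_add fs.span_scale)
qed

text \<open>\<open>linear_ext\<close> is a Hilbert choice, so one linear map \<open>L\<close> with
  the prescribed values is all that has to be exhibited. The chosen map may differ from
  \<open>L\<close>; the two agree on the span of the vectors \<open>u i\<close>.\<close>

lemma linear_ext_works:
  assumes "Vector_Spaces.linear sa sb L" "\<And>i. i \<in> I \<Longrightarrow> L (u i) = g i"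
  shows "Vector_Spaces.linear sa sb (linear_ext sa sb I u g)"
    and "\<And>i. i \<in> I \<Longrightarrow> linear_ext sa sb I u g (u i) = g i"
proof -
  have "\<exists>L. Vector_Spaces.linear sa sb L \<and> (\<forall>i\<in>I. L (u i) = g i)"
    using assms by blast
  then have "Vector_Spaces.linear sa sb (linear_ext sa sb I u g) \<and>
      (\<forall>i\<in>I. linear_ext sa sb I u g (u i) = g i)"
    unfolding linear_ext_def by (rule someI_ex)
  then show "Vector_Spaces.linear sa sb (linear_ext sa sb I u g)"
    and "\<And>i. i \<in> I \<Longrightarrow> linear_ext sa sb I u g (u i) = g i" by auto
qed

lemma sum_list_fscale_right: "fscale c (\<Sum>i\<leftarrow>I. x i) = (\<Sum>i\<leftarrow>I. fscale c (x i))"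
  by (induction I) (simp_all add: fs.scale_right_distrib)

lemma fs_span_sum_list: "(\<And>i. i \<in> set I \<Longrightarrow> f i \<in> fs.span B) \<Longrightarrow> (\<Sum>i\<leftarrow>I. f i) \<in> fs.span B"
  by (induction I) (simp_all add: fs.span_zero fs.span_add)

section \<open>Bilinear maps between function spaces\<close>

definition fbilinear ::
  "(('x \<Rightarrow> 'k::field) \<Rightarrow> ('y \<Rightarrow> 'k) \<Rightarrow> ('z \<Rightarrow> 'k)) \<Rightarrow> bool" where
  "fbilinear \<beta> \<longleftrightarrow> (\<forall>s. flinear (\<beta> s)) \<and> (\<forall>t. flinear (\<lambda>s. \<beta> s t))"

lemma fbilinear_eq_on_span:
  assumes "fbilinear \<beta>" "fbilinear \<gamma>" "s \<in> fs.span A" "t \<in> fs.span B"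
    "\<And>a b. a \<in> A \<Longrightarrow> b \<in> B \<Longrightarrow> \<beta> a b = \<gamma> a b"
  shows "\<beta> s t = \<gamma> s t"
proof -
  have "\<beta> a t = \<gamma> a t" if "a \<in> A" for a
    using assms(1,2,4,5) that
    by (intro flinear_eq_on_span[of "\<beta> a" "\<gamma> a" t B]) (auto simp: fbilinear_def)
  then show ?thesis
    using assms(1-3)
    by (intro flinear_eq_on_span[of "\<lambda>s. \<beta> s t" "\<lambda>s. \<gamma> s t" s A]) (auto simp: fbilinear_def)
qed

section \<open>Universal properties of the tensor products\<close>

lemma bilinear_map_fscale_iff:
  "bilinear_map fscale fscale (*) f \<longleftrightarrow>
    (\<forall>s t u. f s (t + u) = f s t + f s u) \<and> (\<forall>s c t. f s (fscale c t) = c * f s t) \<and>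
    (\<forall>s t u. f (s + t) u = f s u + f t u) \<and> (\<forall>c s t. f (fscale c s) t = c * f s t)"
  for f :: "('x \<Rightarrow> 'k::field) \<Rightarrow> ('y \<Rightarrow> 'k) \<Rightarrow> 'k"
proof -
  have k: "vector_space ((*) :: 'k \<Rightarrow> 'k \<Rightarrow> 'k)"
    by standard (auto simp: algebra_simps)
  show ?thesis
    unfolding bilinear_map_def Vector_Spaces.linear_iff by (simp add: k vector_space_fscale) blast
qed

text \<open>The guard in \<open>tensor_prod\<close> makes this unconditional: on forms that are not
  bilinear all values are zero.\<close>

lemma fbilinear_tensor_prod: "fbilinear (\<lambda>s t. s \<otimes> t)"
  unfolding fbilinear_def
  by (intro conjI allI flinearI)
    (auto simp: tensor_prod_def fun_eq_iff fscale_def pointwise bilinear_map_fscale_iff)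

lemma
  assumes "fbilinear \<beta>"
  shows fbilinear_add: "\<beta> (s + s') t = \<beta> s t + \<beta> s' t" "\<beta> s (t + t') = \<beta> s t + \<beta> s t'"
    and fbilinear_scale: "\<beta> (fscale c s) t = fscale c (\<beta> s t)" "\<beta> s (fscale c t) = fscale c (\<beta> s t)"
    and fbilinear_zero: "\<beta> 0 t = 0" "\<beta> s 0 = 0"
    and fbilinear_sum:
      "\<beta> (\<Sum>i\<in>I. x i) (\<Sum>j\<in>J. y j) = (\<Sum>i\<in>I. \<Sum>j\<in>J. \<beta> (x i) (y j))"
    and fbilinear_sum_list:
      "\<beta> (\<Sum>i\<leftarrow>K. x i) (\<Sum>j\<leftarrow>L. y j) = (\<Sum>i\<leftarrow>K. \<Sum>j\<leftarrow>L. \<beta> (x i) (y j))"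
proof -
  have l: "flinear (\<beta> s)" "flinear (\<lambda>s. \<beta> s t)" for s t
    using assms by (simp_all add: fbilinear_def)
  show "\<beta> (s + s') t = \<beta> s t + \<beta> s' t" "\<beta> s (t + t') = \<beta> s t + \<beta> s t'"
    "\<beta> (fscale c s) t = fscale c (\<beta> s t)" "\<beta> s (fscale c t) = fscale c (\<beta> s t)"
    "\<beta> 0 t = 0" "\<beta> s 0 = 0"
    by (rule l[THEN flinear_add] l[THEN flinear_scale] l[THEN flinear_0])+
  show "\<beta> (\<Sum>i\<in>I. x i) (\<Sum>j\<in>J. y j) = (\<Sum>i\<in>I. \<Sum>j\<in>J. \<beta> (x i) (y j))"
    by (simp only: flinear_sum[OF l(1)] flinear_sum[OF l(2)])
      (simp only: sum.swap[of _ J I])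
  show "\<beta> (\<Sum>i\<leftarrow>K. x i) (\<Sum>j\<leftarrow>L. y j) = (\<Sum>i\<leftarrow>K. \<Sum>j\<leftarrow>L. \<beta> (x i) (y j))"
    by (subst flinear_sum_list[OF l(2)], subst flinear_sum_list[OF l(1)]) simp
qed

lemma fbilinearI:
  assumes "\<And>s s' t. \<beta> (s + s') t = \<beta> s t + \<beta> s' t" "\<And>s t t'. \<beta> s (t + t') = \<beta> s t + \<beta> s t'"
    "\<And>c s t. \<beta> (fscale c s) t = fscale c (\<beta> s t)" "\<And>c s t. \<beta> s (fscale c t) = fscale c (\<beta> s t)"
  shows "fbilinear \<beta>"
  unfolding fbilinear_def using assms by (intro conjI allI flinearI)

lemma fbilinear_compose:
  assumes "flinear L" "fbilinear \<beta>"
  shows "fbilinear (\<lambda>s t. L (\<beta> s t))"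
  by (rule fbilinearI)
    (simp_all only: fbilinear_add[OF assms(2)] fbilinear_scale[OF assms(2)]
      flinear_add[OF assms(1)] flinear_scale[OF assms(1)])

lemma fbilinear_compose2:
  assumes "fbilinear \<beta>" "flinear L" "flinear M"
  shows "fbilinear (\<lambda>s t. \<beta> (L s) (M t))"
  by (rule fbilinearI)
    (simp_all only: fbilinear_add[OF assms(1)] fbilinear_scale[OF assms(1)]
      assms(2,3)[THEN flinear_add] assms(2,3)[THEN flinear_scale])

text \<open>The transpose of the pullback of forms along \<open>A\<close> and \<open>B\<close>,
  which is linear without any choice. The guard matters because the pullback of a form can be
  bilinear although the form itself fails to be so outside the ranges of \<open>A\<close> and
  \<open>B\<close>.\<close>

definition tensor_map ::
  "(('k::field, 'v) tensor \<Rightarrow> ('k, 'v) tensor) \<Rightarrow> (('k, 'v) tensor \<Rightarrow> ('k, 'v) tensor) \<Rightarrow>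
    ('k, 'v) tensor2 \<Rightarrow> ('k, 'v) tensor2" where
  "tensor_map A B \<phi> =
    (\<lambda>f. if bilinear_map fscale fscale (*) f then \<phi> (\<lambda>s t. f (A s) (B t)) else 0)"

lemma flinear_tensor_map: "flinear (tensor_map A B)"
  by (rule flinearI) (auto simp: tensor_map_def fun_eq_iff fscale_def pointwise)

lemma tensor_map_prod:
  fixes A B :: "('k::field, 'v) tensor \<Rightarrow> ('k, 'v) tensor"
  assumes "flinear A" "flinear B"
  shows "tensor_map A B (s \<otimes> t) = A s \<otimes> B t"
proof -
  have "bilinear_map fscale fscale (*) (\<lambda>s t. f (A s) (B t))"
    if "bilinear_map fscale fscale (*) f" for f :: "('k,'v) tensor \<Rightarrow> ('k,'v) tensor \<Rightarrow> 'k"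
    using that
    by (simp add: bilinear_map_fscale_iff assms[THEN flinear_add] assms[THEN flinear_scale])
  then show ?thesis by (auto simp: tensor_map_def tensor_prod_def fun_eq_iff)
qed

context graded_lcs
begin

text \<open>This is one multilinear map for each word length: the equations relate only words of
  equal length, so a function may be cut off to a single length, as happens in
  \<open>degree_part\<close>.\<close>

definition multilin :: "('v list \<Rightarrow> ('x \<Rightarrow> 'k)) \<Rightarrow> bool" where
  "multilin g \<longleftrightarrow> (\<forall>xs u v ys. g (xs @ (u + v) # ys) = g (xs @ u # ys) + g (xs @ v # ys)) \<and>
     (\<forall>xs c v ys. g (xs @ scale c v # ys) = fscale c (g (xs @ v # ys)))"

lemma multilinear_iff:
  "multilinear f \<longleftrightarrow> (\<forall>xs u v ys. f (xs @ (u + v) # ys) = f (xs @ u # ys) + f (xs @ v # ys)) \<and>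
     (\<forall>xs c v ys. f (xs @ scale c v # ys) = c * f (xs @ v # ys))"
proof -
  have k: "vector_space ((*) :: 'k \<Rightarrow> 'k \<Rightarrow> 'k)"
    by standard (auto simp: algebra_simps)
  show ?thesis
    unfolding multilinear_def Vector_Spaces.linear_iff
    using k vector_space_axioms by blast
qed

lemma multilin_iff: "multilin g \<longleftrightarrow> (\<forall>x. multilinear (\<lambda>vs. g vs x))"
  by (auto simp: multilin_def multilinear_iff fscale_def fun_eq_iff pointwise)

lemma multilin_tens: "multilin tens"
  by (auto simp: multilin_def tens_def multilinear_iff fun_eq_iff fscale_def pointwise)

lemma multilin_zero: "multilin g \<Longrightarrow> 0 \<in> set vs \<Longrightarrow> g vs = 0"
proof -
  assume g: "multilin g" and "0 \<in> set vs"
  then obtain xs ys where "vs = xs @ 0 # ys" by (meson split_list)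
  moreover have "g (xs @ scale 0 0 # ys) = fscale 0 (g (xs @ 0 # ys))"
    using g unfolding multilin_def by blast
  ultimately show ?thesis by simp
qed

lemma tens_add: "tens (xs @ (u + v) # ys) = tens (xs @ u # ys) + tens (xs @ v # ys)"
  and tens_scale: "tens (xs @ scale c v # ys) = fscale c (tens (xs @ v # ys))"
  using multilin_tens by (auto simp: multilin_def)

definition tensors :: "('k, 'v) tensor set" where
  "tensors = fs.span (range tens)"

lemma tens_in_tensors [simp]: "tens vs \<in> tensors"
  by (auto simp: tensors_def intro: fs.span_base)

lemma tensors_add: "s \<in> tensors \<Longrightarrow> t \<in> tensors \<Longrightarrow> s + t \<in> tensors"
  and tensors_scale: "s \<in> tensors \<Longrightarrow> fscale c s \<in> tensors"
  and tensors_zero [simp]: "0 \<in> tensors"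
  and tensors_sum: "(\<And>i. i \<in> I \<Longrightarrow> f i \<in> tensors) \<Longrightarrow> (\<Sum>i\<in>I. f i) \<in> tensors"
  by (auto simp: tensors_def fs.span_add fs.span_scale fs.span_zero intro: fs.span_sum)

lemma tensors_induct [consumes 1, case_names zero step]:
  assumes "t \<in> tensors" "Q 0" "\<And>c vs t. t \<in> tensors \<Longrightarrow> Q t \<Longrightarrow> Q (fscale c (tens vs) + t)"
  shows "Q t"
proof -
  have "t \<in> fs.span (range tens)" using assms(1) by (simp add: tensors_def)
  then have "t \<in> tensors \<and> Q t"
  proof (induction rule: fs.span_induct_alt)
    case base
    show ?case using assms(2) by simp
  next
    case (step c x y)
    then obtain vs where "x = tens vs" by blast
    then show ?case using step assms(3) by (simp add: tensors_add tensors_scale)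
  qed
  then show ?thesis ..
qed

lemma flinear_eq_on_tensors:
  "flinear L \<Longrightarrow> flinear M \<Longrightarrow> t \<in> tensors \<Longrightarrow> (\<And>vs. L (tens vs) = M (tens vs)) \<Longrightarrow> L t = M t"
  using flinear_eq_on_span[of L M t "range tens"] unfolding tensors_def by blast

text \<open>An arbitrary functional need not be additive in the form that it is applied to, but
  combinations of evaluations at words are. This is what makes it possible to apply two tensors one
  after the other to a form in two words.\<close>

lemma tensors_apply_linear:
  assumes "t \<in> tensors" "multilinear f" "multilinear g"
  shows "t (\<lambda>vs. f vs + g vs) = t f + t g" "t (\<lambda>vs. c * f vs) = c * t f"
proof -
  have *: "multilinear (\<lambda>vs. f vs + g vs)" "multilinear (\<lambda>vs. c * f vs)"
    using assms(2,3) by (auto simp: multilinear_iff algebra_simps)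
  show "t (\<lambda>vs. f vs + g vs) = t f + t g" "t (\<lambda>vs. c * f vs) = c * t f"
    using assms(1) by (induction rule: tensors_induct)
      (use assms(2,3) * in \<open>auto simp: tens_def fscale_def pointwise algebra_simps\<close>)
qed

definition lift :: "('v list \<Rightarrow> ('x \<Rightarrow> 'k)) \<Rightarrow> ('k, 'v) tensor \<Rightarrow> ('x \<Rightarrow> 'k)" where
  "lift g = linear_ext fscale fscale UNIV tens g"

text \<open>The witness for the choice in \<open>linear_ext\<close> is evaluation: a functional is
  sent to its values on the coordinate forms of \<open>g\<close>, and this is linear in the
  functional for trivial reasons.\<close>

lemma
  assumes "multilin g"
  shows flinear_lift: "flinear (lift g)" and lift_tens: "lift g (tens vs) = g vs"
proof -
  define L where "L = (\<lambda>\<phi> :: ('k, 'v) tensor. \<lambda>x. \<phi> (\<lambda>vs. g vs x))"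
  have "flinear L" by (rule flinearI) (auto simp: L_def fscale_def fun_eq_iff pointwise)
  moreover have "\<And>vs. L (tens vs) = g vs"
    using assms by (auto simp: L_def tens_def multilin_iff)
  ultimately show "flinear (lift g)" "lift g (tens vs) = g vs"
    unfolding lift_def by (auto intro: linear_ext_works)
qed

text \<open>Functionals on tensors need not be linear, so bilinearity of the form below is enforced by
  projecting both arguments onto the span of the elementary tensors.\<close>

lemma ex_bilinear_form:
  fixes h :: "'v list \<Rightarrow> 'v list \<Rightarrow> 'k"
  assumes h1: "\<And>ws. multilinear (\<lambda>vs. h vs ws)" and h2: "\<And>vs. multilinear (h vs)"
  shows "\<exists>\<beta>. bilinear_map fscale fscale (*) \<beta> \<and> (\<forall>vs ws. \<beta> (tens vs) (tens ws) = h vs ws)"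
proof -
  obtain B where B: "B \<subseteq> range tens" "fs.independent B" "range tens \<subseteq> fs.span B"
    using fs.maximal_independent_subset by blast
  have sB: "fs.span B = tensors"
    using B by (simp add: tensors_def fs.span_eq fs.span_superset subset_antisym)
      (meson fs.span_superset order.trans)
  \<comment> \<open>A projection onto \<open>tensors\<close>: the identity on a basis, with the span
    of that basis as its range.\<close>
  obtain E :: "('k, 'v) tensor \<Rightarrow> ('k, 'v) tensor"
    where E: "flinear E" "\<forall>x\<in>B. E x = x" "range E = fs.span ((\<lambda>x. x) ` B)"
    using fsp.linear_independent_extend_subspace[OF B(2), of "\<lambda>x. x"] by blast
  have Et: "E t \<in> tensors" for t using E(3) sB by auto
  have Eid: "E t = t" if "t \<in> tensors" for t
    using flinear_eq_on_span[OF E(1) flinear_id, of t B] that sB E(2) by auto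
  have inner: "multilinear (\<lambda>vs. E t (\<lambda>ws. h vs ws))" for t
  proof -
    have "h (xs @ (u + v) # ys) = (\<lambda>ws. h (xs @ u # ys) ws + h (xs @ v # ys) ws)"
      "h (xs @ scale c v # ys) = (\<lambda>ws. c * h (xs @ v # ys) ws)" for xs u v ys c
      using h1 by (auto simp: multilinear_iff)
    then show ?thesis
      unfolding multilinear_iff
      by (simp add: tensors_apply_linear(1)[OF Et h2 h2] tensors_apply_linear(2)[OF Et h2 h2])
  qed
  define \<beta> where "\<beta> = (\<lambda>s t. E s (\<lambda>vs. E t (\<lambda>ws. h vs ws)))"
  have "bilinear_map fscale fscale (*) \<beta>"
    unfolding bilinear_map_fscale_iff \<beta>_def
    using E(1) tensors_apply_linear(1)[OF Et inner inner] tensors_apply_linear(2)[OF Et inner inner]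
    by (simp add: flinear_add[OF E(1)] flinear_scale[OF E(1)]) (simp add: fscale_def pointwise)
  moreover have "\<beta> (tens vs) (tens ws) = h vs ws" for vs ws
    using h1 h2 inner[of "tens ws"] by (simp add: \<beta>_def Eid) (simp add: tens_def)
  ultimately show ?thesis by blast
qed

definition lift2 :: "('v list \<Rightarrow> 'v list \<Rightarrow> ('x \<Rightarrow> 'k)) \<Rightarrow> ('k, 'v) tensor2 \<Rightarrow> ('x \<Rightarrow> 'k)" where
  "lift2 h = linear_ext fscale fscale UNIV (\<lambda>(vs, ws). tens vs \<otimes> tens ws) (\<lambda>(vs, ws). h vs ws)"

text \<open>At every point \<open>x\<close> of the codomain, \<open>h\<close> gives a bilinear form
  on tensors by \<open>ex_bilinear_form\<close>. Evaluating a functional at all these forms is the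
  required linear map.\<close>

lemma
  assumes h1: "\<And>ws. multilin (\<lambda>vs. h vs ws)" and h2: "\<And>vs. multilin (h vs)"
  shows flinear_lift2: "flinear (lift2 h)"
    and lift2_tens: "lift2 h (tens vs \<otimes> tens ws) = h vs ws"
proof -
  have "\<exists>\<beta>. bilinear_map fscale fscale (*) \<beta> \<and> (\<forall>vs ws. \<beta> (tens vs) (tens ws) = h vs ws x)" for x
    by (rule ex_bilinear_form) (use h1 h2 in \<open>auto simp: multilin_iff\<close>)
  then obtain \<beta> where \<beta>: "\<And>x. bilinear_map fscale fscale (*) (\<beta> x)"
    "\<And>x vs ws. \<beta> x (tens vs) (tens ws) = h vs ws x"
    by metis
  define L where "L = (\<lambda>\<phi> :: ('k, 'v) tensor2. \<lambda>x. \<phi> (\<beta> x))"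
  have "flinear L" by (rule flinearI) (auto simp: L_def fscale_def fun_eq_iff pointwise)
  moreover have "L (tens vs \<otimes> tens ws) = h vs ws" for vs ws
    using \<beta> by (auto simp: L_def tensor_prod_def)
  ultimately have *: "flinear (lift2 h)"
    "(case p of (vs, ws) \<Rightarrow> lift2 h (tens vs \<otimes> tens ws)) = (case p of (vs, ws) \<Rightarrow> h vs ws)" for p
    using linear_ext_works[of fscale fscale L UNIV "\<lambda>(vs, ws). tens vs \<otimes> tens ws" "\<lambda>(vs, ws). h vs ws"]
    unfolding lift2_def by (simp_all add: split_def)
  show "flinear (lift2 h)" by (rule *(1))
  show "lift2 h (tens vs \<otimes> tens ws) = h vs ws" using *(2)[of "(vs, ws)"] by simp
qed

subsection \<open>Concatenation\<close>

lemma concat_tensor_eq: "concat_tensor = lift2 (\<lambda>vs ws. tens (vs @ ws))"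
  by (simp add: concat_tensor_def lift2_def)

lemma multilin_append: "multilin (\<lambda>vs. tens (vs @ ws))" "multilin (\<lambda>ws. tens (vs @ ws))"
  using multilin_tens by (auto simp: multilin_def) (metis append.assoc)+

lemma flinear_concat_tensor: "flinear concat_tensor"
  unfolding concat_tensor_eq by (rule flinear_lift2) (rule multilin_append)+

definition tconc :: "('k, 'v) tensor \<Rightarrow> ('k, 'v) tensor \<Rightarrow> ('k, 'v) tensor" where
  "tconc s t = concat_tensor (s \<otimes> t)"

lemma tconc_tens [simp]: "tconc (tens vs) (tens ws) = tens (vs @ ws)"
  unfolding tconc_def concat_tensor_eq by (rule lift2_tens) (rule multilin_append)+

lemma fbilinear_tconc: "fbilinear tconc"
  using fbilinear_compose[OF flinear_concat_tensor fbilinear_tensor_prod]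
  by (simp add: tconc_def[abs_def])

lemma flinear_tconc: "flinear (tconc s)" "flinear (\<lambda>s. tconc s t)"
  using fbilinear_tconc by (auto simp: fbilinear_def)

lemma tconc_in_tensors [simp]: "s \<in> tensors \<Longrightarrow> t \<in> tensors \<Longrightarrow> tconc s t \<in> tensors"
proof -
  assume s: "s \<in> tensors" and t: "t \<in> tensors"
  have "tconc (tens vs) t \<in> tensors" for vs
    using flinear_span_into[OF flinear_tconc(1)] t unfolding tensors_def
    by (smt (verit, best) tconc_tens fs.span_base imageE rangeI)
  then show ?thesis
    using flinear_span_into[OF flinear_tconc(2)] s unfolding tensors_def by blast
qed

lemma tconc_assoc:
  assumes "s \<in> tensors" "t \<in> tensors" "u \<in> tensors"
  shows "tconc (tconc s t) u = tconc s (tconc t u)"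
proof -
  have 1: "tconc (tconc (tens vs) (tens ws)) u = tconc (tens vs) (tconc (tens ws) u)" for vs ws
    by (rule flinear_eq_on_tensors[OF flinear_tconc(1) flinear_compose[OF flinear_tconc(1) flinear_tconc(1)]])
      (use assms in auto)
  have 2: "tconc (tconc (tens vs) t) u = tconc (tens vs) (tconc t u)" for vs
    by (rule flinear_eq_on_tensors[OF flinear_compose[OF flinear_tconc(2) flinear_tconc(1)]
          flinear_compose[OF flinear_tconc(1) flinear_tconc(2)]])
      (use assms 1 in auto)
  show ?thesis
    by (rule flinear_eq_on_tensors[OF flinear_compose[OF flinear_tconc(2) flinear_tconc(2)] flinear_tconc(2)])
      (use assms 2 in auto)
qed

lemma tconc_Nil [simp]: "t \<in> tensors \<Longrightarrow> tconc t (tens []) = t" "t \<in> tensors \<Longrightarrow> tconc (tens []) t = t"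
  by (auto intro: flinear_eq_on_tensors[OF flinear_tconc(2) flinear_id]
      flinear_eq_on_tensors[OF flinear_tconc(1) flinear_id])

subsection \<open>Degree\<close>

lemma degree_part_eq: "degree_part n = lift (\<lambda>vs. if length vs = n then tens vs else 0)"
  by (simp add: degree_part_def lift_def)

lemma multilin_degree: "multilin (\<lambda>vs. if length vs = n then tens vs else 0)"
  using multilin_tens by (auto simp: multilin_def)

lemma flinear_degree_part: "flinear (degree_part n)"
  and degree_part_tens: "degree_part n (tens vs) = (if length vs = n then tens vs else 0)"
  unfolding degree_part_eq using flinear_lift lift_tens multilin_degree by blast+

lemma tensor_power_subset: "t \<in> tensor_power n \<Longrightarrow> t \<in> tensors"
  unfolding tensor_power_def tensors_def using fs.span_mono[of "tens ` _" "range tens"] by blast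

lemma tens_in_tensor_power: "length vs = n \<Longrightarrow> tens vs \<in> tensor_power n"
  unfolding tensor_power_def by (auto intro: fs.span_base)

lemma degree_part_in_tensor_power: "t \<in> tensors \<Longrightarrow> degree_part n t \<in> tensor_power n"
  unfolding tensors_def tensor_power_def
  by (rule flinear_span_into[OF flinear_degree_part])
    (auto simp: degree_part_tens fs.span_zero intro: fs.span_base[OF imageI])

lemma degree_part_tensor_power:
  assumes "t \<in> tensor_power n"
  shows "degree_part m t = (if m = n then t else 0)"
proof (cases "m = n")
  case True
  then show ?thesis
    using flinear_eq_on_span[OF flinear_degree_part flinear_id, of t] assms
    by (force simp: tensor_power_def degree_part_tens)
next
  case False
  from flinear_eq_on_span[OF flinear_degree_part flinear_zero, of t] show ?thesis
    using assms False by (force simp: tensor_power_def degree_part_tens)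
qed

text \<open>Stated for every \<open>M\<close> from \<open>N\<close> on, so that the induction step
  can enlarge the range until it contains the degree of the added word.\<close>

lemma degree_part_bound:
  assumes "t \<in> tensors"
  obtains N where "\<And>M. M \<ge> N \<Longrightarrow> t = (\<Sum>n<M. degree_part n t)" "\<And>n. n \<ge> N \<Longrightarrow> degree_part n t = 0"
proof -
  have "\<exists>N. (\<forall>M\<ge>N. t = (\<Sum>n<M. degree_part n t)) \<and> (\<forall>n\<ge>N. degree_part n t = 0)"
    using assms
  proof (induction rule: tensors_induct)
    case zero
    then show ?case by (simp add: flinear_0[OF flinear_degree_part])
  next
    case (step c vs t)
    then obtain N where N: "\<And>M. M \<ge> N \<Longrightarrow> t = (\<Sum>n<M. degree_part n t)" "\<And>n. n \<ge> N \<Longrightarrow> degree_part n t = 0"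
      by blast
    have "(\<Sum>n<M. fscale c (degree_part n (tens vs))) = fscale c (tens vs)" if "M \<ge> Suc (length vs)" for M
      using that by (simp add: degree_part_tens if_distrib[of "fscale c"] sum.delta' cong: if_cong)
    then show ?case
      using N
      by (intro exI[of _ "max N (Suc (length vs))"])
        (auto simp: flinear_add[OF flinear_degree_part] flinear_scale[OF flinear_degree_part]
          sum.distrib degree_part_tens)
  qed
  then show thesis using that by blast
qed

lemma finite_degree_support: "t \<in> tensors \<Longrightarrow> finite {n. degree_part n t \<noteq> 0}"
  by (rule degree_part_bound[of t]) (auto simp: finite_nat_set_iff_bounded not_le[symmetric])

subsection \<open>Homogeneous components\<close>

abbreviation proj0 :: "'v \<Rightarrow> 'v" where "proj0 \<equiv> component_along V0 V1"
abbreviation proj1 :: "'v \<Rightarrow> 'v" where "proj1 \<equiv> component_along V1 V0"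

text \<open>Two decompositions differ by a vector in both \<open>V0\<close> and \<open>V1\<close>,
  hence by zero; this resolves the definite description in \<open>component_along\<close>.\<close>

lemma proj_unique:
  assumes "x \<in> V0" "y \<in> V1"
  shows "proj0 (x + y) = x" "proj1 (x + y) = y"
proof -
  have *: "x' = x \<and> y' = y" if "x' \<in> V0" "y' \<in> V1" "x' + y' = x + y" for x' y'
  proof -
    have eq: "x' - x = y - y'" using that(3) by (simp add: algebra_simps)
    have "x' - x \<in> V0" "y - y' \<in> V1"
      by (rule subspace_diff[OF subspace_V0 that(1) assms(1)],
          rule subspace_diff[OF subspace_V1 assms(2) that(2)])
    then have "x' - x \<in> V0 \<inter> V1" "y - y' \<in> V0 \<inter> V1" unfolding eq by blast+
    then show ?thesis unfolding direct by simp
  qed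
  show "proj0 (x + y) = x" unfolding component_along_def
  proof (rule the_equality)
    fix x' assume "x' \<in> V0 \<and> x + y - x' \<in> V1"
    then show "x' = x" using *[of x' "x + y - x'"] by (metis add_diff_cancel_left' add.commute diff_add_cancel)
  qed (use assms in simp)
  show "proj1 (x + y) = y" unfolding component_along_def
  proof (rule the_equality)
    fix y' assume "y' \<in> V1 \<and> x + y - y' \<in> V0"
    then show "y' = y" using *[of "x + y - y'" y'] by (metis diff_add_cancel)
  qed (use assms in simp)
qed

lemma proj_in [simp]: "proj0 v \<in> V0" "proj1 v \<in> V1"
  and proj_sum: "proj0 v + proj1 v = v"
  using decomposition[of v] proj_unique by auto

lemma zero_in_V [simp]: "0 \<in> V0" "0 \<in> V1"
  using direct by auto

lemma proj_hom [simp]: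
  "v \<in> V0 \<Longrightarrow> proj0 v = v" "v \<in> V0 \<Longrightarrow> proj1 v = 0"
  "v \<in> V1 \<Longrightarrow> proj1 v = v" "v \<in> V1 \<Longrightarrow> proj0 v = 0"
  using proj_unique[of v 0] proj_unique[of 0 v] by auto

lemma proj_add: "proj0 (u + v) = proj0 u + proj0 v" "proj1 (u + v) = proj1 u + proj1 v"
proof -
  have eq: "u + v = (proj0 u + proj0 v) + (proj1 u + proj1 v)"
    by (subst add.assoc, subst add.left_commute[of "proj0 v"], subst add.assoc[symmetric])
      (simp only: proj_sum)
  have "proj0 u + proj0 v \<in> V0" "proj1 u + proj1 v \<in> V1"
    by (auto intro!: subspace_add[OF subspace_V0] subspace_add[OF subspace_V1])
  from proj_unique[OF this, folded eq]
  show "proj0 (u + v) = proj0 u + proj0 v" "proj1 (u + v) = proj1 u + proj1 v" .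
qed

lemma proj_scale: "proj0 (scale c v) = scale c (proj0 v)" "proj1 (scale c v) = scale c (proj1 v)"
proof -
  have eq: "scale c v = scale c (proj0 v) + scale c (proj1 v)"
    by (metis proj_sum scale_right_distrib)
  have "scale c (proj0 v) \<in> V0" "scale c (proj1 v) \<in> V1"
    by (auto intro!: subspace_scale[OF subspace_V0] subspace_scale[OF subspace_V1])
  from proj_unique[OF this, folded eq]
  show "proj0 (scale c v) = scale c (proj0 v)" "proj1 (scale c v) = scale c (proj1 v)" .
qed

lemma homogeneous_simps [simp]:
  "homogeneous []" "homogeneous (v # vs) \<longleftrightarrow> v \<in> V0 \<union> V1 \<and> homogeneous vs"
  "homogeneous (vs @ ws) \<longleftrightarrow> homogeneous vs \<and> homogeneous ws"
  by (auto simp: homogeneous_def)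

text \<open>The terms of the distributive expansion of a word: every letter contributes its even or
  its odd component, either of which may be zero.\<close>

fun homs :: "'v list \<Rightarrow> 'v list list" where
  "homs [] = [[]]"
| "homs (v # vs) = map ((#) (proj0 v)) (homs vs) @ map ((#) (proj1 v)) (homs vs)"

lemma homs_hom: "ws \<in> set (homs vs) \<Longrightarrow> homogeneous ws \<and> length ws = length vs"
  by (induction vs arbitrary: ws) auto

lemma tens_homs: "tens vs = (\<Sum>ws\<leftarrow>homs vs. tens ws)"
proof -
  have "tens (xs @ vs) = (\<Sum>ws\<leftarrow>homs vs. tens (xs @ ws))" for xs
  proof (induction vs arbitrary: xs)
    case (Cons v vs)
    have "tens (xs @ v # vs) = tens (xs @ proj0 v # vs) + tens (xs @ proj1 v # vs)"
      by (metis proj_sum tens_add)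
    then show ?case
      using Cons[of "xs @ [proj0 v]"] Cons[of "xs @ [proj1 v]"] by (simp add: comp_def)
  qed simp
  from this[of "[]"] show ?thesis by simp
qed

lemma tensor_power_hom: "tensor_power n = fs.span (tens ` {vs. homogeneous vs \<and> length vs = n})"
proof
  have "tens vs \<in> fs.span (tens ` {vs. homogeneous vs \<and> length vs = n})" if "length vs = n" for vs
    unfolding tens_homs[of vs] using homs_hom[of _ vs] that
    by (intro fs_span_sum_list) (auto intro!: fs.span_base)
  then show "tensor_power n \<subseteq> fs.span (tens ` {vs. homogeneous vs \<and> length vs = n})"
    unfolding tensor_power_def by (intro fs.span_minimal) auto
  show "fs.span (tens ` {vs. homogeneous vs \<and> length vs = n}) \<subseteq> tensor_power n"
    unfolding tensor_power_def by (intro fs.span_mono) auto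
qed

lemma tensors_hom: "tensors = fs.span (tens ` {vs. homogeneous vs})"
proof
  have "tens vs \<in> fs.span (tens ` {vs. homogeneous vs})" for vs
    unfolding tens_homs[of vs] using homs_hom[of _ vs]
    by (intro fs_span_sum_list) (auto intro!: fs.span_base)
  then show "tensors \<subseteq> fs.span (tens ` {vs. homogeneous vs})"
    unfolding tensors_def by (intro fs.span_minimal) auto
  show "fs.span (tens ` {vs. homogeneous vs}) \<subseteq> tensors"
    unfolding tensors_def by (intro fs.span_mono) auto
qed

subsection \<open>The action of permutations\<close>

text \<open>Every letter of the original word occurs exactly once in the permuted word. The maps
  \<open>c j\<close> may depend on the original position \<open>j\<close>; this allows the parity
  projections to be inserted letter by letter.\<close>

lemma multilin_permuted:
  assumes \<sigma>: "\<sigma> permutes {..<n}"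
    and c: "\<And>j u v. c j (u + v) = c j u + c j v" "\<And>j a v. c j (scale a v) = scale a (c j v)"
  shows "multilin (\<lambda>vs. if length vs = n then tens (map (\<lambda>i. c (\<sigma> i) (vs ! \<sigma> i)) [0..<n]) else 0)"
proof -
  have ex: "\<exists>A B. \<forall>v. map (\<lambda>i. c (\<sigma> i) ((xs @ v # ys) ! \<sigma> i)) [0..<n] = A @ c (length xs) v # B"
    if n: "length (xs @ 0 # ys) = n" for xs ys
  proof -
    \<comment> \<open>The place at which the varying letter shows up after the permutation; all
      other places read letters that stay fixed.\<close>
    define m where "m = inv \<sigma> (length xs)"
    have \<sigma>m: "\<sigma> m = length xs" unfolding m_def using \<sigma> by (simp add: permutes_inverses)
    have "m < n"
      using permutes_in_image[OF \<sigma>, of m] \<sigma>m n by simp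
    then have split: "[0..<n] = [0..<m] @ m # [Suc m..<n]"
      by (metis append_Cons append_Nil le0 le_Suc_ex less_imp_le upt_add_eq_append upt_conv_Cons)
    have other: "map (\<lambda>i. c (\<sigma> i) ((xs @ v # ys) ! \<sigma> i)) L = map (\<lambda>i. c (\<sigma> i) ((xs @ 0 # ys) ! \<sigma> i)) L"
      if "m \<notin> set L" for L v
    proof (rule map_cong[OF refl])
      fix i assume "i \<in> set L"
      then have "\<sigma> i \<noteq> length xs" using that \<sigma>m permutes_inj[OF \<sigma>] by (metis injD)
      then show "c (\<sigma> i) ((xs @ v # ys) ! \<sigma> i) = c (\<sigma> i) ((xs @ 0 # ys) ! \<sigma> i)"
        by (auto simp: nth_append nth_Cons')
    qed
    have "map (\<lambda>i. c (\<sigma> i) ((xs @ v # ys) ! \<sigma> i)) [0..<n] =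
      map (\<lambda>i. c (\<sigma> i) ((xs @ 0 # ys) ! \<sigma> i)) [0..<m] @ c (length xs) v #
      map (\<lambda>i. c (\<sigma> i) ((xs @ 0 # ys) ! \<sigma> i)) [Suc m..<n]" for v
      unfolding split map_append list.map \<sigma>m
      by (subst (1 2) other) simp_all
    then show ?thesis by blast
  qed
  have "tens (map (\<lambda>i. c (\<sigma> i) ((xs @ (u + v) # ys) ! \<sigma> i)) [0..<n]) =
      tens (map (\<lambda>i. c (\<sigma> i) ((xs @ u # ys) ! \<sigma> i)) [0..<n]) +
      tens (map (\<lambda>i. c (\<sigma> i) ((xs @ v # ys) ! \<sigma> i)) [0..<n])"
    "tens (map (\<lambda>i. c (\<sigma> i) ((xs @ scale a v # ys) ! \<sigma> i)) [0..<n]) =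
      fscale a (tens (map (\<lambda>i. c (\<sigma> i) ((xs @ v # ys) ! \<sigma> i)) [0..<n]))"
    if len: "length (xs @ 0 # ys) = n" for xs ys u v a
  proof -
    obtain A B where "map (\<lambda>i. c (\<sigma> i) ((xs @ v # ys) ! \<sigma> i)) [0..<n] = A @ c (length xs) v # B" for v
      using ex[OF len] by blast
    then show "tens (map (\<lambda>i. c (\<sigma> i) ((xs @ (u + v) # ys) ! \<sigma> i)) [0..<n]) =
      tens (map (\<lambda>i. c (\<sigma> i) ((xs @ u # ys) ! \<sigma> i)) [0..<n]) +
      tens (map (\<lambda>i. c (\<sigma> i) ((xs @ v # ys) ! \<sigma> i)) [0..<n])"
      "tens (map (\<lambda>i. c (\<sigma> i) ((xs @ scale a v # ys) ! \<sigma> i)) [0..<n]) =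
      fscale a (tens (map (\<lambda>i. c (\<sigma> i) ((xs @ v # ys) ! \<sigma> i)) [0..<n]))"
      by (simp_all add: c tens_add tens_scale)
  qed
  then show ?thesis
    unfolding multilin_def by simp
qed

text \<open>The Koszul sign is not linear in the letters, so a multilinear witness has to be built.
  It sums over all sets \<open>A\<close> of positions: letters in \<open>A\<close> are replaced by
  their odd component, the others by their even component, and the sign is computed as if exactly
  the positions in \<open>A\<close> were odd. On a homogeneous word only the set of its odd
  positions contributes.\<close>

lemma
  assumes \<sigma>: "\<sigma> permutes {..<n}"
  shows flinear_perm_action: "flinear (perm_action n \<sigma>)"
    and perm_action_tens: "homogeneous vs \<Longrightarrow> length vs = n \<Longrightarrow>
      perm_action n \<sigma> (tens vs) = fscale (koszul_sign \<sigma> vs) (tens (map (\<lambda>i. vs ! \<sigma> i) [0..<n]))"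
proof -
  define sg :: "nat set \<Rightarrow> 'k" where
    "sg A = (- 1) ^ card {(i, j). i < j \<and> j < n \<and> \<sigma> i > \<sigma> j \<and> \<sigma> i \<in> A \<and> \<sigma> j \<in> A}" for A
  define g0 :: "nat set \<Rightarrow> 'v list \<Rightarrow> ('k, 'v) tensor" where
    "g0 A vs = (if length vs = n then
      tens (map (\<lambda>i. (if \<sigma> i \<in> A then proj1 else proj0) (vs ! \<sigma> i)) [0..<n]) else 0)" for A vs
  define g :: "'v list \<Rightarrow> ('k, 'v) tensor" where
    "g vs = (\<Sum>A\<in>Pow {..<n}. fscale (sg A) (g0 A vs))" for vs
  have g0: "multilin (g0 A)" for A
    unfolding g0_def
    using multilin_permuted[OF \<sigma>, of "\<lambda>j. if j \<in> A then proj1 else proj0"]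
    by (simp add: proj_add proj_scale)
  have g: "multilin g"
    using g0 unfolding multilin_def g_def
    by (simp add: fs.scale_right_distrib sum.distrib fs.scale_sum_right mult.commute)
  have gtens: "g vs = fscale (koszul_sign \<sigma> vs) (tens (map (\<lambda>i. vs ! \<sigma> i) [0..<n]))"
    if hom: "homogeneous vs" and n: "length vs = n" for vs
  proof -
    define Od where "Od = {j. j < n \<and> parity (vs ! j) = 1}"
    have nth: "vs ! j \<in> V0 \<union> V1" if "j < n" for j
      using hom n that unfolding homogeneous_def by (meson nth_mem subsetD)
    \<comment> \<open>At a position where \<open>A\<close> and \<open>Od\<close> differ, the letter
      is projected to the component that it does not have, so the word contains a zero.\<close>
    have 0: "g0 A vs = 0" if "A \<in> Pow {..<n} - {Od}" for A
    proof -
      obtain j where "j < n" "j \<in> A \<longleftrightarrow> j \<notin> Od"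
        using \<open>A \<in> Pow {..<n} - {Od}\<close> unfolding Od_def by blast
      then have "(if j \<in> A then proj1 else proj0) (vs ! j) = 0"
        using nth[of j] by (auto simp: Od_def parity_def split: if_splits)
      moreover have "inv \<sigma> j < n" "\<sigma> (inv \<sigma> j) = j"
        using \<open>j < n\<close> \<sigma> permutes_in_image[OF permutes_inv[OF \<sigma>], of j]
        by (auto simp: permutes_inverses)
      ultimately have "0 \<in> set (map (\<lambda>i. (if \<sigma> i \<in> A then proj1 else proj0) (vs ! \<sigma> i)) [0..<n])"
        by (auto simp: image_iff intro!: bexI[of _ "inv \<sigma> j"])
      then show ?thesis
        using n multilin_zero[OF multilin_tens] by (simp add: g0_def)
    qed
    have "g vs = (\<Sum>A\<in>{Od}. fscale (sg A) (g0 A vs))"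
      unfolding g_def by (rule sum.mono_neutral_right) (auto simp: Od_def 0)
    also have "\<dots> = fscale (sg Od) (g0 Od vs)" by simp
    also have "sg Od = koszul_sign \<sigma> vs"
    proof -
      have "\<sigma> i \<in> Od \<longleftrightarrow> parity (vs ! \<sigma> i) = 1" if "i < n" for i
        using permutes_in_image[OF \<sigma>, of i] that by (auto simp: Od_def)
      then show ?thesis
        unfolding sg_def koszul_sign_def n
        by (intro arg_cong[where f = "\<lambda>X. (- 1) ^ card X"]) (auto dest: order.strict_trans)
    qed
    also have "g0 Od vs = tens (map (\<lambda>i. vs ! \<sigma> i) [0..<n])"
    proof -
      have "(if \<sigma> i \<in> Od then proj1 else proj0) (vs ! \<sigma> i) = vs ! \<sigma> i" if "i < n" for i
        using permutes_in_image[OF \<sigma>, of i] that nth[of "\<sigma> i"] by (auto simp: Od_def parity_def)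
      then show ?thesis using n by (auto simp: g0_def intro!: arg_cong[where f = tens])
    qed
    finally show ?thesis .
  qed
  note ext = linear_ext_works[where L = "lift g" and I = "{vs. homogeneous vs \<and> length vs = n}"
      and u = tens and sa = fscale and sb = fscale
      and g = "\<lambda>vs. fscale (koszul_sign \<sigma> vs) (tens (map (\<lambda>i. vs ! \<sigma> i) [0..<n]))",
      folded perm_action_def, OF flinear_lift[OF g]]
  show "flinear (perm_action n \<sigma>)"
    by (rule ext(1)) (auto simp: lift_tens[OF g] gtens)
  show "perm_action n \<sigma> (tens vs) = fscale (koszul_sign \<sigma> vs) (tens (map (\<lambda>i. vs ! \<sigma> i) [0..<n]))"
    if "homogeneous vs" "length vs = n"
    by (rule ext(2)) (use that in \<open>auto simp: lift_tens[OF g] gtens\<close>)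
qed

lemma flinear_symmetrizer_n: "flinear (symmetrizer_n n)"
  unfolding symmetrizer_n_def[abs_def]
  by (rule flinear_fscale, rule flinear_setsum) (auto intro: flinear_perm_action)

text \<open>\<open>symmetrizer\<close> sums over the degrees present in its argument, so its
  linearity is not evident. \<open>Sym\<close> is linear on all functionals and agrees with it on
  \<open>tensors\<close>.\<close>

definition Sym :: "('k, 'v) tensor \<Rightarrow> ('k, 'v) tensor" where
  "Sym = lift (\<lambda>vs. symmetrizer_n (length vs) (tens vs))"

lemma flinear_Sym: "flinear Sym" and Sym_tens: "Sym (tens vs) = symmetrizer_n (length vs) (tens vs)"
proof -
  have "multilin (\<lambda>vs. symmetrizer_n (length vs) (tens vs))"
    unfolding multilin_def
    by (simp add: tens_add tens_scale flinear_add[OF flinear_symmetrizer_n]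
        flinear_scale[OF flinear_symmetrizer_n])
  then show "flinear Sym" "Sym (tens vs) = symmetrizer_n (length vs) (tens vs)"
    unfolding Sym_def by (auto intro: flinear_lift lift_tens)
qed

lemma Sym_tensor_power: "t \<in> tensor_power n \<Longrightarrow> Sym t = symmetrizer_n n t"
  unfolding tensor_power_def
  by (rule flinear_eq_on_span[OF flinear_Sym flinear_symmetrizer_n]) (auto simp: Sym_tens)

lemma symmetrizer_eq: "t \<in> tensors \<Longrightarrow> symmetrizer t = Sym t"
proof -
  assume t: "t \<in> tensors"
  then obtain N where N: "\<And>M. M \<ge> N \<Longrightarrow> t = (\<Sum>n<M. degree_part n t)"
    "\<And>n. n \<ge> N \<Longrightarrow> degree_part n t = 0"
    using degree_part_bound by blast
  have "Sym t = (\<Sum>n<N. Sym (degree_part n t))"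
    using N(1)[of N] flinear_sum[OF flinear_Sym, of "\<lambda>n. degree_part n t" "{..<N}"] by simp
  also have "\<dots> = (\<Sum>n<N. symmetrizer_n n (degree_part n t))"
    by (intro sum.cong refl Sym_tensor_power degree_part_in_tensor_power t)
  also have "\<dots> = symmetrizer t"
    unfolding symmetrizer_def
    by (rule sum.mono_neutral_right)
      (auto simp: flinear_0[OF flinear_symmetrizer_n] intro: ccontr N(2) simp flip: not_le)
  finally show ?thesis by simp
qed

subsection \<open>Removing letters from words\<close>

abbreviation par :: "'v list \<Rightarrow> nat" where "par vs \<equiv> sum_list (map parity vs)"

abbreviation del :: "nat \<Rightarrow> 'v list \<Rightarrow> 'v list" where "del k vs \<equiv> take k vs @ drop (Suc k) vs"

text \<open>All ways of moving one letter of a word to the front (\<open>lpeel\<close>) or to the end (\<open>rpeel\<close>),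
  given as Koszul sign, letter and remaining word.\<close>

fun lpeel :: "'v list \<Rightarrow> ('k \<times> 'v \<times> 'v list) list" where
  "lpeel [] = []"
| "lpeel (v # vs) =
    (1, v, vs) # map (\<lambda>(c, w, ws). ((- 1) ^ (parity w * parity v) * c, w, v # ws)) (lpeel vs)"

fun rpeel :: "'v list \<Rightarrow> ('k \<times> 'v \<times> 'v list) list" where
  "rpeel [] = []"
| "rpeel (v # vs) =
    ((- 1) ^ (parity v * par vs), v, vs) # map (\<lambda>(c, w, ws). (c, w, v # ws)) (rpeel vs)"

lemma length_peel [simp]: "length (lpeel vs) = length vs" "length (rpeel vs) = length vs"
  by (induction vs) auto

lemma lpeel_props:
  "(c, w, ws) \<in> set (lpeel vs) \<Longrightarrow> length vs = Suc (length ws) \<and> par vs = parity w + par ws \<and>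
    (homogeneous vs \<longrightarrow> w \<in> V0 \<union> V1 \<and> homogeneous ws)"
  by (induction vs arbitrary: c w ws) force+

lemma rpeel_props:
  "(c, w, ws) \<in> set (rpeel vs) \<Longrightarrow> length vs = Suc (length ws) \<and> par vs = parity w + par ws \<and>
    (homogeneous vs \<longrightarrow> w \<in> V0 \<union> V1 \<and> homogeneous ws)"
  by (induction vs arbitrary: c w ws) force+

lemma lpeel_append:
  "lpeel (xs @ ys) = map (\<lambda>(c, w, ws). (c, w, ws @ ys)) (lpeel xs) @
    map (\<lambda>(c, w, ws). ((- 1) ^ (parity w * par xs) * c, w, xs @ ws)) (lpeel ys)"
proof (induction xs)
  case (Cons v xs)
  then show ?case
    by (simp add: comp_def split_def algebra_simps power_add distrib_left)
qed (simp add: split_def)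

text \<open>Translates the sums over positions in the definition of \<open>P\<close> into sums over
  peelings. \<open>F\<close> is arbitrary so that the induction hypothesis can absorb the extra sign
  and the letter that is put back in front.\<close>

lemma sum_lpeel:
  "(\<Sum>k<length vs. F ((- 1) ^ (parity (vs ! k) * par (take k vs))) (vs ! k) (del k vs)) =
    (\<Sum>(c, w, ws)\<leftarrow>lpeel vs. F c w ws)"
  for F :: "'k \<Rightarrow> 'v \<Rightarrow> 'v list \<Rightarrow> 'a::comm_monoid_add"
proof (induction vs arbitrary: F)
  case (Cons v vs)
  show ?case
    using Cons[of "\<lambda>c w ws. F ((- 1) ^ (parity w * parity v) * c) w (v # ws)"]
    by (simp add: sum.lessThan_Suc_shift power_add distrib_left comp_def split_def del: sum.lessThan_Suc)
qed simp

lemma sum_rpeel: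
  "(\<Sum>k<length vs. F ((- 1) ^ (parity (vs ! k) * par (drop (Suc k) vs))) (vs ! k) (del k vs)) =
    (\<Sum>(c, w, ws)\<leftarrow>rpeel vs. F c w ws)"
  for F :: "'k \<Rightarrow> 'v \<Rightarrow> 'v list \<Rightarrow> 'a::comm_monoid_add"
proof (induction vs arbitrary: F)
  case (Cons v vs)
  show ?case
    using Cons[of "\<lambda>c w ws. F c w (v # ws)"]
    by (simp add: sum.lessThan_Suc_shift comp_def split_def del: sum.lessThan_Suc)
qed simp

text \<open>If \<open>u\<close> stands to the right of \<open>w\<close>, then moving
  \<open>w\<close> to the end and \<open>u\<close> to the front makes the two letters cross exactly
  once, in whichever order this is done; otherwise they never cross. Hence both orders produce the
  same signs.\<close>

lemma rpeel_lpeel: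
  "(\<Sum>(c, w, ws)\<leftarrow>rpeel vs. \<Sum>(d, u, us)\<leftarrow>lpeel ws. fscale (c * d) (G w u us)) =
   (\<Sum>(d, u, us)\<leftarrow>lpeel vs. \<Sum>(c, w, ws)\<leftarrow>rpeel us. fscale (c * d) (G w u ws))"
  for G :: "'v \<Rightarrow> 'v \<Rightarrow> 'v list \<Rightarrow> 'x \<Rightarrow> 'k"
proof (induction vs arbitrary: G)
  case (Cons v vs)
  define Gv where "Gv w u us = fscale ((- 1) ^ (parity u * parity v)) (G w u (v # us))" for w u us
  \<comment> \<open>The crossing case: in one order \<open>v\<close> passes all of
    \<open>vs\<close>, in the other \<open>u\<close> first passes \<open>v\<close>, and then
    \<open>v\<close> passes only the remaining letters \<open>us\<close>.\<close>
  have sgn: "(- 1 :: 'k) ^ (parity v * par vs) * d =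
      (- 1) ^ (parity v * par us) * ((- 1) ^ (parity u * parity v) * d)"
    if "(d, u, us) \<in> set (lpeel vs)" for d u us
    using lpeel_props[OF that] by (simp add: power_add distrib_left mult.commute)
  have "(\<Sum>(c, w, ws)\<leftarrow>rpeel (v # vs). \<Sum>(d, u, us)\<leftarrow>lpeel ws. fscale (c * d) (G w u us)) =
    (\<Sum>(d, u, us)\<leftarrow>lpeel vs. fscale ((- 1) ^ (parity v * par vs) * d) (G v u us)) +
    ((\<Sum>(c, w, ws)\<leftarrow>rpeel vs. fscale c (G w v ws)) +
     (\<Sum>(c, w, ws)\<leftarrow>rpeel vs. \<Sum>(d, u, us)\<leftarrow>lpeel ws. fscale (c * d) (Gv w u us)))"
    by (simp add: comp_def split_def Gv_def sum_list_addf mult_ac)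
  also have "(\<Sum>(c, w, ws)\<leftarrow>rpeel vs. \<Sum>(d, u, us)\<leftarrow>lpeel ws. fscale (c * d) (Gv w u us)) =
    (\<Sum>(d, u, us)\<leftarrow>lpeel vs. \<Sum>(c, w, ws)\<leftarrow>rpeel us. fscale (c * d) (Gv w u ws))"
    by (rule Cons)
  also have "(\<Sum>(d, u, us)\<leftarrow>lpeel vs. fscale ((- 1) ^ (parity v * par vs) * d) (G v u us)) =
    (\<Sum>(d, u, us)\<leftarrow>lpeel vs.
      fscale ((- 1) ^ (parity v * par us) * ((- 1) ^ (parity u * parity v) * d)) (G v u us))"
    by (intro arg_cong[where f = sum_list] map_cong refl) (auto simp only: sgn)
  finally show ?case
    by (simp add: comp_def split_def Gv_def sum_list_addf mult_ac)
qed simp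

subsection \<open>Symmetrised words\<close>

definition sword :: "'v list \<Rightarrow> ('k, 'v) tensor" where
  "sword vs = Sym (tens vs)"

definition skip :: "nat \<Rightarrow> nat \<Rightarrow> nat" where
  "skip k j = (if j < k then j else Suc j)"

text \<open>A permutation of \<open>Suc m\<close> points as the value \<open>k\<close> at 0 together
  with a permutation of the other \<open>m\<close> points, transported along the increasing map
  \<open>skip k\<close> that omits \<open>k\<close>. From \<open>Suc m\<close> on it is the
  identity, as \<open>permutes\<close> demands.\<close>

definition ext_perm :: "nat \<Rightarrow> nat \<Rightarrow> (nat \<Rightarrow> nat) \<Rightarrow> nat \<Rightarrow> nat" where
  "ext_perm m k \<tau> i = (case i of 0 \<Rightarrow> k | Suc j \<Rightarrow> if j < m then skip k (\<tau> j) else Suc j)"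

lemma ext_perm_simps [simp]: "ext_perm m k \<tau> 0 = k"
  "ext_perm m k \<tau> (Suc j) = (if j < m then skip k (\<tau> j) else Suc j)"
  by (simp_all add: ext_perm_def)

lemma skip_inj: "skip k i = skip k j \<longleftrightarrow> i = j"
  and skip_neq: "skip k j \<noteq> k"
  and skip_less: "skip k i < skip k j \<longleftrightarrow> i < j"
  by (auto simp: skip_def)

text \<open>Surjectivity is obtained by counting: the map is injective into the permutations, and
  \<open>Suc m * fact m\<close> is \<open>fact (Suc m)\<close>.\<close>

lemma bij_betw_ext_perm:
  "bij_betw (\<lambda>(k, \<tau>). ext_perm m k \<tau>) ({..<Suc m} \<times> {\<tau>. \<tau> permutes {..<m}}) {\<sigma>. \<sigma> permutes {..<Suc m}}"
proof -
  let ?A = "{..<Suc m} \<times> {\<tau>. \<tau> permutes {..<m}}"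
  have inj: "inj_on (\<lambda>(k, \<tau>). ext_perm m k \<tau>) ?A"
  proof (rule inj_onI, clarify)
    fix k \<tau> k' \<tau>'
    assume perm: "\<tau> permutes {..<m}" "\<tau>' permutes {..<m}" and eq: "ext_perm m k \<tau> = ext_perm m k' \<tau>'"
    have k: "k = k'" using fun_cong[OF eq, of 0] by simp
    have "\<tau> j = \<tau>' j" for j
    proof (cases "j < m")
      case True
      then show ?thesis using fun_cong[OF eq, of "Suc j"] by (simp add: k skip_inj)
    next
      case False
      then show ?thesis using perm by (simp add: permutes_def)
    qed
    then show "k = k' \<and> \<tau> = \<tau>'" using k by auto
  qed
  have into: "ext_perm m k \<tau> permutes {..<Suc m}" if "k < Suc m" "\<tau> permutes {..<m}" for k \<tau>
  proof (rule bij_imp_permutes)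
    have \<tau>: "\<tau> j < m" if "j < m" for j using permutes_in_image[OF \<open>\<tau> permutes {..<m}\<close>, of j] that by simp
    have "inj_on (ext_perm m k \<tau>) {..<Suc m}"
    proof (rule inj_onI)
      fix i j assume "i \<in> {..<Suc m}" "j \<in> {..<Suc m}" "ext_perm m k \<tau> i = ext_perm m k \<tau> j"
      then show "i = j"
        using permutes_inj[OF \<open>\<tau> permutes {..<m}\<close>] skip_neq
        by (cases i; cases j) (auto simp: skip_inj dest: injD, metis)
    qed
    moreover have "ext_perm m k \<tau> ` {..<Suc m} \<subseteq> {..<Suc m}"
    proof clarify
      fix i assume "i < Suc m"
      then show "ext_perm m k \<tau> i < Suc m" using \<tau> that(1) by (cases i) (auto simp: skip_def less_SucI)
    qed
    ultimately show "bij_betw (ext_perm m k \<tau>) {..<Suc m} {..<Suc m}"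
      by (simp add: bij_betw_def endo_inj_surj)
    show "ext_perm m k \<tau> i = i" if "i \<notin> {..<Suc m}" for i
      using that by (cases i) auto
  qed
  have "(\<lambda>(k, \<tau>). ext_perm m k \<tau>) ` ?A = {\<sigma>. \<sigma> permutes {..<Suc m}}"
  proof (rule card_subset_eq)
    show "finite {\<sigma>. \<sigma> permutes {..<Suc m}}" by (simp add: finite_permutations)
    show "(\<lambda>(k, \<tau>). ext_perm m k \<tau>) ` ?A \<subseteq> {\<sigma>. \<sigma> permutes {..<Suc m}}" using into by auto
    show "card ((\<lambda>(k, \<tau>). ext_perm m k \<tau>) ` ?A) = card {\<sigma>. \<sigma> permutes {..<Suc m}}"
      using inj by (simp add: card_image card_cartesian_product card_permutations del: fact_Suc)
        (simp add: card_permutations[of "{..<m}" m] card_permutations[of "{..<Suc m}" "Suc m"])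
  qed
  then show ?thesis using inj by (simp add: bij_betw_def)
qed

lemma par_eq_card: "par vs = card {i. i < length vs \<and> parity (vs ! i) = 1}"
proof -
  have "par vs = (\<Sum>i<length vs. parity (vs ! i))"
    by (simp add: sum_list_sum_nth atLeast0LessThan)
  also have "\<dots> = (\<Sum>i<length vs. if parity (vs ! i) = 1 then 1 else 0)"
    by (intro sum.cong refl) (simp add: parity_def)
  also have "\<dots> = card {i \<in> {..<length vs}. parity (vs ! i) = 1}"
    by (simp add: sum.If_cases Int_def)
  finally show ?thesis by simp
qed

lemma nth_skip: "length vs = Suc m \<Longrightarrow> k < Suc m \<Longrightarrow> j < m \<Longrightarrow> vs ! skip k j = del k vs ! j"
  by (auto simp: skip_def nth_append)

text \<open>The odd inversions fall into two kinds. Those not involving place 0 are the inversions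
  of \<open>\<tau>\<close>, shifted by one (\<open>Y\<close>). Those involving place 0 come from the
  odd letters that stood before position \<open>k\<close> (\<open>Z\<close>); they count only if the
  letter at \<open>k\<close> is itself odd, and give the sign of moving it to the front.\<close>

lemma koszul_sign_ext_perm:
  assumes k: "k < Suc m" and \<tau>: "\<tau> permutes {..<m}" and vs: "length vs = Suc m"
  shows "koszul_sign (ext_perm m k \<tau>) vs =
    (- 1) ^ (parity (vs ! k) * par (take k vs)) * koszul_sign \<tau> (del k vs)"
proof -
  define e where "e = ext_perm m k \<tau>"
  have \<tau>m: "\<tau> j < m" if "j < m" for j using permutes_in_image[OF \<tau>, of j] that by simp
  have len: "length (del k vs) = m" using k vs by simp
  define odd where "odd v \<longleftrightarrow> parity v = 1" for v
  define X where "X = {(i, j). i < j \<and> j < Suc m \<and> e i > e j \<and> odd (vs ! e i) \<and> odd (vs ! e j)}"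
  define Y where "Y = {(i, j). i < j \<and> j < m \<and> \<tau> i > \<tau> j \<and> odd (del k vs ! \<tau> i) \<and> odd (del k vs ! \<tau> j)}"
  define Z where "Z = {j. j < m \<and> \<tau> j < k \<and> odd (vs ! k) \<and> odd (vs ! \<tau> j)}"
  have X: "X = (\<lambda>j. (0, Suc j)) ` Z \<union> map_prod Suc Suc ` Y"
  proof (intro set_eqI iffI)
    fix p assume p: "p \<in> X"
    obtain i j where ij: "p = (i, Suc j)" "i < Suc j" "j < m"
      using p unfolding X_def by (cases "snd p") auto
    show "p \<in> (\<lambda>j. (0, Suc j)) ` Z \<union> map_prod Suc Suc ` Y"
    proof (cases i)
      case 0
      then have "j \<in> Z" using p ij unfolding X_def Z_def e_def by (auto simp: skip_def split: if_splits)
      then show ?thesis using 0 ij by auto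
    next
      case (Suc i')
      then have "(i', j) \<in> Y"
        using p ij k vs \<tau>m unfolding X_def Y_def e_def by (auto simp: skip_less nth_skip)
      then show ?thesis using Suc ij by (auto intro!: image_eqI[of _ _ "(i', j)"])
    qed
  next
    fix p assume "p \<in> (\<lambda>j. (0, Suc j)) ` Z \<union> map_prod Suc Suc ` Y"
    then show "p \<in> X"
    proof
      assume "p \<in> (\<lambda>j. (0, Suc j)) ` Z"
      then show ?thesis unfolding X_def Z_def e_def by (auto simp: skip_def)
    next
      assume "p \<in> map_prod Suc Suc ` Y"
      then show ?thesis
        using k vs \<tau>m unfolding X_def Y_def e_def by (auto simp: skip_less nth_skip)
    qed
  qed
  have "finite Y" by (rule finite_subset[of _ "{..<m} \<times> {..<m}"]) (auto simp: Y_def)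
  moreover have "finite Z" by (auto simp: Z_def)
  ultimately have "card X = card Z + card Y"
    unfolding X by (subst card_Un_disjoint)
      (auto simp: card_image inj_on_def card_image[OF inj_on_subset[OF prod.inj_map[OF inj_Suc inj_Suc]]])
  moreover have "card Z = parity (vs ! k) * par (take k vs)"
  proof (cases "odd (vs ! k)")
    case True
    have "bij_betw \<tau> Z {i. i < k \<and> odd (vs ! i)}"
      unfolding bij_betw_def
    proof
      show "inj_on \<tau> Z" using permutes_inj[OF \<tau>] by (auto intro: inj_on_subset)
      show "\<tau> ` Z = {i. i < k \<and> odd (vs ! i)}"
      proof (intro set_eqI iffI)
        fix i assume "i \<in> {i. i < k \<and> odd (vs ! i)}"
        then have i: "i < k" "odd (vs ! i)" by auto
        have "\<tau> (inv \<tau> i) = i" using \<tau> by (simp add: permutes_inverses)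
        moreover have "inv \<tau> i < m"
          using permutes_in_image[OF permutes_inv[OF \<tau>], of i] i k by simp
        ultimately show "i \<in> \<tau> ` Z" using i True by (auto simp: Z_def intro!: image_eqI[of _ _ "inv \<tau> i"])
      qed (auto simp: Z_def)
    qed
    then have "card Z = card {i. i < k \<and> odd (vs ! i)}" by (rule bij_betw_same_card)
    also have "\<dots> = par (take k vs)"
      unfolding par_eq_card odd_def using k vs by (intro arg_cong[where f = card]) auto
    finally show ?thesis using True by (simp add: odd_def)
  next
    case False
    then show ?thesis by (simp add: Z_def odd_def parity_def split: if_splits)
  qed
  ultimately show ?thesis
    unfolding koszul_sign_def e_def[symmetric] vs len X_def[unfolded odd_def, symmetric]
      Y_def[unfolded odd_def, symmetric] by (simp add: power_add)
qed

lemma sword_perms: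
  assumes "homogeneous vs"
  shows "fscale (fact (length vs)) (sword vs) = (\<Sum>\<sigma> | \<sigma> permutes {..<length vs}.
    fscale (koszul_sign \<sigma> vs) (tens (map (\<lambda>i. vs ! \<sigma> i) [0..<length vs])))"
  using assms by (simp add: sword_def Sym_tens symmetrizer_n_def perm_action_tens)

lemma homogeneous_del: "homogeneous vs \<Longrightarrow> homogeneous (del k vs)"
  unfolding homogeneous_def by (auto dest: in_set_takeD in_set_dropD)

lemma sword_in_tensors [simp]: "homogeneous vs \<Longrightarrow> sword vs \<in> tensors"
proof -
  assume "homogeneous vs"
  then have "fscale (1 / fact (length vs)) (fscale (fact (length vs)) (sword vs)) \<in> tensors"
    unfolding sword_perms[OF \<open>homogeneous vs\<close>] by (intro tensors_scale tensors_sum tens_in_tensors)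
  then show ?thesis by simp
qed

lemma sword_Nil [simp]: "sword [] = tens []"
  using sword_perms[of "[]"] by (simp add: koszul_sign_def)

text \<open>Grouping the permutations by the position \<open>k\<close> whose letter they put first
  leaves, for each \<open>k\<close>, the symmetrisation of the remaining letters. The factor
  \<open>length vs\<close> is the quotient of the two factorials in the averages.\<close>

lemma sword_lpeel:
  assumes hom: "homogeneous vs"
  shows "fscale (of_nat (length vs)) (sword vs) =
    (\<Sum>(c, w, ws)\<leftarrow>lpeel vs. fscale c (tconc (tens [w]) (sword ws)))"
proof (cases vs)
  case (Cons v vs')
  define m where "m = length vs'"
  have len: "length vs = Suc m" by (simp add: Cons m_def)
  have "fscale (fact (Suc m)) (sword vs) = (\<Sum>\<sigma> | \<sigma> permutes {..<Suc m}.
      fscale (koszul_sign \<sigma> vs) (tens (map (\<lambda>i. vs ! \<sigma> i) [0..<Suc m])))"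
    using sword_perms[OF hom] len by simp
  also have "\<dots> = (\<Sum>(k, \<tau>)\<in>{..<Suc m} \<times> {\<tau>. \<tau> permutes {..<m}}.
      fscale (koszul_sign (ext_perm m k \<tau>) vs) (tens (map (\<lambda>i. vs ! ext_perm m k \<tau> i) [0..<Suc m])))"
    by (subst sum.reindex_bij_betw[OF bij_betw_ext_perm, symmetric]) (simp add: split_def)
  also have "\<dots> = (\<Sum>k<Suc m. \<Sum>\<tau> | \<tau> permutes {..<m}.
      fscale (koszul_sign (ext_perm m k \<tau>) vs) (tens (map (\<lambda>i. vs ! ext_perm m k \<tau> i) [0..<Suc m])))"
    by (rule sum.cartesian_product[symmetric])
  also have "\<dots> = (\<Sum>k<Suc m. fscale ((- 1) ^ (parity (vs ! k) * par (take k vs)))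
      (tconc (tens [vs ! k]) (fscale (fact m) (sword (del k vs)))))"
  proof (rule sum.cong[OF refl])
    fix k assume "k \<in> {..<Suc m}"
    then have k: "k < Suc m" by simp
    have len': "length (del k vs) = m" using len k by simp
    have "fscale (koszul_sign (ext_perm m k \<tau>) vs) (tens (map (\<lambda>i. vs ! ext_perm m k \<tau> i) [0..<Suc m])) =
      fscale ((- 1) ^ (parity (vs ! k) * par (take k vs))) (tconc (tens [vs ! k])
        (fscale (koszul_sign \<tau> (del k vs)) (tens (map (\<lambda>i. del k vs ! \<tau> i) [0..<m]))))"
      if \<tau>: "\<tau> permutes {..<m}" for \<tau>
    proof -
      have "\<tau> j < m" if "j < m" for j using permutes_in_image[OF \<tau>, of j] that by simp
      then have "map (\<lambda>i. vs ! ext_perm m k \<tau> i) [0..<Suc m] = vs ! k # map (\<lambda>i. del k vs ! \<tau> i) [0..<m]"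
        unfolding map_upt_Suc using len k by (auto simp: nth_skip)
      then show ?thesis
        by (simp add: koszul_sign_ext_perm[OF k \<tau> len] fbilinear_scale[OF fbilinear_tconc])
    qed
    note eq = this
    show "(\<Sum>\<tau> | \<tau> permutes {..<m}.
        fscale (koszul_sign (ext_perm m k \<tau>) vs) (tens (map (\<lambda>i. vs ! ext_perm m k \<tau> i) [0..<Suc m]))) =
      fscale ((- 1) ^ (parity (vs ! k) * par (take k vs)))
        (tconc (tens [vs ! k]) (fscale (fact m) (sword (del k vs))))"
      unfolding sword_perms[OF homogeneous_del[OF hom, of k], unfolded len']
        flinear_sum[OF flinear_tconc(1)] fs.scale_sum_right
      by (rule sum.cong[OF refl]) (simp only: mem_Collect_eq eq)
  qed
  also have "\<dots> = (\<Sum>(c, w, ws)\<leftarrow>lpeel vs. fscale c (tconc (tens [w]) (fscale (fact m) (sword ws))))"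
    using sum_lpeel[of "\<lambda>c w ws. fscale c (tconc (tens [w]) (fscale (fact m) (sword ws)))" vs] len by simp
  also have "\<dots> = fscale (fact m) (\<Sum>(c, w, ws)\<leftarrow>lpeel vs. fscale c (tconc (tens [w]) (sword ws)))"
    by (simp add: sum_list_fscale_right split_def fbilinear_scale[OF fbilinear_tconc] mult.commute)
  finally have "fscale (1 / fact m) (fscale (fact (Suc m)) (sword vs)) =
      (\<Sum>(c, w, ws)\<leftarrow>lpeel vs. fscale c (tconc (tens [w]) (sword ws)))"
    by simp
  then show ?thesis by (simp add: len)
qed simp

lemma fscale_cancel_nat:
  "fscale (of_nat n) s = fscale (of_nat n) t \<Longrightarrow> n \<noteq> 0 \<Longrightarrow> s = (t :: 'x \<Rightarrow> 'k)"
  by simp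

lemma sum_list_cong_peel:
  "(\<And>c w ws. (c, w, ws) \<in> set L \<Longrightarrow> F c w ws = G c w ws) \<Longrightarrow>
    (\<Sum>(c, w, ws)\<leftarrow>L. F c w ws) = (\<Sum>(c, w, ws)\<leftarrow>L. G c w ws)"
  by (intro arg_cong[where f = sum_list] map_cong refl) auto

lemma minus_one_power_square: "(- 1 :: 'k) ^ n * ((- 1) ^ n * c) = c"
  by (simp add: mult.assoc[symmetric] power_mult_distrib[symmetric])

text \<open>Induction on the number of other letters through \<open>sword_lpeel\<close>, which
  avoids composing permutations: if a letter of \<open>xs\<close> or \<open>ys\<close> is peeled
  off, the hypothesis applies to the rest, while the two terms in which \<open>a\<close> or
  \<open>b\<close> is peeled off change places. The length factor is cancelled at the end.\<close>

lemma sword_swap: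
  assumes "homogeneous (xs @ a # b # ys)"
  shows "sword (xs @ a # b # ys) = fscale ((- 1) ^ (parity a * parity b)) (sword (xs @ b # a # ys))"
  using assms
proof (induction "length xs + length ys" arbitrary: xs ys rule: less_induct)
  case less
  define s :: 'k where "s = (- 1) ^ (parity a * parity b)"
  have ss: "s * (s * c) = c" for c unfolding s_def by (rule minus_one_power_square)
  define T where "T w t = tconc (tens [w]) t" for w and t :: "('k, 'v) tensor"
  have T: "T w (fscale c t) = fscale c (T w t)" for w c t
    by (simp add: T_def fbilinear_scale[OF fbilinear_tconc])
  let ?p = "\<lambda>a b. fscale ((- 1) ^ (parity a * par xs)) (T a (sword (xs @ b # ys)))"
  have exp: "fscale (of_nat (length (xs @ a # b # ys))) (sword (xs @ a # b # ys)) =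
      (\<Sum>(c, w, ws)\<leftarrow>lpeel xs. fscale c (T w (sword (ws @ a # b # ys)))) + (?p a b +
      (fscale ((- 1) ^ (parity a * parity b)) (?p b a) +
      (\<Sum>(c, w, ws)\<leftarrow>lpeel ys. fscale ((- 1) ^ (parity w * par xs) *
        ((- 1) ^ (parity w * parity a) * ((- 1) ^ (parity w * parity b) * c))) (T w (sword (xs @ a # b # ws))))))"
    if "homogeneous (xs @ a # b # ys)" for a b
    using sword_lpeel[OF that] unfolding T_def[symmetric]
    by (simp add: lpeel_append comp_def split_def mult_ac)
  have "(\<Sum>(c, w, ws)\<leftarrow>lpeel xs. fscale c (T w (sword (ws @ a # b # ys)))) =
      (\<Sum>(c, w, ws)\<leftarrow>lpeel xs. fscale s (fscale c (T w (sword (ws @ b # a # ys)))))"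
  proof (rule sum_list_cong_peel)
    fix c w ws assume "(c, w, ws) \<in> set (lpeel xs)"
    from lpeel_props[OF this] less(2)
    have "sword (ws @ a # b # ys) = fscale s (sword (ws @ b # a # ys))"
      unfolding s_def by (intro less(1)) auto
    then show "fscale c (T w (sword (ws @ a # b # ys))) = fscale s (fscale c (T w (sword (ws @ b # a # ys))))"
      by (simp add: T mult.commute)
  qed
  moreover have "(\<Sum>(c, w, ws)\<leftarrow>lpeel ys. fscale ((- 1) ^ (parity w * par xs) *
        ((- 1) ^ (parity w * parity a) * ((- 1) ^ (parity w * parity b) * c))) (T w (sword (xs @ a # b # ws)))) =
      (\<Sum>(c, w, ws)\<leftarrow>lpeel ys. fscale s (fscale ((- 1) ^ (parity w * par xs) *
        ((- 1) ^ (parity w * parity b) * ((- 1) ^ (parity w * parity a) * c))) (T w (sword (xs @ b # a # ws)))))"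
  proof (rule sum_list_cong_peel)
    fix c w ws assume "(c, w, ws) \<in> set (lpeel ys)"
    from lpeel_props[OF this] less(2)
    have "sword (xs @ a # b # ws) = fscale s (sword (xs @ b # a # ws))"
      unfolding s_def by (intro less(1)) auto
    then show "fscale ((- 1) ^ (parity w * par xs) *
        ((- 1) ^ (parity w * parity a) * ((- 1) ^ (parity w * parity b) * c))) (T w (sword (xs @ a # b # ws))) =
      fscale s (fscale ((- 1) ^ (parity w * par xs) *
        ((- 1) ^ (parity w * parity b) * ((- 1) ^ (parity w * parity a) * c))) (T w (sword (xs @ b # a # ws))))"
      by (simp add: T mult_ac)
  qed
  ultimately have "fscale (of_nat (length (xs @ a # b # ys))) (sword (xs @ a # b # ys)) =
      fscale s (fscale (of_nat (length (xs @ b # a # ys))) (sword (xs @ b # a # ys)))"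
    using less(2)
    by (subst exp, simp, subst exp, simp)
      (simp add: fs.scale_right_distrib sum_list_fscale_right split_def add_ac ss
        mult.commute[of "parity b" "parity a"] flip: s_def)
  then have "fscale (of_nat (length (xs @ a # b # ys))) (sword (xs @ a # b # ys)) =
      fscale (of_nat (length (xs @ a # b # ys))) (fscale s (sword (xs @ b # a # ys)))"
    by (simp only: fs.scale_scale mult.commute length_append list.size)
  then show ?case unfolding s_def[symmetric] by (rule fscale_cancel_nat) simp
qed

text \<open>The sign \<open>c\<close> is the product of the signs of the adjacent swaps that carry
  \<open>w\<close> back to its old place, so it cancels against them.\<close>

lemma sword_lpeel_insert:
  assumes "(c, w, ws) \<in> set (lpeel vs)" "homogeneous (xs @ vs @ ys)"
  shows "fscale c (sword (xs @ w # ws @ ys)) = sword (xs @ vs @ ys)"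
  using assms
proof (induction vs arbitrary: c w ws xs)
  case (Cons v vs)
  then consider "(c, w, ws) = (1, v, vs)" |
    c' ws' where "(c', w, ws') \<in> set (lpeel vs)" "c = (- 1) ^ (parity w * parity v) * c'" "ws = v # ws'"
    by auto
  then show ?case
  proof cases
    case 2
    have "homogeneous (xs @ w # v # ws' @ ys)" using Cons.prems(2) lpeel_props[OF 2(1)] by auto
    from sword_swap[OF this]
    have "fscale c (sword (xs @ w # ws @ ys)) = fscale c' (sword ((xs @ [v]) @ w # ws' @ ys))"
      unfolding 2 by (simp add: minus_one_power_square mult.assoc mult.left_commute[of c'])
    also have "\<dots> = sword ((xs @ [v]) @ vs @ ys)"
      by (rule Cons.IH[OF 2(1)]) (use Cons.prems in auto)
    finally show ?thesis by simp
  qed simp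
qed simp

text \<open>The inner symmetrised word is peeled: by \<open>sword_lpeel_insert\<close> each of its
  \<open>length vs\<close> terms yields the same total symmetrisation, so the factor cancels. The
  prefix \<open>xs\<close> collects the peeled letters. This is the fact behind the associativity of
  the symmetric product, here without cosets of subgroups of permutations.\<close>

lemma Sym_absorb:
  assumes "homogeneous (xs @ vs @ ys)"
  shows "Sym (tconc (tens xs) (tconc (sword vs) (tens ys))) = sword (xs @ vs @ ys)"
  using assms
proof (induction "length vs" arbitrary: xs vs)
  case (Suc n)
  let ?L = "\<lambda>t. Sym (tconc (tens xs) (tconc t (tens ys)))"
  have L: "flinear ?L"
    by (intro flinear_compose[OF flinear_Sym] flinear_compose[OF flinear_tconc(1)] flinear_tconc(2))
  have hom: "homogeneous vs" using Suc(3) by simp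
  have "fscale (of_nat (length vs)) (?L (sword vs)) = ?L (fscale (of_nat (length vs)) (sword vs))"
    by (rule flinear_scale[OF L, symmetric])
  also have "\<dots> = (\<Sum>(c, w, ws)\<leftarrow>lpeel vs. fscale c (?L (tconc (tens [w]) (sword ws))))"
    unfolding sword_lpeel[OF hom] flinear_sum_list[OF L] split_def flinear_scale[OF L] ..
  also have "\<dots> = (\<Sum>(c, w, ws)\<leftarrow>lpeel vs. sword (xs @ vs @ ys))"
  proof (rule sum_list_cong_peel)
    fix c w ws assume p: "(c, w, ws) \<in> set (lpeel vs)"
    note q = lpeel_props[OF p]
    have "?L (tconc (tens [w]) (sword ws)) = Sym (tconc (tens (xs @ [w])) (tconc (sword ws) (tens ys)))"
      using q Suc(3) by (simp add: tconc_assoc flip: tconc_tens)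
    also have "\<dots> = sword (xs @ w # ws @ ys)"
      using q Suc(2,3) Suc(1)[of ws "xs @ [w]"] by simp
    finally show "fscale c (?L (tconc (tens [w]) (sword ws))) = sword (xs @ vs @ ys)"
      using sword_lpeel_insert[OF p Suc(3)] by simp
  qed
  also have "\<dots> = fscale (of_nat (length vs)) (sword (xs @ vs @ ys))"
  proof -
    have "(\<Sum>(c, w, ws)\<leftarrow>L. x) = fscale (of_nat (length L)) x"
      for L :: "('k \<times> 'v \<times> 'v list) list" and x :: "('k, 'v) tensor"
      by (induction L) (auto simp: fs.scale_left_distrib)
    then show ?thesis by simp
  qed
  finally show ?case by (rule fscale_cancel_nat) (use Suc(2) in auto)
next
  case 0
  then have "vs = []" by simp
  show ?case unfolding \<open>vs = []\<close> sword_Nil by (simp add: sword_def)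
qed

text \<open>A second computation with permutations is avoided: the words left over on the right hand
  side are peeled on the left, the two peelings are exchanged by \<open>rpeel_lpeel\<close>, and the
  induction hypothesis applies inside. This introduces the factor \<open>n\<close> for a word of
  length \<open>Suc n\<close>, whence the separate treatment of \<open>n = 0\<close>.\<close>

lemma sword_rpeel:
  assumes "homogeneous vs"
  shows "fscale (of_nat (length vs)) (sword vs) =
    (\<Sum>(c, w, ws)\<leftarrow>rpeel vs. fscale c (tconc (sword ws) (tens [w])))"
  using assms
proof (induction "length vs" arbitrary: vs)
  case (Suc n)
  show ?case
  proof (cases "n = 0")
    case True
    then obtain v where "vs = [v]" using Suc(2) by (metis length_0_conv length_Suc_conv)
    then show ?thesis using sword_lpeel[OF Suc(3)] by simp
  next
    case False
    let ?T = "\<lambda>w u us. tconc (tens [u]) (tconc (sword us) (tens [w]))"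
    let ?R = "\<lambda>vs. \<Sum>(c, w, ws)\<leftarrow>rpeel vs. fscale c (tconc (sword ws) (tens [w]))"
    have "fscale (of_nat n) (?R vs) =
      (\<Sum>(c, w, ws)\<leftarrow>rpeel vs. fscale c (tconc (fscale (of_nat n) (sword ws)) (tens [w])))"
      by (simp add: sum_list_fscale_right split_def fbilinear_scale[OF fbilinear_tconc] mult.commute)
    also have "\<dots> = (\<Sum>(c, w, ws)\<leftarrow>rpeel vs. \<Sum>(d, u, us)\<leftarrow>lpeel ws. fscale (c * d) (?T w u us))"
    proof (rule sum_list_cong_peel)
      fix c w ws assume "(c, w, ws) \<in> set (rpeel vs)"
      note q = rpeel_props[OF this]
      have "fscale (of_nat n) (sword ws) = (\<Sum>(c, w, ws)\<leftarrow>lpeel ws. fscale c (tconc (tens [w]) (sword ws)))"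
        using sword_lpeel[of ws] q Suc(2,3) by simp
      then have "fscale c (tconc (fscale (of_nat n) (sword ws)) (tens [w])) =
        (\<Sum>(d, u, us)\<leftarrow>lpeel ws. fscale (c * d) (tconc (tconc (tens [u]) (sword us)) (tens [w])))"
        by (simp add: flinear_sum_list[OF flinear_tconc(2)] sum_list_fscale_right split_def
            fbilinear_scale[OF fbilinear_tconc])
      also have "\<dots> = (\<Sum>(d, u, us)\<leftarrow>lpeel ws. fscale (c * d) (?T w u us))"
      proof (rule sum_list_cong_peel)
        fix d u us assume "(d, u, us) \<in> set (lpeel ws)"
        from lpeel_props[OF this] have "homogeneous us" using q Suc(3) by simp
        then show "fscale (c * d) (tconc (tconc (tens [u]) (sword us)) (tens [w])) = fscale (c * d) (?T w u us)"
          by (simp add: tconc_assoc)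
      qed
      finally show "fscale c (tconc (fscale (of_nat n) (sword ws)) (tens [w])) =
        (\<Sum>(d, u, us)\<leftarrow>lpeel ws. fscale (c * d) (?T w u us))" .
    qed
    also have "\<dots> = (\<Sum>(d, u, us)\<leftarrow>lpeel vs. \<Sum>(c, w, ws)\<leftarrow>rpeel us. fscale (c * d) (?T w u ws))"
      by (rule rpeel_lpeel)
    also have "\<dots> = (\<Sum>(d, u, us)\<leftarrow>lpeel vs. fscale d (tconc (tens [u]) (?R us)))"
      by (simp add: flinear_sum_list[OF flinear_tconc(1)] sum_list_fscale_right split_def
          fbilinear_scale[OF fbilinear_tconc] mult.commute)
    also have "\<dots> = (\<Sum>(d, u, us)\<leftarrow>lpeel vs. fscale d (tconc (tens [u]) (fscale (of_nat n) (sword us))))"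
    proof (rule sum_list_cong_peel)
      fix d u us assume "(d, u, us) \<in> set (lpeel vs)"
      from lpeel_props[OF this] have "n = length us" "homogeneous us" using Suc(2,3) by auto
      then show "fscale d (tconc (tens [u]) (?R us)) = fscale d (tconc (tens [u]) (fscale (of_nat n) (sword us)))"
        using Suc(1)[of us] by simp
    qed
    also have "\<dots> = fscale (of_nat n) (\<Sum>(d, u, us)\<leftarrow>lpeel vs. fscale d (tconc (tens [u]) (sword us)))"
      by (simp add: sum_list_fscale_right split_def fbilinear_scale[OF fbilinear_tconc] mult.commute)
    also have "\<dots> = fscale (of_nat n) (fscale (of_nat (length vs)) (sword vs))"
      using sword_lpeel[OF Suc(3)] by simp
    finally show ?thesis using False by (metis fscale_cancel_nat)
  qed
qed simp

subsection \<open>The symmetric algebra\<close>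

abbreviation hsign :: "nat \<Rightarrow> 'k" where "hsign n \<equiv> (- 1) ^ n"

text \<open>Permuting letters changes neither the length nor the total parity. Symmetrised words are
  therefore eigenvectors of the degree and grading operators.\<close>

lemma sword_span:
  assumes hom: "homogeneous vs"
  shows "sword vs \<in> fs.span (tens ` {ws. homogeneous ws \<and> length ws = length vs \<and> par ws = par vs})"
    (is "_ \<in> ?S")
proof -
  have "tens (map (\<lambda>i. vs ! \<sigma> i) [0..<length vs]) \<in> ?S" if \<sigma>: "\<sigma> permutes {..<length vs}" for \<sigma>
  proof -
    let ?ws = "map (\<lambda>i. vs ! \<sigma> i) [0..<length vs]"
    have "\<sigma> i < length vs" if "i < length vs" for i using permutes_in_image[OF \<sigma>, of i] that by simp
    then have "vs ! \<sigma> i \<in> V0 \<union> V1" if "i < length vs" for i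
      using hom nth_mem[of "\<sigma> i" vs] that unfolding homogeneous_def by blast
    then have "homogeneous ?ws" unfolding homogeneous_def set_map by (intro image_subsetI) (simp del: Un_iff)
    moreover have "par ?ws = (\<Sum>i<length vs. parity (vs ! \<sigma> i))"
      by (simp add: sum_list_sum_nth atLeast0LessThan)
    moreover have "\<dots> = (\<Sum>i<length vs. parity (vs ! i))"
      using sum.permute[OF \<sigma>, of "\<lambda>i. parity (vs ! i)"] by (simp add: comp_def)
    moreover have "\<dots> = par vs" by (simp add: sum_list_sum_nth atLeast0LessThan)
    ultimately show ?thesis by (intro fs.span_base imageI) simp
  qed
  then have "fscale (1 / fact (length vs)) (fscale (fact (length vs)) (sword vs)) \<in> ?S"
    unfolding sword_perms[OF hom] by (intro fs.span_scale fs.span_sum) auto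
  then show ?thesis by simp
qed

lemma sword_in_tensor_power: "homogeneous vs \<Longrightarrow> sword vs \<in> tensor_power (length vs)"
  unfolding tensor_power_def using sword_span[of vs] fs.span_mono[of "tens ` _" "tens ` _"]
  by (metis (mono_tags, lifting) Collect_mono_iff image_mono subsetD)

lemma sym_algebra_eq: "sym_algebra = fs.span (sword ` {vs. homogeneous vs})" (is "_ = ?S")
proof
  have "symmetrizer_n n t \<in> ?S" if "t \<in> tensor_power n" for n t
    using that unfolding tensor_power_hom
    by (rule flinear_span_into[OF flinear_symmetrizer_n, rotated])
      (auto simp: sword_def Sym_tens intro: fs.span_base)
  then show "sym_algebra \<subseteq> ?S"
    unfolding sym_algebra_def sym_power_def by (intro fs.span_minimal) auto
  have "sword vs \<in> sym_power (length vs)" for vs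
    unfolding sword_def Sym_tens sym_power_def by (intro imageI tens_in_tensor_power) simp
  then show "?S \<subseteq> sym_algebra"
    unfolding sym_algebra_def by (intro fs.span_mono) auto
qed

lemma sword_in_sym [simp]: "homogeneous vs \<Longrightarrow> sword vs \<in> sym_algebra"
  unfolding sym_algebra_eq by (auto intro: fs.span_base)

lemma sym_in_tensors: "a \<in> sym_algebra \<Longrightarrow> a \<in> tensors"
  using fs.span_minimal[of "sword ` {vs. homogeneous vs}" tensors] sword_in_tensors
  unfolding sym_algebra_eq tensors_def by auto

lemma sym_add: "a \<in> sym_algebra \<Longrightarrow> b \<in> sym_algebra \<Longrightarrow> a + b \<in> sym_algebra"
  and sym_scale: "a \<in> sym_algebra \<Longrightarrow> fscale c a \<in> sym_algebra"
  and sym_zero [simp]: "0 \<in> sym_algebra"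
  and sym_diff: "a \<in> sym_algebra \<Longrightarrow> b \<in> sym_algebra \<Longrightarrow> a - b \<in> sym_algebra"
  and sym_sum: "(\<And>i. i \<in> I \<Longrightarrow> f i \<in> sym_algebra) \<Longrightarrow> (\<Sum>i\<in>I. f i) \<in> sym_algebra"
  unfolding sym_algebra_def by (auto intro: fs.span_add fs.span_scale fs.span_zero fs.span_diff fs.span_sum)

lemma flinear_eq_on_sym:
  assumes "flinear L" "flinear M" "a \<in> sym_algebra"
    "\<And>vs. homogeneous vs \<Longrightarrow> L (sword vs) = M (sword vs)"
  shows "L a = M a"
  using flinear_eq_on_span[OF assms(1,2)] assms(3,4) unfolding sym_algebra_eq by blast

lemma Sym_sword_sword:
  assumes "homogeneous vs" "homogeneous ws"
  shows "Sym (tconc (sword vs) (sword ws)) = sword (vs @ ws)"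
proof -
  have "Sym (tconc x (sword ws)) = Sym (tconc x (tens ws))" if "x \<in> tensors" for x
    using that unfolding tensors_hom
  proof (rule flinear_eq_on_span[rotated 2])
    show "flinear (\<lambda>x. Sym (tconc x (sword ws)))" "flinear (\<lambda>x. Sym (tconc x (tens ws)))"
      by (intro flinear_compose[OF flinear_Sym flinear_tconc(2)])+
    fix b assume "b \<in> tens ` {vs. homogeneous vs}"
    then show "Sym (tconc b (sword ws)) = Sym (tconc b (tens ws))"
      using Sym_absorb[of _ ws "[]"] assms(2) by (auto simp flip: sword_def)
  qed
  then show ?thesis using Sym_absorb[of "[]" vs ws] assms by simp
qed

definition vmul :: "'v \<Rightarrow> ('k, 'v) tensor \<Rightarrow> ('k, 'v) tensor" where
  "vmul v t = Sym (tconc (tens [v]) t)"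

lemma flinear_vmul: "flinear (vmul v)"
  unfolding vmul_def[abs_def] by (rule flinear_compose[OF flinear_Sym flinear_tconc(1)])

lemma vmul_sword: "v \<in> V0 \<union> V1 \<Longrightarrow> homogeneous vs \<Longrightarrow> vmul v (sword vs) = sword (v # vs)"
  using Sym_absorb[of "[v]" vs "[]"] by (simp add: vmul_def)

text \<open>Linear on all functionals, and equal to \<open>mu\<close> on \<open>pairs\<close> by
  \<open>mu_eq_mult\<close>.\<close>

definition mult :: "('k, 'v) tensor2 \<Rightarrow> ('k, 'v) tensor" where
  "mult x = Sym (concat_tensor x)"

lemma flinear_mult: "flinear mult"
  unfolding mult_def[abs_def] by (rule flinear_compose[OF flinear_Sym flinear_concat_tensor])

lemma mult_sword: "homogeneous vs \<Longrightarrow> homogeneous ws \<Longrightarrow> mult (sword vs \<otimes> sword ws) = sword (vs @ ws)"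
  using Sym_sword_sword by (simp add: mult_def tconc_def)

section \<open>Tensor squares of the tensor algebra and of the symmetric algebra\<close>

definition pairs :: "('k, 'v) tensor2 set" where
  "pairs = fs.span (\<Union>vs ws. {tens vs \<otimes> tens ws})"

definition sym_pairs :: "('k, 'v) tensor2 set" where
  "sym_pairs = fs.span {sword vs \<otimes> sword ws | vs ws. homogeneous vs \<and> homogeneous ws}"

lemma fbilinear_span_into:
  assumes "fbilinear \<beta>" "s \<in> fs.span A" "t \<in> fs.span B" "\<And>a b. a \<in> A \<Longrightarrow> b \<in> B \<Longrightarrow> \<beta> a b \<in> fs.span C"
  shows "\<beta> s t \<in> fs.span C"
proof -
  have l: "flinear (\<beta> s)" "flinear (\<lambda>s. \<beta> s t)" for s t
    using assms(1) by (simp_all add: fbilinear_def)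
  have "\<beta> a t \<in> fs.span C" if "a \<in> A" for a
    by (rule flinear_span_into[OF l(1) _ assms(3)]) (use assms(4) that in auto)
  then show ?thesis by (rule flinear_span_into[OF l(2) _ assms(2)])
qed

lemma tensor_prod_in_pairs: "s \<in> tensors \<Longrightarrow> t \<in> tensors \<Longrightarrow> s \<otimes> t \<in> pairs"
  unfolding tensors_def pairs_def
  by (erule (1) fbilinear_span_into[OF fbilinear_tensor_prod]) (auto intro!: fs.span_base)

lemma tensor_prod_in_sym_pairs: "a \<in> sym_algebra \<Longrightarrow> b \<in> sym_algebra \<Longrightarrow> a \<otimes> b \<in> sym_pairs"
  unfolding sym_algebra_eq sym_pairs_def
  by (erule (1) fbilinear_span_into[OF fbilinear_tensor_prod]) (auto intro!: fs.span_base)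

lemma sym_pairs_subset: "x \<in> sym_pairs \<Longrightarrow> x \<in> pairs"
proof -
  have "sym_pairs \<subseteq> pairs"
    unfolding sym_pairs_def
    by (rule fs.span_minimal)
      (auto intro!: tensor_prod_in_pairs sword_in_tensors, simp add: pairs_def)
  then show "x \<in> sym_pairs \<Longrightarrow> x \<in> pairs" by auto
qed

lemma concat_in_tensors: "x \<in> pairs \<Longrightarrow> concat_tensor x \<in> tensors"
  unfolding pairs_def tensors_def
  by (erule flinear_span_into[OF flinear_concat_tensor, rotated])
    (auto simp flip: tconc_def intro: fs.span_base)

lemma mu_eq_mult: "x \<in> pairs \<Longrightarrow> mu x = mult x"
  by (simp add: mu_def mult_def symmetrizer_eq concat_in_tensors)

lemma mult_in_sym: "x \<in> sym_pairs \<Longrightarrow> mult x \<in> sym_algebra"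
  unfolding sym_pairs_def sym_algebra_eq
  by (erule flinear_span_into[OF flinear_mult, rotated])
    (auto simp: mult_sword intro!: fs.span_base)

lemma sym_prod_eq: "homogeneous vs \<Longrightarrow> sym_prod vs = sword vs"
proof (induction vs)
  case (Cons v vs)
  then have "sym_prod (v # vs) = mu (tens [v] \<otimes> sword vs)" by (simp add: sym_prod_def)
  also have "\<dots> = vmul v (sword vs)"
    using Cons.prems by (simp add: mu_eq_mult tensor_prod_in_pairs mult_def vmul_def tconc_def)
  finally show ?case using Cons.prems by (simp add: vmul_sword)
qed (simp add: sym_prod_def)

lemma sym_pairs_eqI:
  assumes "flinear L" "flinear M" "x \<in> sym_pairs"
    "\<And>vs ws. homogeneous vs \<Longrightarrow> homogeneous ws \<Longrightarrow> L (sword vs \<otimes> sword ws) = M (sword vs \<otimes> sword ws)"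
  shows "L x = M x"
  using assms(3) unfolding sym_pairs_def
  by (rule flinear_eq_on_span[OF assms(1,2)]) (use assms(4) in auto)

lemma sym_pairs_into:
  assumes "flinear L" "x \<in> sym_pairs"
    "\<And>vs ws. homogeneous vs \<Longrightarrow> homogeneous ws \<Longrightarrow> L (sword vs \<otimes> sword ws) \<in> sym_pairs"
  shows "L x \<in> sym_pairs"
  using assms(2) unfolding sym_pairs_def
  by (rule flinear_span_into[OF assms(1), rotated]) (use assms(3) in \<open>auto simp: sym_pairs_def\<close>)

subsection \<open>Degree and grading operators\<close>

text \<open>The Euler operator. Applied to a symmetrised word it undoes the averaging over the
  letter in an end position, so that a contraction there becomes a sum over all letters.\<close>

definition degop :: "('k, 'v) tensor \<Rightarrow> ('k, 'v) tensor" where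
  "degop = lift (\<lambda>vs. fscale (of_nat (length vs)) (tens vs))"

lemma flinear_degop: "flinear degop"
  and degop_tens: "degop (tens vs) = fscale (of_nat (length vs)) (tens vs)"
proof -
  have "multilin (\<lambda>vs. fscale (of_nat (length vs)) (tens vs))"
    by (simp add: multilin_def tens_add tens_scale fs.scale_right_distrib mult.commute)
  then show "flinear degop" "degop (tens vs) = fscale (of_nat (length vs)) (tens vs)"
    unfolding degop_def by (auto intro: flinear_lift lift_tens)
qed

lemma degop_sword: "homogeneous vs \<Longrightarrow> degop (sword vs) = fscale (of_nat (length vs)) (sword vs)"
  by (rule flinear_eq_on_span[OF flinear_degop flinear_fscale[OF flinear_id]
        sword_in_tensor_power[unfolded tensor_power_def]])
    (auto simp: degop_tens)

text \<open>The \<open>e\<close>-th power of the parity automorphism. For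
  \<open>e = parity v\<close> it produces the sign for moving \<open>v\<close> past a whole
  tensor.\<close>

definition gradop :: "nat \<Rightarrow> ('k, 'v) tensor \<Rightarrow> ('k, 'v) tensor" where
  "gradop e = lift (\<lambda>vs. tens (map (\<lambda>v. proj0 v + scale (hsign e) (proj1 v)) vs))"

lemma flinear_gradop: "flinear (gradop e)"
  and gradop_tens: "homogeneous vs \<Longrightarrow> gradop e (tens vs) = fscale (hsign (e * par vs)) (tens vs)"
proof -
  define \<gamma> where "\<gamma> v = proj0 v + scale (hsign e) (proj1 v)" for v
  have \<gamma>: "\<gamma> (u + v) = \<gamma> u + \<gamma> v" "\<gamma> (scale c v) = scale c (\<gamma> v)" for u v c
    by (simp_all add: \<gamma>_def proj_add proj_scale scale_right_distrib add_ac mult.commute)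
  have ml: "multilin (\<lambda>vs. tens (map \<gamma> vs))"
    by (simp add: multilin_def \<gamma> tens_add tens_scale)
  then show "flinear (gradop e)" unfolding gradop_def \<gamma>_def by (rule flinear_lift)
  have "tens (xs @ map \<gamma> vs) = fscale (hsign (e * par vs)) (tens (xs @ vs))"
    if "homogeneous vs" for xs vs
    using that
  proof (induction vs arbitrary: xs)
    case (Cons v vs)
    then have "\<gamma> v = scale (hsign (e * parity v)) v"
      by (auto simp: \<gamma>_def parity_def)
    moreover have "tens (xs @ v # map \<gamma> vs) = fscale (hsign (e * par vs)) (tens (xs @ v # vs))"
      using Cons.IH[of "xs @ [v]"] Cons.prems by simp
    ultimately show ?case by (simp add: tens_scale distrib_left power_add)
  qed simp
  from this[of vs "[]"] show "homogeneous vs \<Longrightarrow> gradop e (tens vs) = fscale (hsign (e * par vs)) (tens vs)"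
    unfolding gradop_def \<gamma>_def[symmetric] by (simp add: lift_tens[OF ml])
qed

lemma gradop_sword: "homogeneous vs \<Longrightarrow> gradop e (sword vs) = fscale (hsign (e * par vs)) (sword vs)"
  by (rule flinear_eq_on_span[OF flinear_gradop flinear_fscale[OF flinear_id] sword_span])
    (auto simp: gradop_tens)

end

lemma funpow_commute_on:
  assumes "x \<in> S" "\<And>x. x \<in> S \<Longrightarrow> f x \<in> S" "\<And>x. x \<in> S \<Longrightarrow> f (g x) = g (f x)"
  shows "(f ^^ k) (g x) = g ((f ^^ k) x)"
proof -
  have "(f ^^ k) x \<in> S \<and> (f ^^ k) (g x) = g ((f ^^ k) x)"
    using assms by (induction k) auto
  then show ?thesis ..
qed

subsection \<open>Contractions and the star product\<close>

locale graded_form = graded_lcs scale V0 V1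
  for scale :: "'k::real_normed_field \<Rightarrow> 'v::{topological_ab_group_add, t2_space} \<Rightarrow> 'v"
    and V0 V1 :: "'v set" +
  fixes \<Lambda> :: "'v \<Rightarrow> 'v \<Rightarrow> 'k"
  assumes bil: "bilinear_map scale scale (*) \<Lambda>" and even: "even_form \<Lambda>"
begin

lemma form_bilinear:
  "\<Lambda> (u + v) w = \<Lambda> u w + \<Lambda> v w" "\<Lambda> (scale c v) w = c * \<Lambda> v w"
  "\<Lambda> v (u + w) = \<Lambda> v u + \<Lambda> v w" "\<Lambda> v (scale c w) = c * \<Lambda> v w"
  using bil unfolding bilinear_map_def Vector_Spaces.linear_iff by blast+

lemma form_parity: "v \<in> V0 \<union> V1 \<Longrightarrow> w \<in> V0 \<union> V1 \<Longrightarrow> \<Lambda> v w \<noteq> 0 \<Longrightarrow> parity v = parity w"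
  using even unfolding even_form_def parity_def by auto

definition contr :: "('k, 'v) tensor2 \<Rightarrow> ('k, 'v) tensor2" where
  "contr = lift2 (\<lambda>vs ws. if vs = [] \<or> ws = [] then 0
     else fscale (\<Lambda> (last vs) (hd ws)) (tens (butlast vs) \<otimes> tens (tl ws)))"

lemma flinear_contr: "flinear contr"
  and contr_tens: "contr (tens vs \<otimes> tens ws) = (if vs = [] \<or> ws = [] then 0
     else fscale (\<Lambda> (last vs) (hd ws)) (tens (butlast vs) \<otimes> tens (tl ws)))"
proof -
  let ?h = "\<lambda>vs ws. if vs = [] \<or> ws = [] then 0
     else fscale (\<Lambda> (last vs) (hd ws)) (tens (butlast vs) \<otimes> tens (tl ws))"
  have tp: "(s + s') \<otimes> t = s \<otimes> t + s' \<otimes> t" "s \<otimes> (t + t') = s \<otimes> t + s \<otimes> t'"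
    "fscale c s \<otimes> t = fscale c (s \<otimes> t)" "s \<otimes> fscale c t = fscale c (s \<otimes> t)"
    for s s' t t' :: "('k, 'v) tensor" and c
    using fbilinear_add[OF fbilinear_tensor_prod] fbilinear_scale[OF fbilinear_tensor_prod] by blast+
  have left: "multilin (\<lambda>vs. ?h vs ws)" for ws
  proof -
    have "last (xs @ v # ys) = (if ys = [] then v else last ys)"
      "butlast (xs @ v # ys) = (if ys = [] then xs else xs @ v # butlast ys)" for xs v ys
      by (auto simp: butlast_append)
    note eqs = this
    show ?thesis
      unfolding multilin_def eqs
      by (auto simp: form_bilinear tens_add tens_scale tp fs.scale_left_distrib fs.scale_right_distrib mult.commute)
  qed
  have right: "multilin (?h vs)" for vs
  proof -
    have "hd (xs @ v # ys) = (if xs = [] then v else hd xs)"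
      "tl (xs @ v # ys) = (if xs = [] then ys else tl xs @ v # ys)" for xs v ys
      by (cases xs; simp)+
    note eqs = this
    show ?thesis
      unfolding multilin_def eqs
      by (auto simp: form_bilinear tens_add tens_scale tp fs.scale_left_distrib fs.scale_right_distrib mult.commute)
  qed
  show "flinear contr" unfolding contr_def by (rule flinear_lift2[OF left right])
  show "contr (tens vs \<otimes> tens ws) = ?h vs ws" unfolding contr_def by (rule lift2_tens[OF left right])
qed

lemma contr_tconc:
  assumes "x \<in> tensors" "y \<in> tensors"
  shows "contr (tconc x (tens [v]) \<otimes> tconc (tens [w]) y) = fscale (\<Lambda> v w) (x \<otimes> y)"
  using assms unfolding tensors_def
proof (rule fbilinear_eq_on_span[rotated 2])
  show "fbilinear (\<lambda>x y. contr (tconc x (tens [v]) \<otimes> tconc (tens [w]) y))"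
    by (rule fbilinear_compose[OF flinear_contr
          fbilinear_compose2[OF fbilinear_tensor_prod flinear_tconc(2) flinear_tconc(1)]])
  show "fbilinear (\<lambda>x y. fscale (\<Lambda> v w) (x \<otimes> y))"
    by (rule fbilinear_compose[OF flinear_fscale[OF flinear_id] fbilinear_tensor_prod])
qed (auto simp: contr_tens)

text \<open>\<open>Pc\<close> extends \<open>P \<Lambda>\<close> to pairs of arbitrary tensors: contracting the last factor on the left with
  the first factor on the right needs no signs, and on symmetric tensors the degrees account for
  the sum over all pairs of factors.\<close>

definition Pc :: "('k, 'v) tensor2 \<Rightarrow> ('k, 'v) tensor2" where
  "Pc x = contr (tensor_map degop degop x)"

lemma flinear_Pc: "flinear Pc"
  unfolding Pc_def[abs_def] by (rule flinear_compose[OF flinear_contr flinear_tensor_map])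

lemma Pc_prod: "Pc (s \<otimes> t) = contr (degop s \<otimes> degop t)"
  by (simp add: Pc_def tensor_map_prod[OF flinear_degop flinear_degop])

lemma Pc_tens: "Pc (tens vs \<otimes> tens ws) = (if vs = [] \<or> ws = [] then 0
     else fscale (of_nat (length vs) * of_nat (length ws) * \<Lambda> (last vs) (hd ws))
       (tens (butlast vs) \<otimes> tens (tl ws)))"
  by (simp add: Pc_prod degop_tens fbilinear_scale[OF fbilinear_tensor_prod]
      flinear_scale[OF flinear_contr] contr_tens mult_ac)

text \<open>The two degree factors turn the symmetrised words into the sums over their right and
  left peelings; each term is then contracted at its exposed letters, which stand next to each
  other.\<close>

lemma Pc_sword:
  assumes "homogeneous vs" "homogeneous ws"
  shows "Pc (sword vs \<otimes> sword ws) = (\<Sum>(c, v, vs')\<leftarrow>rpeel vs. \<Sum>(d, w, ws')\<leftarrow>lpeel ws.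
    fscale (c * d * \<Lambda> v w) (sword vs' \<otimes> sword ws'))"
proof -
  have "Pc (sword vs \<otimes> sword ws) =
    contr ((\<Sum>(c, v, vs')\<leftarrow>rpeel vs. fscale c (tconc (sword vs') (tens [v]))) \<otimes>
      (\<Sum>(d, w, ws')\<leftarrow>lpeel ws. fscale d (tconc (tens [w]) (sword ws'))))"
    by (simp only: Pc_prod degop_sword[OF assms(1)] degop_sword[OF assms(2)]
        sword_rpeel[OF assms(1)] sword_lpeel[OF assms(2)])
  also have "\<dots> = (\<Sum>(c, v, vs')\<leftarrow>rpeel vs. \<Sum>(d, w, ws')\<leftarrow>lpeel ws.
    contr (fscale c (tconc (sword vs') (tens [v])) \<otimes> fscale d (tconc (tens [w]) (sword ws'))))"
    unfolding fbilinear_sum_list[OF fbilinear_compose[OF flinear_contr fbilinear_tensor_prod]] split_def ..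
  also have "\<dots> = (\<Sum>(c, v, vs')\<leftarrow>rpeel vs. \<Sum>(d, w, ws')\<leftarrow>lpeel ws.
    fscale (c * d * \<Lambda> v w) (sword vs' \<otimes> sword ws'))"
  proof (intro sum_list_cong_peel)
    fix c v vs' d w ws'
    assume "(c, v, vs') \<in> set (rpeel vs)" "(d, w, ws') \<in> set (lpeel ws)"
    then have "homogeneous vs'" "homogeneous ws'" using assms lpeel_props rpeel_props by blast+
    then show "contr (fscale c (tconc (sword vs') (tens [v])) \<otimes> fscale d (tconc (tens [w]) (sword ws'))) =
      fscale (c * d * \<Lambda> v w) (sword vs' \<otimes> sword ws')"
      by (simp add: fbilinear_scale[OF fbilinear_tensor_prod] flinear_scale[OF flinear_contr]
          contr_tconc mult_ac)
  qed
  finally show ?thesis .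
qed

text \<open>\<open>P\<close> is specified only on products of symmetrised words, so equality can be
  asserted only on \<open>sym_pairs\<close>. \<open>Pc\<close> itself is the linear map with the
  prescribed values that makes the choice in \<open>P\<close> meaningful.\<close>

lemma P_eq_Pc: "x \<in> sym_pairs \<Longrightarrow> P \<Lambda> x = Pc x"
proof -
  assume x: "x \<in> sym_pairs"
  let ?g = "\<lambda>(vs, ws). \<Sum>k<length vs. \<Sum>l<length ws.
          fscale ((- 1) ^ (parity (vs ! k) * par (drop (Suc k) vs) + parity (ws ! l) * par (take l ws))
                  * \<Lambda> (vs ! k) (ws ! l))
            (sym_prod (del k vs) \<otimes> sym_prod (del l ws))"
  have *: "Pc (case p of (vs, ws) \<Rightarrow> sym_prod vs \<otimes> sym_prod ws) = ?g p"
    if "p \<in> {(vs, ws). homogeneous vs \<and> homogeneous ws}" for p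
  proof -
    obtain vs ws where p: "p = (vs, ws)" "homogeneous vs" "homogeneous ws" using \<open>p \<in> _\<close> by auto
    have "Pc (sword vs \<otimes> sword ws) = (\<Sum>k<length vs. \<Sum>(d, w, ws')\<leftarrow>lpeel ws.
        fscale ((- 1) ^ (parity (vs ! k) * par (drop (Suc k) vs)) * d * \<Lambda> (vs ! k) w)
          (sword (del k vs) \<otimes> sword ws'))"
      unfolding Pc_sword[OF p(2,3)]
      by (rule sum_rpeel[symmetric, of "\<lambda>c v vs'. \<Sum>(d, w, ws')\<leftarrow>lpeel ws.
        fscale (c * d * \<Lambda> v w) (sword vs' \<otimes> sword ws')"])
    also have "\<dots> = (\<Sum>k<length vs. \<Sum>l<length ws.
        fscale ((- 1) ^ (parity (vs ! k) * par (drop (Suc k) vs)) * (- 1) ^ (parity (ws ! l) * par (take l ws))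
            * \<Lambda> (vs ! k) (ws ! l))
          (sword (del k vs) \<otimes> sword (del l ws)))"
      by (intro sum.cong refl sum_lpeel[symmetric])
    also have "\<dots> = ?g (vs, ws)"
      by (simp only: prod.case sym_prod_eq homogeneous_del p power_add)
    finally show ?thesis using p by (simp add: sym_prod_eq)
  qed
  note ext = linear_ext_works[where sa = fscale and sb = fscale and L = Pc
      and I = "{(vs, ws). homogeneous vs \<and> homogeneous ws}"
      and u = "\<lambda>(vs, ws). sym_prod vs \<otimes> sym_prod ws" and g = ?g, folded P_def, OF flinear_Pc *]
  show "P \<Lambda> x = Pc x"
  proof (rule sym_pairs_eqI[OF ext(1) flinear_Pc x])
    fix vs ws assume h: "homogeneous vs" "homogeneous ws"
    then show "P \<Lambda> (sword vs \<otimes> sword ws) = Pc (sword vs \<otimes> sword ws)"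
      using ext(2)[of "(vs, ws)"] *[of "(vs, ws)"] by (simp add: sym_prod_eq)
  qed
qed

lemma tensor_prod_sword: "homogeneous vs \<Longrightarrow> homogeneous ws \<Longrightarrow> sword vs \<otimes> sword ws \<in> sym_pairs"
  by (intro tensor_prod_in_sym_pairs sword_in_sym)

lemma Pc_in_sym_pairs: "x \<in> sym_pairs \<Longrightarrow> Pc x \<in> sym_pairs"
proof (rule sym_pairs_into[OF flinear_Pc])
  fix vs ws assume h: "homogeneous vs" "homogeneous ws"
  have *: "sword vs' \<otimes> sword ws' \<in> sym_pairs"
    if "(c, v, vs') \<in> set (rpeel vs)" "(d, w, ws') \<in> set (lpeel ws)" for c v vs' d w ws'
    using h lpeel_props[OF that(2)] rpeel_props[OF that(1)] by (intro tensor_prod_sword) auto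
  show "Pc (sword vs \<otimes> sword ws) \<in> sym_pairs"
    unfolding Pc_sword[OF h] using * unfolding sym_pairs_def
    by (intro fs_span_sum_list) (auto intro!: fs_span_sum_list fs.span_scale split: prod.splits)
qed

lemma Pc_funpow_in_sym_pairs: "x \<in> sym_pairs \<Longrightarrow> (Pc ^^ k) x \<in> sym_pairs"
  by (induction k) (auto intro: Pc_in_sym_pairs)

lemma P_funpow: "x \<in> sym_pairs \<Longrightarrow> (P \<Lambda> ^^ k) x = (Pc ^^ k) x"
  by (induction k) (auto simp: P_eq_Pc Pc_funpow_in_sym_pairs)

subsection \<open>Insertion operators\<close>

definition icontr :: "'v \<Rightarrow> ('k, 'v) tensor \<Rightarrow> ('k, 'v) tensor" where
  "icontr v = lift (\<lambda>ws. if ws = [] then 0 else fscale (\<Lambda> v (hd ws)) (tens (tl ws)))"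

lemma flinear_icontr: "flinear (icontr v)"
  and icontr_tens: "icontr v (tens ws) = (if ws = [] then 0 else fscale (\<Lambda> v (hd ws)) (tens (tl ws)))"
proof -
  have "hd (xs @ w # ys) = (if xs = [] then w else hd xs)"
    "tl (xs @ w # ys) = (if xs = [] then ys else tl xs @ w # ys)" for xs w and ys :: "'v list"
    by (cases xs; simp)+
  note eqs = this
  have ml: "multilin (\<lambda>ws. if ws = [] then 0 else fscale (\<Lambda> v (hd ws)) (tens (tl ws)))"
    unfolding multilin_def eqs
    by (auto simp: form_bilinear tens_add tens_scale fs.scale_left_distrib fs.scale_right_distrib mult.commute)
  show "flinear (icontr v)"
    unfolding icontr_def by (rule flinear_lift[OF ml])
  show "icontr v (tens ws) = (if ws = [] then 0 else fscale (\<Lambda> v (hd ws)) (tens (tl ws)))"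
    unfolding icontr_def by (rule lift_tens[OF ml])
qed

text \<open>Insertion of \<open>v\<close> through \<open>\<Lambda>\<close>: the degree operator
  makes the contraction of the first letter a sum over all letters. By \<open>ins_vmul\<close> it is
  a graded derivation of the symmetric product.\<close>

definition ins :: "'v \<Rightarrow> ('k, 'v) tensor \<Rightarrow> ('k, 'v) tensor" where
  "ins v t = icontr v (degop t)"

lemma flinear_ins: "flinear (ins v)"
  unfolding ins_def[abs_def] by (rule flinear_compose[OF flinear_icontr flinear_degop])

lemma ins_sword:
  assumes "homogeneous ws"
  shows "ins v (sword ws) = (\<Sum>(d, w, ws')\<leftarrow>lpeel ws. fscale (d * \<Lambda> v w) (sword ws'))"
proof -
  have ic: "icontr v (tconc (tens [w]) t) = fscale (\<Lambda> v w) t" if "t \<in> tensors" for w t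
    by (rule flinear_eq_on_tensors[OF flinear_compose[OF flinear_icontr flinear_tconc(1)]
          flinear_fscale[OF flinear_id] that])
      (simp add: icontr_tens)
  have "ins v (sword ws) = (\<Sum>(d, w, ws')\<leftarrow>lpeel ws. fscale d (icontr v (tconc (tens [w]) (sword ws'))))"
    unfolding ins_def degop_sword[OF assms] sword_lpeel[OF assms] flinear_sum_list[OF flinear_icontr]
      split_def flinear_scale[OF flinear_icontr] ..
  also have "\<dots> = (\<Sum>(d, w, ws')\<leftarrow>lpeel ws. fscale (d * \<Lambda> v w) (sword ws'))"
  proof (rule sum_list_cong_peel)
    fix d w ws' assume "(d, w, ws') \<in> set (lpeel ws)"
    then have "homogeneous ws'" using lpeel_props assms by blast
    then show "fscale d (icontr v (tconc (tens [w]) (sword ws'))) = fscale (d * \<Lambda> v w) (sword ws')"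
      by (simp add: ic)
  qed
  finally show ?thesis .
qed

lemma ins_in_sym: "a \<in> sym_algebra \<Longrightarrow> ins v a \<in> sym_algebra"
  unfolding sym_algebra_eq
proof (erule flinear_span_into[OF flinear_ins, rotated], clarify)
  fix ws assume "homogeneous ws"
  then show "ins v (sword ws) \<in> fs.span (sword ` {vs. homogeneous vs})"
    unfolding ins_sword[OF \<open>homogeneous ws\<close>] using lpeel_props
    by (intro fs_span_sum_list) (auto intro!: fs.span_scale fs.span_base[OF imageI] split: prod.splits)
qed

lemma vmul_in_sym: "v \<in> V0 \<union> V1 \<Longrightarrow> a \<in> sym_algebra \<Longrightarrow> vmul v a \<in> sym_algebra"
  unfolding sym_algebra_eq
  by (erule flinear_span_into[OF flinear_vmul, rotated]) (auto simp: vmul_sword intro!: fs.span_base)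

text \<open>Leibniz rule for one letter. A letter \<open>u\<close> taken from behind
  \<open>w\<close> comes with the sign of \<open>u\<close> and \<open>w\<close>; it may be written
  with \<open>v\<close> instead of \<open>u\<close>, because \<open>\<Lambda>\<close> is even and
  the term vanishes unless \<open>u\<close> and \<open>v\<close> have equal parity.\<close>

lemma ins_vmul:
  assumes v: "v \<in> V0 \<union> V1" and w: "w \<in> V0 \<union> V1" and a: "a \<in> sym_algebra"
  shows "ins v (vmul w a) = fscale (\<Lambda> v w) a + fscale (hsign (parity v * parity w)) (vmul w (ins v a))"
proof (rule flinear_eq_on_sym[OF _ _ a])
  show "flinear (\<lambda>a. ins v (vmul w a))" by (rule flinear_compose[OF flinear_ins flinear_vmul])
  show "flinear (\<lambda>a. fscale (\<Lambda> v w) a + fscale (hsign (parity v * parity w)) (vmul w (ins v a)))"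
    by (intro flinear_plus flinear_fscale flinear_id flinear_compose[OF flinear_vmul flinear_ins])
  fix ws assume ws: "homogeneous ws"
  have "ins v (vmul w (sword ws)) = fscale (\<Lambda> v w) (sword ws) +
      (\<Sum>(d, u, us)\<leftarrow>lpeel ws. fscale (hsign (parity u * parity w) * d * \<Lambda> v u) (sword (w # us)))"
    using ws w by (simp add: vmul_sword ins_sword split_def comp_def)
  also have "(\<Sum>(d, u, us)\<leftarrow>lpeel ws. fscale (hsign (parity u * parity w) * d * \<Lambda> v u) (sword (w # us))) =
      (\<Sum>(d, u, us)\<leftarrow>lpeel ws. fscale (hsign (parity v * parity w)) (fscale (d * \<Lambda> v u) (vmul w (sword us))))"
  proof (rule sum_list_cong_peel)
    fix d u us assume "(d, u, us) \<in> set (lpeel ws)"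
    then have "homogeneous us" "u \<in> V0 \<union> V1" using lpeel_props ws by blast+
    then show "fscale (hsign (parity u * parity w) * d * \<Lambda> v u) (sword (w # us)) =
        fscale (hsign (parity v * parity w)) (fscale (d * \<Lambda> v u) (vmul w (sword us)))"
      using form_parity[OF v, of u] w by (cases "\<Lambda> v u = 0") (auto simp: vmul_sword mult.assoc)
  qed
  also have "\<dots> = fscale (hsign (parity v * parity w)) (vmul w (ins v (sword ws)))"
    unfolding ins_sword[OF ws] flinear_sum_list[OF flinear_vmul] sum_list_fscale_right split_def
      flinear_scale[OF flinear_vmul] ..
  finally show "ins v (vmul w (sword ws)) =
      fscale (\<Lambda> v w) (sword ws) + fscale (hsign (parity v * parity w)) (vmul w (ins v (sword ws)))" .
qed

lemma ins_tens_Nil: "ins v (tens []) = 0"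
  by (simp add: ins_def degop_tens flinear_0[OF flinear_icontr])

lemma hsign_square: "hsign n * hsign n = 1"
  by (simp add: power_mult_distrib[symmetric])

text \<open>Both orders are expanded by the Leibniz rule at the first letter of the word. The cross
  terms match because a letter paired with a vector can be assumed to have the parity of that
  vector.\<close>

lemma ins_ins:
  assumes v: "v \<in> V0 \<union> V1" and u: "u \<in> V0 \<union> V1" and a: "a \<in> sym_algebra"
  shows "ins v (ins u a) = fscale (hsign (parity v * parity u)) (ins u (ins v a))"
proof (rule flinear_eq_on_sym[OF _ _ a])
  show "flinear (\<lambda>a. ins v (ins u a))" by (rule flinear_compose[OF flinear_ins flinear_ins])
  show "flinear (\<lambda>a. fscale (hsign (parity v * parity u)) (ins u (ins v a)))"
    by (intro flinear_fscale flinear_compose[OF flinear_ins flinear_ins])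
  fix ws assume "homogeneous ws"
  then show "ins v (ins u (sword ws)) = fscale (hsign (parity v * parity u)) (ins u (ins v (sword ws)))"
  proof (induction ws)
    case Nil
    show ?case by (simp add: ins_tens_Nil flinear_0[OF flinear_ins])
  next
    case (Cons w ws)
    then have w: "w \<in> V0 \<union> V1" and ws: "homogeneous ws" by auto
    define s where "s x y = hsign (parity x * parity y)" for x y
    have ss: "s x y * s x y = 1" for x y unfolding s_def by (rule hsign_square)
    \<comment> \<open>In \<open>f1\<close> the letter \<open>w\<close> may be given the parity of
      \<open>v\<close>, in \<open>f2\<close> that of \<open>u\<close>; then both sides carry the
      same sign.\<close>
    have f1: "s v u * \<Lambda> v w = s u w * \<Lambda> v w" and f2: "s v u * (s v w * \<Lambda> u w) = \<Lambda> u w"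
    proof -
      show "s v u * \<Lambda> v w = s u w * \<Lambda> v w"
        using form_parity[OF v w] by (cases "\<Lambda> v w = 0") (simp_all add: s_def mult.commute)
      show "s v u * (s v w * \<Lambda> u w) = \<Lambda> u w"
        using form_parity[OF u w] by (cases "\<Lambda> u w = 0") (simp_all add: s_def minus_one_power_square)
    qed
    have exp: "ins x (ins y (sword (w # ws))) = fscale (\<Lambda> y w) (ins x (sword ws)) +
        (fscale (s y w) (fscale (\<Lambda> x w) (ins y (sword ws))) +
         fscale (s y w) (fscale (s x w) (vmul w (ins x (ins y (sword ws))))))"
      if x: "x \<in> V0 \<union> V1" and y: "y \<in> V0 \<union> V1" for x y
    proof -
      have "ins y (sword (w # ws)) = fscale (\<Lambda> y w) (sword ws) + fscale (s y w) (vmul w (ins y (sword ws)))"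
        using ins_vmul[OF y w sword_in_sym[OF ws]] w ws by (simp add: vmul_sword s_def)
      moreover have "ins x (vmul w (ins y (sword ws))) =
          fscale (\<Lambda> x w) (ins y (sword ws)) + fscale (s x w) (vmul w (ins x (ins y (sword ws))))"
        using ins_vmul[OF x w ins_in_sym[OF sword_in_sym[OF ws]]] by (simp add: s_def)
      ultimately show ?thesis
        by (simp only: flinear_add[OF flinear_ins] flinear_scale[OF flinear_ins] fs.scale_right_distrib)
    qed
    have IH: "ins v (ins u (sword ws)) = fscale (s v u) (ins u (ins v (sword ws)))"
      using Cons.IH[OF ws] by (simp add: s_def)
    have "fscale (s v u) (ins u (ins v (sword (w # ws)))) =
        fscale (s v u * \<Lambda> v w) (ins u (sword ws)) +
        (fscale (s v u * (s v w * \<Lambda> u w)) (ins v (sword ws)) +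
         fscale (s v w * s u w) (vmul w (fscale (s v u) (ins u (ins v (sword ws))))))"
      unfolding exp[OF u v] flinear_scale[OF flinear_vmul] by (simp add: fs.scale_right_distrib mult_ac)
    also have "\<dots> = ins v (ins u (sword (w # ws)))"
      unfolding exp[OF v u] IH[symmetric] f1 f2 by (simp add: add_ac mult_ac)
    finally have "ins v (ins u (sword (w # ws))) = fscale (s v u) (ins u (ins v (sword (w # ws))))" ..
    then show ?case unfolding s_def .
  qed
qed

section \<open>Multiplication and insertion on pairs of tensors\<close>

definition vmul_left :: "'v \<Rightarrow> ('k, 'v) tensor2 \<Rightarrow> ('k, 'v) tensor2" where
  "vmul_left v = tensor_map (vmul v) (\<lambda>t. t)"

definition ins_left :: "'v \<Rightarrow> ('k, 'v) tensor2 \<Rightarrow> ('k, 'v) tensor2" where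
  "ins_left v = tensor_map (ins v) (\<lambda>t. t)"

text \<open>The inserted vector reaches the right factor by passing the left one; the grading
  operator records the sign of this.\<close>

definition ins_right :: "'v \<Rightarrow> ('k, 'v) tensor2 \<Rightarrow> ('k, 'v) tensor2" where
  "ins_right v = tensor_map (gradop (parity v)) (ins v)"

lemma flinear_ops: "flinear (vmul_left v)" "flinear (ins_left v)" "flinear (ins_right v)"
  by (simp_all add: vmul_left_def ins_left_def ins_right_def flinear_tensor_map)

lemma ops_prod:
  "vmul_left v (s \<otimes> t) = vmul v s \<otimes> t" "ins_left v (s \<otimes> t) = ins v s \<otimes> t"
  "ins_right v (s \<otimes> t) = gradop (parity v) s \<otimes> ins v t"
  by (simp_all add: vmul_left_def ins_left_def ins_right_def tensor_map_prod flinear_id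
      flinear_vmul flinear_ins flinear_gradop)

lemma gradop_in_sym: "a \<in> sym_algebra \<Longrightarrow> gradop e a \<in> sym_algebra"
  unfolding sym_algebra_eq
  by (erule flinear_span_into[OF flinear_gradop, rotated])
    (auto simp: gradop_sword intro!: fs.span_scale fs.span_base[OF imageI])

lemma ops_in_sym_pairs:
  assumes "x \<in> sym_pairs"
  shows "v \<in> V0 \<union> V1 \<Longrightarrow> vmul_left v x \<in> sym_pairs" "ins_left v x \<in> sym_pairs" "ins_right v x \<in> sym_pairs"
  by (rule sym_pairs_into[OF _ assms];
      auto simp: ops_prod flinear_ops
        intro!: tensor_prod_in_sym_pairs vmul_in_sym ins_in_sym gradop_in_sym)+

lemma ins_right_vmul_left:
  assumes "v \<in> V0 \<union> V1" "u \<in> V0 \<union> V1" "x \<in> sym_pairs"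
  shows "ins_right v (vmul_left u x) = fscale (hsign (parity v * parity u)) (vmul_left u (ins_right v x))"
proof (rule sym_pairs_eqI[OF _ _ assms(3)])
  show "flinear (\<lambda>x. ins_right v (vmul_left u x))"
    by (rule flinear_compose[OF flinear_ops(3,1)])
  show "flinear (\<lambda>x. fscale (hsign (parity v * parity u)) (vmul_left u (ins_right v x)))"
    by (rule flinear_fscale[OF flinear_compose[OF flinear_ops(1,3)]])
qed (use assms in \<open>simp add: ops_prod vmul_sword gradop_sword flinear_scale[OF flinear_vmul] flinear_scale[OF flinear_ops(1)]
      fbilinear_scale[OF fbilinear_tensor_prod] distrib_left power_add\<close>)

lemma ins_left_vmul_left:
  assumes "v \<in> V0 \<union> V1" "u \<in> V0 \<union> V1" "x \<in> sym_pairs"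
  shows "ins_left v (vmul_left u x) =
    fscale (\<Lambda> v u) x + fscale (hsign (parity v * parity u)) (vmul_left u (ins_left v x))"
proof -
  have "flinear (\<lambda>x. ins_left v (vmul_left u x))"
    by (rule flinear_compose[OF flinear_ops(2,1)])
  moreover have "flinear (\<lambda>x. fscale (\<Lambda> v u) x + fscale (hsign (parity v * parity u)) (vmul_left u (ins_left v x)))"
    by (rule flinear_plus[OF flinear_fscale[OF flinear_id] flinear_fscale[OF flinear_compose[OF flinear_ops(1,2)]]])
  ultimately show ?thesis
    by (rule sym_pairs_eqI[OF _ _ assms(3)])
      (simp add: ops_prod ins_vmul[OF assms(1,2)] fbilinear_add[OF fbilinear_tensor_prod]
        fbilinear_scale[OF fbilinear_tensor_prod])
qed

lemma ins_right_ins_right: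
  assumes "v \<in> V0 \<union> V1" "u \<in> V0 \<union> V1" "x \<in> sym_pairs"
  shows "ins_right v (ins_right u x) = fscale (hsign (parity v * parity u)) (ins_right u (ins_right v x))"
proof (rule sym_pairs_eqI[OF _ _ assms(3)])
  show "flinear (\<lambda>x. ins_right v (ins_right u x))"
    by (rule flinear_compose[OF flinear_ops(3,3)])
  show "flinear (\<lambda>x. fscale (hsign (parity v * parity u)) (ins_right u (ins_right v x)))"
    by (rule flinear_fscale[OF flinear_compose[OF flinear_ops(3,3)]])
qed (simp add: ops_prod gradop_sword flinear_scale[OF flinear_gradop] flinear_scale[OF flinear_ops(3)] ins_ins[OF assms(1,2)]
      fbilinear_scale[OF fbilinear_tensor_prod] mult_ac)

text \<open>As \<open>\<Lambda>\<close> is even, the letters removed by \<open>ins v\<close> have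
  the parity of \<open>v\<close>; the sign is the contribution of that letter to the total
  parity.\<close>

lemma gradop_ins:
  assumes v: "v \<in> V0 \<union> V1" and u: "u \<in> V0 \<union> V1" and a: "a \<in> sym_algebra"
  shows "ins v (gradop (parity u) a) = fscale (hsign (parity v * parity u)) (gradop (parity u) (ins v a))"
proof (rule flinear_eq_on_sym[OF _ _ a])
  show "flinear (\<lambda>a. ins v (gradop (parity u) a))" by (rule flinear_compose[OF flinear_ins flinear_gradop])
  show "flinear (\<lambda>a. fscale (hsign (parity v * parity u)) (gradop (parity u) (ins v a)))"
    by (rule flinear_fscale[OF flinear_compose[OF flinear_gradop flinear_ins]])
  fix ws assume ws: "homogeneous ws"
  have "ins v (gradop (parity u) (sword ws)) =
      (\<Sum>(d, w, ws')\<leftarrow>lpeel ws. fscale (hsign (parity u * par ws) * (d * \<Lambda> v w)) (sword ws'))"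
    by (simp add: gradop_sword ws flinear_scale[OF flinear_ins] ins_sword sum_list_fscale_right split_def)
  also have "\<dots> = (\<Sum>(d, w, ws')\<leftarrow>lpeel ws. fscale (hsign (parity v * parity u))
      (fscale (d * \<Lambda> v w) (gradop (parity u) (sword ws'))))"
  proof (rule sum_list_cong_peel)
    fix d w ws' assume p: "(d, w, ws') \<in> set (lpeel ws)"
    have w: "w \<in> V0 \<union> V1" "homogeneous ws'" "par ws = parity w + par ws'"
      using lpeel_props[OF p] ws by auto
    show "fscale (hsign (parity u * par ws) * (d * \<Lambda> v w)) (sword ws') =
      fscale (hsign (parity v * parity u)) (fscale (d * \<Lambda> v w) (gradop (parity u) (sword ws')))"
      using form_parity[OF v w(1)] w
      by (cases "\<Lambda> v w = 0") (simp_all add: gradop_sword distrib_left power_add mult_ac)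
  qed
  also have "\<dots> = fscale (hsign (parity v * parity u)) (gradop (parity u) (ins v (sword ws)))"
    by (simp add: ins_sword[OF ws] flinear_sum_list[OF flinear_gradop] sum_list_fscale_right split_def
        flinear_scale[OF flinear_gradop])
  finally show "ins v (gradop (parity u) (sword ws)) =
      fscale (hsign (parity v * parity u)) (gradop (parity u) (ins v (sword ws)))" .
qed

lemma ins_left_ins_right:
  assumes "v \<in> V0 \<union> V1" "u \<in> V0 \<union> V1" "x \<in> sym_pairs"
  shows "ins_left v (ins_right u x) = fscale (hsign (parity v * parity u)) (ins_right u (ins_left v x))"
proof (rule sym_pairs_eqI[OF _ _ assms(3)])
  show "flinear (\<lambda>x. ins_left v (ins_right u x))"
    by (rule flinear_compose[OF flinear_ops(2,3)])
  show "flinear (\<lambda>x. fscale (hsign (parity v * parity u)) (ins_right u (ins_left v x)))"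
    by (rule flinear_fscale[OF flinear_compose[OF flinear_ops(3,2)]])
qed (simp add: ops_prod gradop_ins[OF assms(1,2)] fbilinear_scale[OF fbilinear_tensor_prod])

lemma flinear_Pc_sword:
  assumes "flinear L" "homogeneous vs" "homogeneous ws"
  shows "L (Pc (sword vs \<otimes> sword ws)) = (\<Sum>(c, v, vs')\<leftarrow>rpeel vs. \<Sum>(d, w, ws')\<leftarrow>lpeel ws.
    fscale (c * d * \<Lambda> v w) (L (sword vs' \<otimes> sword ws')))"
  by (simp add: Pc_sword[OF assms(2,3)] flinear_sum_list[OF assms(1)] flinear_scale[OF assms(1)] split_def)

text \<open>The new first letter on the left is either kept or contracted. To be contracted it has
  to pass the whole left word, and this term is \<open>ins_right v\<close>.\<close>

lemma Pc_vmul_left: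
  assumes v: "v \<in> V0 \<union> V1" and x: "x \<in> sym_pairs"
  shows "Pc (vmul_left v x) = vmul_left v (Pc x) + ins_right v x"
proof (rule sym_pairs_eqI[OF _ _ x])
  show "flinear (\<lambda>x. Pc (vmul_left v x))" by (rule flinear_compose[OF flinear_Pc flinear_ops(1)])
  show "flinear (\<lambda>x. vmul_left v (Pc x) + ins_right v x)"
    by (rule flinear_plus[OF flinear_compose[OF flinear_ops(1) flinear_Pc] flinear_ops(3)])
  fix vs ws assume h: "homogeneous vs" "homogeneous ws"
  have eq: "Pc (vmul_left v (sword vs \<otimes> sword ws)) =
      (\<Sum>(d, w, ws')\<leftarrow>lpeel ws. fscale (hsign (parity v * par vs) * d * \<Lambda> v w) (sword vs \<otimes> sword ws')) +
      (\<Sum>(c, u, vs')\<leftarrow>rpeel vs. \<Sum>(d, w, ws')\<leftarrow>lpeel ws.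
        fscale (c * d * \<Lambda> u w) (sword (v # vs') \<otimes> sword ws'))"
    using v h by (simp add: ops_prod vmul_sword Pc_sword comp_def split_def)
  have eq1: "(\<Sum>(d, w, ws')\<leftarrow>lpeel ws. fscale (hsign (parity v * par vs) * d * \<Lambda> v w) (sword vs \<otimes> sword ws')) =
      ins_right v (sword vs \<otimes> sword ws)"
  proof -
    have tp: "flinear (\<lambda>t. sword vs \<otimes> t)"
      using fbilinear_tensor_prod unfolding fbilinear_def by blast
    show ?thesis
      by (simp add: ops_prod gradop_sword h ins_sword flinear_sum_list[OF tp] split_def
          fbilinear_scale[OF fbilinear_tensor_prod] sum_list_fscale_right mult.assoc)
  qed
  have eq2: "(\<Sum>(c, u, vs')\<leftarrow>rpeel vs. \<Sum>(d, w, ws')\<leftarrow>lpeel ws.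
        fscale (c * d * \<Lambda> u w) (sword (v # vs') \<otimes> sword ws')) = vmul_left v (Pc (sword vs \<otimes> sword ws))"
  proof -
    have "vmul_left v (Pc (sword vs \<otimes> sword ws)) = (\<Sum>(c, u, vs')\<leftarrow>rpeel vs. \<Sum>(d, w, ws')\<leftarrow>lpeel ws.
        fscale (c * d * \<Lambda> u w) (vmul v (sword vs') \<otimes> sword ws'))"
      by (simp add: flinear_Pc_sword[OF flinear_ops(1) h] ops_prod)
    also have "\<dots> = (\<Sum>(c, u, vs')\<leftarrow>rpeel vs. \<Sum>(d, w, ws')\<leftarrow>lpeel ws.
        fscale (c * d * \<Lambda> u w) (sword (v # vs') \<otimes> sword ws'))"
    proof (intro sum_list_cong_peel)
      fix c u vs' d w ws' assume "(c, u, vs') \<in> set (rpeel vs)"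
      from rpeel_props[OF this] h have "homogeneous vs'" by simp
      then show "fscale (c * d * \<Lambda> u w) (vmul v (sword vs') \<otimes> sword ws') =
        fscale (c * d * \<Lambda> u w) (sword (v # vs') \<otimes> sword ws')"
        using v by (simp add: vmul_sword)
    qed
    finally show ?thesis ..
  qed
  show "Pc (vmul_left v (sword vs \<otimes> sword ws)) =
      vmul_left v (Pc (sword vs \<otimes> sword ws)) + ins_right v (sword vs \<otimes> sword ws)"
    unfolding eq eq1 eq2 by (rule add.commute)
qed

text \<open>Left factors are built from the unit by multiplication with letters, so identities
  between operators on pairs reduce to their behaviour under \<open>vmul_left\<close>.\<close>

lemma sym_pairs_word_induct:
  assumes x: "x \<in> sym_pairs" and L: "flinear L" and M: "flinear M"
    and nil: "\<And>ws. homogeneous ws \<Longrightarrow> L (tens [] \<otimes> sword ws) = M (tens [] \<otimes> sword ws)"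
    and step: "\<And>v x. v \<in> V0 \<union> V1 \<Longrightarrow> x \<in> sym_pairs \<Longrightarrow> L x = M x \<Longrightarrow> L (vmul_left v x) = M (vmul_left v x)"
  shows "L x = M x"
proof (rule sym_pairs_eqI[OF L M x])
  fix vs ws assume "homogeneous vs" "homogeneous ws"
  then show "L (sword vs \<otimes> sword ws) = M (sword vs \<otimes> sword ws)"
  proof (induction vs)
    case (Cons v vs)
    then show ?case
      using step[of v "sword vs \<otimes> sword ws"] tensor_prod_sword[of vs ws]
      by (simp add: ops_prod vmul_sword)
  qed (simp add: nil)
qed

lemma Pc_Nil: "Pc (tens [] \<otimes> t) = 0"
  by (simp add: Pc_prod degop_tens fbilinear_zero[OF fbilinear_tensor_prod] flinear_0[OF flinear_contr])

lemma ops_Nil: "ins_left v (tens [] \<otimes> t) = 0" "ins_right v (tens [] \<otimes> t) = tens [] \<otimes> ins v t"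
  using gradop_tens[of "[]"]
  by (simp_all add: ops_prod ins_tens_Nil fbilinear_zero[OF fbilinear_tensor_prod])

text \<open>Moving \<open>vmul_left u\<close> past \<open>Pc\<close> leaves
  \<open>ins_right u\<close>. This term commutes with \<open>ins_right v\<close> up to the same sign
  as \<open>vmul_left u\<close> does, so the sign is common to all terms and factors out.\<close>

lemma Pc_ins_right:
  assumes v: "v \<in> V0 \<union> V1" and x: "x \<in> sym_pairs"
  shows "Pc (ins_right v x) = ins_right v (Pc x)"
proof (rule sym_pairs_word_induct[OF x])
  show "flinear (\<lambda>x. Pc (ins_right v x))" by (rule flinear_compose[OF flinear_Pc flinear_ops(3)])
  show "flinear (\<lambda>x. ins_right v (Pc x))" by (rule flinear_compose[OF flinear_ops(3) flinear_Pc])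
  fix u x assume u: "u \<in> V0 \<union> V1" and x: "x \<in> sym_pairs" and IH: "Pc (ins_right v x) = ins_right v (Pc x)"
  let ?s = "hsign (parity v * parity u)"
  have "Pc (ins_right v (vmul_left u x)) =
      fscale ?s (vmul_left u (Pc (ins_right v x)) + ins_right u (ins_right v x))"
    by (simp add: ins_right_vmul_left[OF v u x] flinear_scale[OF flinear_Pc]
        Pc_vmul_left[OF u ops_in_sym_pairs(3)[OF x]])
  also have "\<dots> = ins_right v (Pc (vmul_left u x))"
    by (simp add: IH Pc_vmul_left[OF u x] flinear_add[OF flinear_ops(3)]
        ins_right_vmul_left[OF v u Pc_in_sym_pairs[OF x]] ins_right_ins_right[OF v u x] fs.scale_right_distrib)
  finally show "Pc (ins_right v (vmul_left u x)) = ins_right v (Pc (vmul_left u x))" .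
qed (simp add: ops_Nil Pc_Nil flinear_0[OF flinear_ops(3)])

lemma Pc_ins_left:
  assumes v: "v \<in> V0 \<union> V1" and x: "x \<in> sym_pairs"
  shows "Pc (ins_left v x) = ins_left v (Pc x)"
proof (rule sym_pairs_word_induct[OF x])
  show "flinear (\<lambda>x. Pc (ins_left v x))" by (rule flinear_compose[OF flinear_Pc flinear_ops(2)])
  show "flinear (\<lambda>x. ins_left v (Pc x))" by (rule flinear_compose[OF flinear_ops(2) flinear_Pc])
  fix u x assume u: "u \<in> V0 \<union> V1" and x: "x \<in> sym_pairs" and IH: "Pc (ins_left v x) = ins_left v (Pc x)"
  let ?s = "hsign (parity v * parity u)"
  have "Pc (ins_left v (vmul_left u x)) = fscale (\<Lambda> v u) (Pc x) +
      fscale ?s (vmul_left u (Pc (ins_left v x)) + ins_right u (ins_left v x))"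
    by (simp add: ins_left_vmul_left[OF v u x] flinear_scale[OF flinear_Pc] flinear_add[OF flinear_Pc]
        Pc_vmul_left[OF u ops_in_sym_pairs(2)[OF x]])
  also have "\<dots> = ins_left v (Pc (vmul_left u x))"
    by (simp add: IH Pc_vmul_left[OF u x] flinear_add[OF flinear_ops(2)]
        ins_left_vmul_left[OF v u Pc_in_sym_pairs[OF x]] ins_left_ins_right[OF v u x]
        fs.scale_right_distrib add.assoc)
  finally show "Pc (ins_left v (vmul_left u x)) = ins_left v (Pc (vmul_left u x))" .
qed (simp add: ops_Nil Pc_Nil flinear_0[OF flinear_ops(2)] flinear_0[OF flinear_Pc])

lemma mult_vmul_left:
  assumes v: "v \<in> V0 \<union> V1" and x: "x \<in> sym_pairs"
  shows "mult (vmul_left v x) = vmul v (mult x)"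
  by (rule sym_pairs_eqI[OF flinear_compose[OF flinear_mult flinear_ops(1)]
        flinear_compose[OF flinear_vmul flinear_mult] x])
    (use v in \<open>simp add: ops_prod vmul_sword mult_sword\<close>)

lemma mult_Nil: "a \<in> sym_algebra \<Longrightarrow> mult (tens [] \<otimes> a) = a"
proof (rule flinear_eq_on_sym[OF _ flinear_id])
  show "flinear (\<lambda>a. mult (tens [] \<otimes> a))"
    using fbilinear_tensor_prod unfolding fbilinear_def by (auto intro: flinear_compose[OF flinear_mult])
  show "homogeneous vs \<Longrightarrow> mult (tens [] \<otimes> sword vs) = sword vs" for vs
    using mult_sword[of "[]" vs] by simp
qed

text \<open>By induction on the left word the Leibniz rule for a product of two tensors follows from
  that for a single letter, \<open>ins_vmul\<close>.\<close>

lemma ins_mult: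
  assumes v: "v \<in> V0 \<union> V1" and x: "x \<in> sym_pairs"
  shows "ins v (mult x) = mult (ins_left v x + ins_right v x)"
proof (rule sym_pairs_word_induct[OF x])
  show "flinear (\<lambda>x. ins v (mult x))" by (rule flinear_compose[OF flinear_ins flinear_mult])
  show "flinear (\<lambda>x. mult (ins_left v x + ins_right v x))"
    by (rule flinear_compose[OF flinear_mult flinear_plus[OF flinear_ops(2,3)]])
  show "ins v (mult (tens [] \<otimes> sword ws)) = mult (ins_left v (tens [] \<otimes> sword ws) + ins_right v (tens [] \<otimes> sword ws))"
    if "homogeneous ws" for ws
    using that by (simp add: ops_Nil mult_Nil ins_in_sym)
  fix u x assume u: "u \<in> V0 \<union> V1" and x: "x \<in> sym_pairs"
    and IH: "ins v (mult x) = mult (ins_left v x + ins_right v x)"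
  let ?s = "hsign (parity v * parity u)"
  have "ins v (mult (vmul_left u x)) = fscale (\<Lambda> v u) (mult x) + fscale ?s (vmul u (ins v (mult x)))"
    by (simp add: mult_vmul_left[OF u x] ins_vmul[OF v u mult_in_sym[OF x]])
  also have "\<dots> = mult (ins_left v (vmul_left u x) + ins_right v (vmul_left u x))"
    by (simp add: IH ins_left_vmul_left[OF v u x] ins_right_vmul_left[OF v u x] flinear_add[OF flinear_mult]
        flinear_scale[OF flinear_mult] mult_vmul_left[OF u ops_in_sym_pairs(2)[OF x]]
        mult_vmul_left[OF u ops_in_sym_pairs(3)[OF x]] fs.scale_right_distrib
        flinear_add[OF flinear_vmul] add.assoc)
  finally show "ins v (mult (vmul_left u x)) = mult (ins_left v (vmul_left u x) + ins_right v (vmul_left u x))" .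
qed

subsection \<open>The exponential series and associativity\<close>

lemma Pc_funpow_tens_zero: "length vs < k \<Longrightarrow> (Pc ^^ k) (tens vs \<otimes> tens ws) = 0"
proof (induction "length vs" arbitrary: vs ws k)
  case 0
  then obtain k' where "k = Suc k'" by (cases k) auto
  then show ?case
    using 0 by (simp add: funpow_swap1 Pc_tens flinear_0[OF flinear_funpow[OF flinear_Pc]] del: funpow.simps)
      (simp add: funpow_Suc_right Pc_tens flinear_0[OF flinear_funpow[OF flinear_Pc]] del: funpow.simps)
next
  case (Suc n)
  then obtain k' where k: "k = Suc k'" by (cases k) auto
  have "(Pc ^^ k') (tens (butlast vs) \<otimes> tens (tl ws)) = 0"
    using Suc k by (intro Suc(1)) auto
  then show ?case
    by (simp add: k funpow_Suc_right Pc_tens flinear_0[OF flinear_funpow[OF flinear_Pc]]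
        flinear_scale[OF flinear_funpow[OF flinear_Pc]] del: funpow.simps)
qed

text \<open>Every contraction shortens the left words. Local nilpotence replaces the series over the
  nonzero powers, whose index set varies with the argument, by sums over a common finite range, for
  which linearity is plain.\<close>

lemma Pc_nilpotent:
  assumes "x \<in> pairs"
  obtains K where "\<And>k. k \<ge> K \<Longrightarrow> (Pc ^^ k) x = 0"
proof -
  have "\<exists>K. \<forall>k\<ge>K. (Pc ^^ k) x = 0"
    using assms unfolding pairs_def
  proof (induction rule: fs.span_induct_alt)
    case base
    show ?case by (simp add: flinear_0[OF flinear_funpow[OF flinear_Pc]])
  next
    case (step c y x)
    then obtain K where K: "\<And>k. k \<ge> K \<Longrightarrow> (Pc ^^ k) x = 0" by blast
    obtain vs ws where "y = tens vs \<otimes> tens ws" using step by blast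
    then have "(Pc ^^ k) (fscale c y + x) = 0" if "k \<ge> max K (Suc (length vs))" for k
      using that K[of k] Pc_funpow_tens_zero[of vs k ws]
      by (simp add: flinear_add[OF flinear_funpow[OF flinear_Pc]] flinear_scale[OF flinear_funpow[OF flinear_Pc]])
    then show ?case by blast
  qed
  then show thesis using that by blast
qed

text \<open>The exponential of \<open>z\<close> times \<open>Pc\<close>, over the same kind of index
  set as in \<open>star\<close>, so that the two can be compared term by term on the symmetric
  algebra.\<close>

definition expo :: "'k \<Rightarrow> ('k, 'v) tensor2 \<Rightarrow> ('k, 'v) tensor2" where
  "expo z x = (\<Sum>k | (Pc ^^ k) x \<noteq> 0. fscale (z ^ k / fact k) ((Pc ^^ k) x))"

lemma expo_eq:
  assumes "\<And>k. k \<ge> K \<Longrightarrow> (Pc ^^ k) x = 0"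
  shows "expo z x = (\<Sum>k<K. fscale (z ^ k / fact k) ((Pc ^^ k) x))"
  unfolding expo_def
  by (rule sum.mono_neutral_left) (auto intro: ccontr assms simp flip: not_le)

lemma expo_in_sym_pairs: "x \<in> sym_pairs \<Longrightarrow> expo z x \<in> sym_pairs"
  unfolding expo_def using Pc_funpow_in_sym_pairs unfolding sym_pairs_def
  by (intro fs.span_sum fs.span_scale) blast

lemma expo_add:
  assumes "x \<in> pairs" "y \<in> pairs"
  shows "expo z (x + y) = expo z x + expo z y"
proof -
  obtain K where K: "\<And>k. k \<ge> K \<Longrightarrow> (Pc ^^ k) x = 0" using Pc_nilpotent[OF assms(1)] by blast
  obtain L where L: "\<And>k. k \<ge> L \<Longrightarrow> (Pc ^^ k) y = 0" using Pc_nilpotent[OF assms(2)] by blast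
  note add = flinear_add[OF flinear_funpow[OF flinear_Pc]]
  show ?thesis
    by (subst (1 2 3) expo_eq[where K = "max K L"])
      (auto simp: K L add fs.scale_right_distrib sum.distrib)
qed

lemma expo_scale:
  assumes "x \<in> pairs"
  shows "expo z (fscale c x) = fscale c (expo z x)"
proof -
  obtain K where K: "\<And>k. k \<ge> K \<Longrightarrow> (Pc ^^ k) x = 0" using Pc_nilpotent[OF assms(1)] by blast
  note scale = flinear_scale[OF flinear_funpow[OF flinear_Pc]]
  show ?thesis
    by (subst (1 2) expo_eq[where K = K])
      (auto simp: K scale fs.scale_sum_right mult.commute)
qed

lemma Pc_funpow_ins_left:
  assumes "v \<in> V0 \<union> V1" "x \<in> sym_pairs"
  shows "(Pc ^^ k) (ins_left v x) = ins_left v ((Pc ^^ k) x)"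
  by (rule funpow_commute_on[where S = sym_pairs and f = Pc and g = "ins_left v"])
    (rule assms(2) Pc_in_sym_pairs Pc_ins_left[OF assms(1)]; assumption)+

text \<open>The commutator of \<open>Pc\<close> with \<open>vmul_left v\<close> is
  \<open>ins_right v\<close>, which commutes with \<open>Pc\<close>. As in the Heisenberg relations,
  the commutator with a power of \<open>Pc\<close> is then the exponent times
  \<open>ins_right v\<close> and the next lower power.\<close>

lemma Pc_funpow_vmul_left:
  assumes v: "v \<in> V0 \<union> V1" and x: "x \<in> sym_pairs"
  shows "(Pc ^^ Suc k) (vmul_left v x) =
    vmul_left v ((Pc ^^ Suc k) x) + fscale (of_nat (Suc k)) (ins_right v ((Pc ^^ k) x))"
proof -
  define Q where "Q k \<longleftrightarrow> (Pc ^^ Suc k) (vmul_left v x) =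
    vmul_left v ((Pc ^^ Suc k) x) + fscale (of_nat (Suc k)) (ins_right v ((Pc ^^ k) x))" for k
  have "Q (Suc k)" if "Q k" for k
  proof -
  have 1: "Pc (ins_right v ((Pc ^^ k) x)) = ins_right v ((Pc ^^ Suc k) x)"
    using Pc_ins_right[OF v Pc_funpow_in_sym_pairs[OF x]] by simp
  have "(Pc ^^ Suc (Suc k)) (vmul_left v x) =
    Pc (vmul_left v ((Pc ^^ Suc k) x)) + fscale (of_nat (Suc k)) (Pc (ins_right v ((Pc ^^ k) x)))"
    unfolding funpow.simps(2)[of "Suc k"] comp_apply[of Pc] \<open>Q k\<close>[unfolded Q_def] flinear_add[OF flinear_Pc]
      flinear_scale[OF flinear_Pc] ..
  also have "\<dots> = vmul_left v ((Pc ^^ Suc (Suc k)) x) + fscale (of_nat (Suc (Suc k))) (ins_right v ((Pc ^^ Suc k) x))"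
    unfolding 1 Pc_vmul_left[OF v Pc_funpow_in_sym_pairs[OF x]]
    by (simp only: of_nat_Suc[of "Suc k"] fs.scale_left_distrib fs.scale_one add.assoc
        funpow.simps(2)[of "Suc k"] comp_apply[of Pc])
  finally show ?thesis unfolding Q_def .
  qed
  moreover have "Q 0" by (simp add: Q_def Pc_vmul_left[OF v x])
  ultimately have "Q k" by (rule nat_induct[of Q, rotated])
  then show ?thesis unfolding Q_def .
qed

lemma expo_ins_left:
  assumes v: "v \<in> V0 \<union> V1" and x: "x \<in> sym_pairs"
  shows "expo z (ins_left v x) = ins_left v (expo z x)"
proof -
  obtain K where K: "\<And>k. k \<ge> K \<Longrightarrow> (Pc ^^ k) x = 0"
    using Pc_nilpotent[OF sym_pairs_subset[OF x]] by blast
  have K': "(Pc ^^ k) (ins_left v x) = 0" if "k \<ge> K" for k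
    unfolding Pc_funpow_ins_left[OF v x] K[OF that] by (rule flinear_0[OF flinear_ops(2)])
  have eqx: "expo z x = (\<Sum>k<K. fscale (z ^ k / fact k) ((Pc ^^ k) x))"
    by (rule expo_eq[OF K])
  have "expo z (ins_left v x) = (\<Sum>k<K. fscale (z ^ k / fact k) ((Pc ^^ k) (ins_left v x)))"
    by (rule expo_eq[OF K'])
  also have "\<dots> = ins_left v (expo z x)"
    unfolding eqx Pc_funpow_ins_left[OF v x] flinear_sum[OF flinear_ops(2)]
      flinear_scale[OF flinear_ops(2)] ..
  finally show ?thesis .
qed

text \<open>Exponentiated form of the commutator with powers of \<open>Pc\<close>: the exponent
  \<open>Suc k\<close> cancels one factor of the factorial, and the index shift leaves one factor
  \<open>z\<close>.\<close>

lemma expo_vmul_left: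
  assumes v: "v \<in> V0 \<union> V1" and x: "x \<in> sym_pairs"
  shows "expo z (vmul_left v x) = vmul_left v (expo z x) + fscale z (ins_right v (expo z x))"
proof -
  obtain K where K: "\<And>k. k \<ge> K \<Longrightarrow> (Pc ^^ k) x = 0"
    using Pc_nilpotent[OF sym_pairs_subset[OF x]] by blast
  \<comment> \<open>\<open>vmul_left v\<close> lengthens the left words by one letter, so one more
    power of \<open>Pc\<close> may survive.\<close>
  have K': "(Pc ^^ k) (vmul_left v x) = 0" if "k \<ge> Suc K" for k
  proof -
    obtain k' where "k = Suc k'" "k' \<ge> K" using \<open>k \<ge> Suc K\<close> by (metis Suc_le_D Suc_le_mono)
    then show ?thesis
      by (simp only: Pc_funpow_vmul_left[OF v x] K le_SucI flinear_0[OF flinear_ops(1)]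
          flinear_0[OF flinear_ops(3)] fs.scale_zero_right add_0)
  qed
  have eqx': "expo z x = (\<Sum>k<K. fscale (z ^ k / fact k) ((Pc ^^ k) x))"
    by (rule expo_eq[OF K])
  have eqx: "expo z x = (\<Sum>k<Suc K. fscale (z ^ k / fact k) ((Pc ^^ k) x))"
    by (rule expo_eq) (rule K, simp)
  have eq1: "expo z (vmul_left v x) = vmul_left v x +
      (\<Sum>k<K. fscale (z ^ Suc k / fact (Suc k)) ((Pc ^^ Suc k) (vmul_left v x)))"
  proof -
    have "expo z (vmul_left v x) = (\<Sum>k<Suc K. fscale (z ^ k / fact k) ((Pc ^^ k) (vmul_left v x)))"
      by (rule expo_eq[OF K'])
    then show ?thesis
      by (simp only: sum.lessThan_Suc_shift power_0 fact_0 div_by_1 fs.scale_one funpow_0 comp_apply)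
  qed
  have eq2: "vmul_left v x +
      (\<Sum>k<K. fscale (z ^ Suc k / fact (Suc k)) ((Pc ^^ Suc k) (vmul_left v x))) =
      (vmul_left v x + (\<Sum>k<K. fscale (z ^ Suc k / fact (Suc k)) (vmul_left v ((Pc ^^ Suc k) x)))) +
      (\<Sum>k<K. fscale z (fscale (z ^ k / fact k) (ins_right v ((Pc ^^ k) x))))"
  proof -
    have "z ^ Suc k / fact (Suc k) * of_nat (Suc k) = z * (z ^ k / fact k)" for k
      by (simp add: field_simps del: of_nat_Suc)
    then show ?thesis
      by (simp only: Pc_funpow_vmul_left[OF v x] fs.scale_right_distrib fs.scale_scale sum.distrib add.assoc)
  qed
  have "vmul_left v x + (\<Sum>k<K. fscale (z ^ Suc k / fact (Suc k)) (vmul_left v ((Pc ^^ Suc k) x))) =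
      (\<Sum>k<Suc K. fscale (z ^ k / fact k) (vmul_left v ((Pc ^^ k) x)))"
    by (simp only: sum.lessThan_Suc_shift power_0 fact_0 div_by_1 fs.scale_one funpow_0 comp_apply)
  also have "\<dots> = vmul_left v (expo z x)"
    unfolding eqx flinear_sum[OF flinear_ops(1)]
      flinear_scale[OF flinear_ops(1)] ..
  finally have eq3: "vmul_left v x + (\<Sum>k<K. fscale (z ^ Suc k / fact (Suc k)) (vmul_left v ((Pc ^^ Suc k) x))) =
      vmul_left v (expo z x)" .
  have eq4: "(\<Sum>k<K. fscale z (fscale (z ^ k / fact k) (ins_right v ((Pc ^^ k) x)))) =
      fscale z (ins_right v (expo z x))"
    unfolding eqx' flinear_sum[OF flinear_ops(3)] flinear_scale[OF flinear_ops(3)]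
      fs.scale_sum_right ..
  show ?thesis unfolding eq1 eq2 eq3 eq4 ..
qed

definition sprod :: "'k \<Rightarrow> ('k, 'v) tensor \<Rightarrow> ('k, 'v) tensor \<Rightarrow> ('k, 'v) tensor" where
  "sprod z a b = mult (expo z (a \<otimes> b))"

lemma mu_P_eq: "a \<in> sym_algebra \<Longrightarrow> b \<in> sym_algebra \<Longrightarrow> mu_P \<Lambda> k a b = mult ((Pc ^^ k) (a \<otimes> b))"
  by (simp add: mu_P_def P_funpow tensor_prod_in_sym_pairs mu_eq_mult sym_pairs_subset Pc_funpow_in_sym_pairs)

lemma star_eq_sprod:
  assumes "a \<in> sym_algebra" "b \<in> sym_algebra"
  shows "star \<Lambda> z a b = sprod z a b"
  using assms
  by (simp add: star_def sprod_def expo_def mu_P_eq P_funpow tensor_prod_in_sym_pairs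
      flinear_sum[OF flinear_mult] flinear_scale[OF flinear_mult])

lemma sprod_in_sym: "a \<in> sym_algebra \<Longrightarrow> b \<in> sym_algebra \<Longrightarrow> sprod z a b \<in> sym_algebra"
  unfolding sprod_def by (intro mult_in_sym expo_in_sym_pairs tensor_prod_in_sym_pairs)

lemma sprod_add:
  assumes "a \<in> tensors" "a' \<in> tensors" "b \<in> tensors"
  shows "sprod z (a + a') b = sprod z a b + sprod z a' b" "sprod z b (a + a') = sprod z b a + sprod z b a'"
  using assms
  by (simp_all add: sprod_def fbilinear_add[OF fbilinear_tensor_prod] expo_add tensor_prod_in_pairs
      flinear_add[OF flinear_mult])

lemma sprod_scale:
  assumes "a \<in> tensors" "b \<in> tensors"
  shows "sprod z (fscale c a) b = fscale c (sprod z a b)" "sprod z b (fscale c a) = fscale c (sprod z b a)"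
  using assms
  by (simp_all add: sprod_def fbilinear_scale[OF fbilinear_tensor_prod] expo_scale tensor_prod_in_pairs
      flinear_scale[OF flinear_mult])

lemma sprod_Nil: "b \<in> sym_algebra \<Longrightarrow> sprod z (tens []) b = b"
proof -
  assume b: "b \<in> sym_algebra"
  have "(Pc ^^ k) (tens [] \<otimes> b) = 0" if "k \<ge> 1" for k
    using that by (cases k)
      (auto simp: funpow_Suc_right Pc_Nil flinear_0[OF flinear_funpow[OF flinear_Pc]] simp del: funpow.simps)
  from expo_eq[where K = 1, OF this] have "expo z (tens [] \<otimes> b) = tens [] \<otimes> b" by simp
  then show ?thesis using b by (simp add: sprod_def mult_Nil)
qed

text \<open>Star multiplication by \<open>v\<close> from the left: \<open>v \<star> a = v a + z i\<^sub>v a\<close>.\<close>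

definition vstar :: "'k \<Rightarrow> 'v \<Rightarrow> ('k, 'v) tensor \<Rightarrow> ('k, 'v) tensor" where
  "vstar z v a = vmul v a + fscale z (ins v a)"

lemma vstar_in_sym: "v \<in> V0 \<union> V1 \<Longrightarrow> a \<in> sym_algebra \<Longrightarrow> vstar z v a \<in> sym_algebra"
  unfolding vstar_def by (intro sym_add vmul_in_sym sym_scale ins_in_sym)

text \<open>Commuting the exponential past multiplication by \<open>v\<close> creates the insertion
  in the right factor; the term \<open>z\<close> times \<open>ins v a\<close> supplies the insertion
  in the left factor. By the Leibniz rule \<open>ins_mult\<close> the two add up to the insertion in
  the product.\<close>

lemma sprod_vstar:
  assumes v: "v \<in> V0 \<union> V1" and a: "a \<in> sym_algebra" and b: "b \<in> sym_algebra"
  shows "sprod z (vstar z v a) b = vstar z v (sprod z a b)"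
proof -
  define x where "x = a \<otimes> b"
  have x: "x \<in> sym_pairs" unfolding x_def using a b by (rule tensor_prod_in_sym_pairs)
  have E: "expo z x \<in> sym_pairs" using x by (rule expo_in_sym_pairs)
  have "vstar z v a \<otimes> b = vmul_left v x + fscale z (ins_left v x)"
    by (simp add: vstar_def x_def ops_prod fbilinear_add[OF fbilinear_tensor_prod]
        fbilinear_scale[OF fbilinear_tensor_prod])
  moreover have "vmul_left v x \<in> pairs" "ins_left v x \<in> pairs"
    using ops_in_sym_pairs[OF x] v sym_pairs_subset by blast+
  moreover from this have "fscale z (ins_left v x) \<in> pairs"
    unfolding pairs_def by (intro fs.span_scale)
  ultimately have "expo z (vstar z v a \<otimes> b) = vmul_left v (expo z x) +
      (fscale z (ins_left v (expo z x)) + fscale z (ins_right v (expo z x)))"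
    by (simp add: expo_add expo_scale expo_vmul_left[OF v x] expo_ins_left[OF v x] add_ac)
  then have "sprod z (vstar z v a) b = vmul v (mult (expo z x)) + fscale z (ins v (mult (expo z x)))"
    unfolding ins_mult[OF v E]
    by (simp add: sprod_def flinear_add[OF flinear_mult] flinear_scale[OF flinear_mult]
        mult_vmul_left[OF v E] fs.scale_right_distrib)
  then show ?thesis by (simp add: vstar_def sprod_def x_def)
qed

text \<open>Strong induction on the length of words in the first factor. \<open>vstar z v\<close>
  moves through both bracketings by \<open>sprod_vstar\<close>; multiplication by \<open>v\<close>
  differs from it by an insertion, which is a combination of words that are shorter by two than the
  given one.\<close>

lemma sprod_assoc:
  assumes "a \<in> sym_algebra" "b \<in> sym_algebra" "c \<in> sym_algebra"
  shows "sprod z (sprod z a b) c = sprod z a (sprod z b c)"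
proof -
  define Q where "Q a \<longleftrightarrow> a \<in> sym_algebra \<and> sprod z (sprod z a b) c = sprod z a (sprod z b c)" for a
  note T = sym_in_tensors
  have bc: "sprod z b c \<in> sym_algebra" using assms by (intro sprod_in_sym)
  have Q_add: "Q (a + a')" if "Q a" "Q a'" for a a'
    using that assms bc unfolding Q_def by (simp add: sprod_add T sprod_in_sym sym_add)
  have Q_scale: "Q (fscale d a)" if "Q a" for a d
    using that assms bc unfolding Q_def by (simp add: sprod_scale T sprod_in_sym sym_scale)
  have Q_0: "Q 0" using Q_scale[of "tens []" 0] assms bc sword_in_sym[of "[]"]
    by (simp add: Q_def sprod_Nil)
  have Q_word: "Q (sword vs)" if "homogeneous vs" for vs
    using that
  proof (induction "length vs" arbitrary: vs rule: less_induct)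
    case less
    show ?case
    proof (cases vs)
      case Nil
      then show ?thesis using assms bc sword_in_sym[of "[]"] by (simp add: Q_def sprod_Nil)
    next
      case (Cons v ws)
      then have v: "v \<in> V0 \<union> V1" and ws: "homogeneous ws" using less(2) by auto
      have "Q (sword ws)" using less(1)[of ws] ws Cons by simp
      then have "Q (vstar z v (sword ws))"
        using assms v unfolding Q_def
        by (simp add: sprod_vstar[OF v] vstar_in_sym[OF v] sprod_in_sym)
      moreover have "Q (ins v (sword ws))"
      proof -
        have "Q (\<Sum>(d, w, ws')\<leftarrow>L. fscale (d * \<Lambda> v w) (sword ws'))"
          if "set L \<subseteq> set (lpeel ws)" for L
          using that
        proof (induction L)
          case (Cons p L)
          obtain d w ws' where p: "p = (d, w, ws')" by (cases p)
          have "length ws = Suc (length ws')" "homogeneous ws'"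
            using lpeel_props[of d w ws' ws] Cons.prems p ws by auto
          then have "Q (sword ws')" using less(1)[of ws'] \<open>vs = v # ws\<close> by simp
          then show ?case using Cons by (simp add: p Q_add Q_scale)
        qed (simp add: Q_0)
        from this[of "lpeel ws"] show ?thesis by (simp add: ins_sword[OF ws])
      qed
      moreover have "sword vs = vstar z v (sword ws) + fscale (- z) (ins v (sword ws))"
        using v ws Cons by (simp add: vstar_def vmul_sword)
      ultimately show ?thesis by (metis Q_add Q_scale)
    qed
  qed
  have "Q a" using assms(1) unfolding sym_algebra_eq
  proof (induction rule: fs.span_induct_alt)
    case base
    show ?case by (rule Q_0)
  next
    case (step c x y)
    then show ?case using Q_word by (auto intro: Q_add Q_scale)
  qed
  then show ?thesis by (simp add: Q_def)
qed

end

section \<open>Seminorms\<close>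

context graded_lcs
begin

lemma
  assumes "seminorm scale p"
  shows seminorm_add: "p (x + y) \<le> p x + p y" and seminorm_scale: "p (scale c x) = norm c * p x"
    and seminorm_0: "p 0 = 0" and seminorm_nonneg: "p x \<ge> 0" and seminorm_minus: "p (x - y) = p (y - x)"
proof -
  have add: "p (x + y) \<le> p x + p y" and sc: "p (scale c x) = norm c * p x" for x y c
    using assms by (auto simp: seminorm_def)
  show "p (x + y) \<le> p x + p y" "p (scale c x) = norm c * p x" by (rule add sc)+
  show 0: "p 0 = 0" using sc[of 0 0] by simp
  have "p (- z) = p z" for z using sc[of "- 1" z] by simp
  then show "p (x - y) = p (y - x)" by (metis minus_diff_eq)
  show "p x \<ge> 0" using add[of x "- x"] 0 \<open>\<And>z. p (- z) = p z\<close>[of x] by simp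
qed

lemma prod_list_nonneg: "seminorm scale p \<Longrightarrow> prod_list (map p vs) \<ge> 0"
  by (induction vs) (auto simp: seminorm_nonneg)

section \<open>Projective tensor seminorms\<close>

definition cost :: "('v \<Rightarrow> real) \<Rightarrow> ('k \<times> 'v list) list \<Rightarrow> real" where
  "cost p L = (\<Sum>(c, vs)\<leftarrow>L. norm c * prod_list (map p vs))"

definition represents :: "nat \<Rightarrow> ('k \<times> 'v list) list \<Rightarrow> ('k, 'v) tensor \<Rightarrow> bool" where
  "represents n L t \<longleftrightarrow> (\<forall>(c, vs)\<in>set L. length vs = n) \<and> t = (\<Sum>(c, vs)\<leftarrow>L. fscale c (tens vs))"

lemma proj_seminorm_eq: "proj_seminorm p n t = Inf {cost p L | L. represents n L t}"
  by (simp add: proj_seminorm_def cost_def represents_def)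

lemma represents_append: "represents n L s \<Longrightarrow> represents n L' t \<Longrightarrow> represents n (L @ L') (s + t)"
  by (auto simp: represents_def)

lemma represents_scale:
  "represents n L t \<Longrightarrow> represents n (map (\<lambda>(d, vs). (c * d, vs)) L) (fscale c t)"
  by (auto simp: represents_def sum_list_fscale_right split_def comp_def)

lemma cost_append: "cost p (L @ L') = cost p L + cost p L'"
  by (simp add: cost_def)

lemma cost_scale: "cost p (map (\<lambda>(d, vs). (c * d, vs)) L) = norm c * cost p L"
  by (simp add: cost_def split_def comp_def norm_mult sum_list_const_mult mult.assoc)

lemma cost_nonneg: "seminorm scale p \<Longrightarrow> cost p L \<ge> 0"
  unfolding cost_def by (intro sum_list_nonneg) (auto simp: prod_list_nonneg)

lemma tensor_power_rep: "t \<in> tensor_power n \<Longrightarrow> \<exists>L. represents n L t"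
  unfolding tensor_power_def
proof (induction rule: fs.span_induct_alt)
  case base
  show ?case by (rule exI[of _ "[]"]) (simp add: represents_def)
next
  case (step c x y)
  then obtain vs L where "x = tens vs" "length vs = n" "represents n L y" by blast
  then show ?case by (intro exI[of _ "(c, vs) # L"]) (simp add: represents_def)
qed

lemma tensor_power_add: "s \<in> tensor_power n \<Longrightarrow> t \<in> tensor_power n \<Longrightarrow> s + t \<in> tensor_power n"
  and tensor_power_scale: "s \<in> tensor_power n \<Longrightarrow> fscale c s \<in> tensor_power n"
  and tensor_power_zero: "0 \<in> tensor_power n"
  and tensor_power_sum: "(\<And>i. i \<in> I \<Longrightarrow> f i \<in> tensor_power n) \<Longrightarrow> (\<Sum>i\<in>I. f i) \<in> tensor_power n"
  unfolding tensor_power_def by (rule fs.span_add fs.span_scale fs.span_zero fs.span_sum; assumption)+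

context
  fixes p :: "'v \<Rightarrow> real"
  assumes p: "seminorm scale p"
begin

lemma proj_seminorm_le: "represents n L t \<Longrightarrow> proj_seminorm p n t \<le> cost p L"
  unfolding proj_seminorm_eq
  by (rule cInf_lower) (auto intro!: bdd_belowI[of _ 0] cost_nonneg p)

lemma proj_seminorm_approx:
  assumes "t \<in> tensor_power n" "e > 0"
  obtains L where "represents n L t" "cost p L < proj_seminorm p n t + e"
proof -
  have "{cost p L | L. represents n L t} \<noteq> {}" using tensor_power_rep[OF assms(1)] by blast
  from cInf_lessD[OF this, of "proj_seminorm p n t + e"] assms(2) that show thesis
    unfolding proj_seminorm_eq by auto
qed

lemma proj_seminorm_nonneg: "t \<in> tensor_power n \<Longrightarrow> proj_seminorm p n t \<ge> 0"
  unfolding proj_seminorm_eq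
  by (rule cInf_greatest) (use tensor_power_rep in \<open>auto intro: cost_nonneg p\<close>)

lemma proj_seminorm_tens: "length vs = n \<Longrightarrow> proj_seminorm p n (tens vs) \<le> prod_list (map p vs)"
  using proj_seminorm_le[of n "[(1, vs)]" "tens vs"] by (simp add: represents_def cost_def)

lemma proj_seminorm_zero: "proj_seminorm p n 0 = 0"
  using proj_seminorm_le[of n "[]" 0] proj_seminorm_nonneg[OF tensor_power_zero]
  by (simp add: represents_def cost_def order_antisym)

lemma proj_seminorm_add:
  assumes s: "s \<in> tensor_power n" and t: "t \<in> tensor_power n"
  shows "proj_seminorm p n (s + t) \<le> proj_seminorm p n s + proj_seminorm p n t"
proof (rule field_le_epsilon)
  fix e :: real assume "e > 0"
  then obtain L L' where L: "represents n L s" "cost p L < proj_seminorm p n s + e / 2"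
    and L': "represents n L' t" "cost p L' < proj_seminorm p n t + e / 2"
    using proj_seminorm_approx[OF s, of "e / 2"] proj_seminorm_approx[OF t, of "e / 2"]
    by (metis half_gt_zero)
  have "proj_seminorm p n (s + t) \<le> cost p (L @ L')"
    by (rule proj_seminorm_le[OF represents_append[OF L(1) L'(1)]])
  then show "proj_seminorm p n (s + t) \<le> proj_seminorm p n s + proj_seminorm p n t + e"
    using L(2) L'(2) by (simp add: cost_append)
qed

lemma proj_seminorm_scale:
  assumes t: "t \<in> tensor_power n"
  shows "proj_seminorm p n (fscale c t) \<le> norm c * proj_seminorm p n t"
proof (rule field_le_epsilon)
  fix e :: real assume e: "e > 0"
  \<comment> \<open>The summand 1 keeps the denominator positive when \<open>c\<close> is
    zero.\<close>
  define d where "d = e / (norm c + 1)"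
  have c1: "norm c + 1 > 0" using norm_ge_zero[of c] by linarith
  then have "d > 0" using e by (simp add: d_def)
  then obtain L where L: "represents n L t" "cost p L < proj_seminorm p n t + d"
    using proj_seminorm_approx[OF t] by blast
  have "proj_seminorm p n (fscale c t) \<le> norm c * cost p L"
    using proj_seminorm_le[OF represents_scale[OF L(1)]] by (simp add: cost_scale)
  also have "\<dots> \<le> norm c * (proj_seminorm p n t + d)"
    using L(2) by (intro mult_left_mono) auto
  also have "norm c * d \<le> (norm c + 1) * d" using \<open>d > 0\<close> by (intro mult_right_mono) auto
  then have "norm c * (proj_seminorm p n t + d) \<le> norm c * proj_seminorm p n t + e"
    using c1 by (simp add: d_def distrib_left)
  finally show "proj_seminorm p n (fscale c t) \<le> norm c * proj_seminorm p n t + e" .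
qed

lemma proj_seminorm_sum_list:
  assumes "\<And>i. i \<in> set I \<Longrightarrow> f i \<in> tensor_power n" "\<And>i. i \<in> set I \<Longrightarrow> proj_seminorm p n (f i) \<le> g i"
  shows "(\<Sum>i\<leftarrow>I. f i) \<in> tensor_power n \<and> proj_seminorm p n (\<Sum>i\<leftarrow>I. f i) \<le> (\<Sum>i\<leftarrow>I. g i)"
  using assms
proof (induction I)
  case (Cons i I)
  then have "(\<Sum>i\<leftarrow>I. f i) \<in> tensor_power n" "proj_seminorm p n (\<Sum>i\<leftarrow>I. f i) \<le> (\<Sum>i\<leftarrow>I. g i)"
    "f i \<in> tensor_power n" "proj_seminorm p n (f i) \<le> g i" by auto
  then show ?case using proj_seminorm_add[of "f i" n "\<Sum>i\<leftarrow>I. f i"] tensor_power_add by force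
qed (simp add: tensor_power_zero proj_seminorm_zero)

lemma proj_seminorm_sum:
  assumes "finite I" "\<And>i. i \<in> I \<Longrightarrow> f i \<in> tensor_power n" "\<And>i. i \<in> I \<Longrightarrow> proj_seminorm p n (f i) \<le> g i"
  shows "proj_seminorm p n (\<Sum>i\<in>I. f i) \<le> (\<Sum>i\<in>I. g i)"
  using assms
proof (induction I)
  case (insert i I)
  then have "proj_seminorm p n (\<Sum>i\<in>I. f i) \<le> (\<Sum>i\<in>I. g i)" "proj_seminorm p n (f i) \<le> g i"
    "f i \<in> tensor_power n" "(\<Sum>i\<in>I. f i) \<in> tensor_power n" by (auto intro: tensor_power_sum)
  then show ?case using proj_seminorm_add[of "f i" n "\<Sum>i\<in>I. f i"] insert(1,2) by simp
qed (simp add: proj_seminorm_zero)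

text \<open>Characteristic property of the projective seminorm: a representation of \<open>t\<close>
  is mapped term by term, so a bound on elementary tensors passes to every representation and then
  to the infimum. The infimum on the right is \<open>proj_seminorm q m t\<close>, unfolded.\<close>

lemma proj_seminorm_linear:
  assumes L: "flinear L" and q: "seminorm scale q" and "C \<ge> 0" and t: "t \<in> tensor_power m"
    and bound: "\<And>vs. length vs = m \<Longrightarrow> L (tens vs) \<in> tensor_power n \<and>
      proj_seminorm p n (L (tens vs)) \<le> C * prod_list (map q vs)"
  shows "L t \<in> tensor_power n \<and> proj_seminorm p n (L t) \<le> C * Inf {cost q R | R. represents m R t}"
proof -
  have *: "L t \<in> tensor_power n \<and> proj_seminorm p n (L t) \<le> C * cost q R" if R: "represents m R t" for R
  proof -
    have "L t = (\<Sum>(c, vs)\<leftarrow>R. fscale c (L (tens vs)))"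
      using R by (simp add: represents_def flinear_sum_list[OF L] split_def flinear_scale[OF L])
    moreover have "(\<Sum>(c, vs)\<leftarrow>R. fscale c (L (tens vs))) \<in> tensor_power n \<and>
      proj_seminorm p n (\<Sum>(c, vs)\<leftarrow>R. fscale c (L (tens vs))) \<le> (\<Sum>(c, vs)\<leftarrow>R. C * (norm c * prod_list (map q vs)))"
    proof (rule proj_seminorm_sum_list)
      fix i assume "i \<in> set R"
      then obtain c vs where i: "i = (c, vs)" "length vs = m" using R by (auto simp: represents_def)
      note b = bound[OF i(2)]
      show "(case i of (c, vs) \<Rightarrow> fscale c (L (tens vs))) \<in> tensor_power n"
        using b i by (simp add: tensor_power_scale)
      have "proj_seminorm p n (fscale c (L (tens vs))) \<le> norm c * proj_seminorm p n (L (tens vs))"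
        using b by (intro proj_seminorm_scale) blast
      also have "\<dots> \<le> norm c * (C * prod_list (map q vs))" using b by (intro mult_left_mono) auto
      finally show "proj_seminorm p n (case i of (c, vs) \<Rightarrow> fscale c (L (tens vs)))
          \<le> (case i of (c, vs) \<Rightarrow> C * (norm c * prod_list (map q vs)))"
        using i by (simp add: mult_ac)
    qed
    moreover have "(\<Sum>(c, vs)\<leftarrow>R. C * (norm c * prod_list (map q vs))) = C * cost q R"
      by (simp add: cost_def sum_list_const_mult split_def)
    ultimately show ?thesis by simp
  qed
  obtain R where R: "represents m R t" using tensor_power_rep[OF t] by blast
  have "proj_seminorm p n (L t) \<le> C * Inf {cost q R | R. represents m R t}"
  \<comment> \<open>The infimum is reached after dividing by \<open>C\<close>.\<close>
  proof (cases "C = 0")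
    case True
    then show ?thesis using *[OF R] by simp
  next
    case False
    then have "C > 0" using \<open>C \<ge> 0\<close> by simp
    have "proj_seminorm p n (L t) / C \<le> Inf {cost q R | R. represents m R t}"
      by (rule cInf_greatest) (use R * \<open>C > 0\<close> in \<open>auto simp: divide_le_eq mult.commute\<close>)
    then show ?thesis using \<open>C > 0\<close> by (simp add: divide_le_eq mult.commute)
  qed
  then show ?thesis using *[OF R] by simp
qed

end

text \<open>\<open>proj_seminorm_linear\<close> is applied to one argument at a time; while an
  elementary tensor is fixed on the left, its product of seminorms is part of the constant.\<close>

lemma proj_seminorm_bilinear:
  assumes p: "seminorm scale p" and q: "seminorm scale q" and "C \<ge> 0" and \<beta>: "fbilinear \<beta>"
    and s: "s \<in> tensor_power m" and t: "t \<in> tensor_power l"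
    and bound: "\<And>vs ws. length vs = m \<Longrightarrow> length ws = l \<Longrightarrow> \<beta> (tens vs) (tens ws) \<in> tensor_power n \<and>
      proj_seminorm p n (\<beta> (tens vs) (tens ws)) \<le> C * prod_list (map q vs) * prod_list (map q ws)"
  shows "\<beta> s t \<in> tensor_power n \<and>
    proj_seminorm p n (\<beta> s t) \<le> C * proj_seminorm q m s * proj_seminorm q l t"
proof -
  have lin: "flinear (\<beta> s)" "flinear (\<lambda>s. \<beta> s t)" for s t using \<beta> by (simp_all add: fbilinear_def)
  have "\<beta> (tens vs) t \<in> tensor_power n \<and>
      proj_seminorm p n (\<beta> (tens vs) t) \<le> (C * proj_seminorm q l t) * prod_list (map q vs)"
    if vs: "length vs = m" for vs
    using proj_seminorm_linear[OF p lin(1)[of "tens vs"] q, of "C * prod_list (map q vs)" t l n] bound[OF vs]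
      \<open>C \<ge> 0\<close> t prod_list_nonneg[OF q, of vs] by (simp add: proj_seminorm_eq[symmetric] mult_ac)
  then show ?thesis
    using proj_seminorm_linear[OF p lin(2)[of t] q, of "C * proj_seminorm q l t" s m n]
      \<open>C \<ge> 0\<close> s proj_seminorm_nonneg[OF q t] by (simp add: proj_seminorm_eq[symmetric] mult_ac)
qed

lemma proj_seminorm_mono:
  assumes p: "seminorm scale p" and q: "seminorm scale q" and le: "\<And>v. p v \<le> q v"
    and t: "t \<in> tensor_power n"
  shows "proj_seminorm p n t \<le> proj_seminorm q n t"
proof -
  have le': "prod_list (map p vs) \<le> prod_list (map q vs)" for vs
    by (induction vs) (auto intro!: mult_mono le prod_list_nonneg p seminorm_nonneg[OF q])
  show ?thesis
    using proj_seminorm_linear[OF p flinear_id q, of 1 t n n] t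
    by (auto simp: proj_seminorm_eq[symmetric] tens_in_tensor_power
        intro!: order_trans[OF proj_seminorm_tens[OF p] le'])
qed

lemma seminorm_mult: "seminorm scale p \<Longrightarrow> c \<ge> 0 \<Longrightarrow> seminorm scale (\<lambda>v. c * p v)"
  unfolding seminorm_def by (simp add: distrib_left[symmetric] mult_left_mono mult.left_commute)

lemma prod_list_mult: "prod_list (map (\<lambda>v. c * p v) vs) = c ^ length vs * prod_list (map p vs)"
  for c :: real
  by (induction vs) auto

lemma proj_seminorm_mult:
  assumes p: "seminorm scale p" and c: "c > 0" and t: "t \<in> tensor_power n"
  shows "c ^ n * proj_seminorm p n t \<le> proj_seminorm (\<lambda>v. c * p v) n t"
proof -
  have "proj_seminorm p n t \<le> (1 / c ^ n) * proj_seminorm (\<lambda>v. c * p v) n t"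
    using proj_seminorm_linear[OF p flinear_id seminorm_mult[OF p, of c], of "1 / c ^ n" t n n] t c
    by (auto simp: proj_seminorm_eq[symmetric] tens_in_tensor_power prod_list_mult
        intro!: proj_seminorm_tens[OF p])
  then show ?thesis using c by (simp add: field_simps)
qed

text \<open>On a homogeneous word all permuted words have the same product of seminorms. For a
  general word the products over the expansion \<open>homs\<close> add up to the product for the
  word itself, because \<open>p\<close> is additive along the grading; no factor growing with
  \<open>n\<close> is lost.\<close>

lemma proj_seminorm_Sym:
  assumes p: "seminorm scale p" and graded: "\<And>v. p v = p (proj0 v) + p (proj1 v)"
    and t: "t \<in> tensor_power n"
  shows "Sym t \<in> tensor_power n \<and> proj_seminorm p n (Sym t) \<le> proj_seminorm p n t"
proof -
  have hom: "sword vs \<in> tensor_power n \<and> proj_seminorm p n (sword vs) \<le> prod_list (map p vs)"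
    if vs: "homogeneous vs" "length vs = n" for vs
  proof -
    let ?f = "\<lambda>\<sigma>. fscale (koszul_sign \<sigma> vs) (tens (map (\<lambda>i. vs ! \<sigma> i) [0..<n]))"
    have eq: "sword vs = fscale (1 / fact n) (\<Sum>\<sigma> | \<sigma> permutes {..<n}. ?f \<sigma>)"
      using sword_perms[OF vs(1)] vs(2) by (simp flip: sword_perms[OF vs(1), unfolded vs(2)])
    have "proj_seminorm p n (\<Sum>\<sigma> | \<sigma> permutes {..<n}. ?f \<sigma>) \<le>
        (\<Sum>\<sigma> | \<sigma> permutes {..<n}. prod_list (map p vs))"
    proof (rule proj_seminorm_sum[OF p])
      fix \<sigma> assume "\<sigma> \<in> {\<sigma>. \<sigma> permutes {..<n}}"
      then have \<sigma>: "\<sigma> permutes {..<n}" by simp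
      show "?f \<sigma> \<in> tensor_power n" by (intro tensor_power_scale tens_in_tensor_power) simp
      have "proj_seminorm p n (?f \<sigma>) \<le> norm (koszul_sign \<sigma> vs) * proj_seminorm p n (tens (map (\<lambda>i. vs ! \<sigma> i) [0..<n]))"
        by (intro proj_seminorm_scale p tens_in_tensor_power) simp
      also have "norm (koszul_sign \<sigma> vs) = 1" by (simp add: koszul_sign_def norm_power)
      also have "1 * proj_seminorm p n (tens (map (\<lambda>i. vs ! \<sigma> i) [0..<n])) \<le>
          prod_list (map p (map (\<lambda>i. vs ! \<sigma> i) [0..<n]))"
        using proj_seminorm_tens[OF p, of "map (\<lambda>i. vs ! \<sigma> i) [0..<n]" n] by simp
      also have "\<dots> = (\<Prod>i<n. p (vs ! \<sigma> i))"
        by (simp add: prod.list_conv_set_nth atLeast0LessThan)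
      also have "\<dots> = (\<Prod>i<n. p (vs ! i))"
        using prod.permute[OF \<sigma>, of "\<lambda>i. p (vs ! i)"] by (simp add: comp_def)
      also have "\<dots> = prod_list (map p vs)"
        using vs(2) by (simp add: prod.list_conv_set_nth atLeast0LessThan)
      finally show "proj_seminorm p n (?f \<sigma>) \<le> prod_list (map p vs)" .
    qed (simp add: finite_permutations)
    then have X: "proj_seminorm p n (\<Sum>\<sigma> | \<sigma> permutes {..<n}. ?f \<sigma>) \<le> fact n * prod_list (map p vs)"
      using card_permutations[of "{..<n}" n] by simp
    have X': "(\<Sum>\<sigma> | \<sigma> permutes {..<n}. ?f \<sigma>) \<in> tensor_power n"
      by (intro tensor_power_sum tensor_power_scale tens_in_tensor_power) simp
    have "norm (1 / fact n :: 'k) * proj_seminorm p n (\<Sum>\<sigma> | \<sigma> permutes {..<n}. ?f \<sigma>) \<le>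
        prod_list (map p vs)"
      using X by (simp add: norm_divide field_simps)
    from order_trans[OF proj_seminorm_scale[OF p X'] this] tensor_power_scale[OF X'] eq
    show ?thesis by simp
  qed
  have "Sym (tens vs) \<in> tensor_power n \<and> proj_seminorm p n (Sym (tens vs)) \<le> 1 * prod_list (map p vs)"
    if vs: "length vs = n" for vs
  proof -
    have "Sym (tens vs) = (\<Sum>ws\<leftarrow>homs vs. sword ws)"
      by (subst tens_homs) (simp add: flinear_sum_list[OF flinear_Sym] sword_def[abs_def])
    moreover have "(\<Sum>ws\<leftarrow>homs vs. prod_list (map p ws)) = prod_list (map p vs)"
    proof (induction vs)
      case (Cons v vs)
      have "(\<Sum>ws\<leftarrow>homs (v # vs). prod_list (map p ws)) =
          (p (proj0 v) + p (proj1 v)) * (\<Sum>ws\<leftarrow>homs vs. prod_list (map p ws))"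
        by (simp add: comp_def sum_list_const_mult distrib_right)
      then show ?case using Cons graded[of v] by simp
    qed simp
    moreover have "(\<Sum>ws\<leftarrow>homs vs. sword ws) \<in> tensor_power n \<and>
        proj_seminorm p n (\<Sum>ws\<leftarrow>homs vs. sword ws) \<le> (\<Sum>ws\<leftarrow>homs vs. prod_list (map p ws))"
      by (rule proj_seminorm_sum_list[OF p]) (use hom homs_hom[of _ vs] vs in auto)
    ultimately show ?thesis by simp
  qed
  from proj_seminorm_linear[OF p flinear_Sym p _ t this]
  show ?thesis by (simp add: proj_seminorm_eq[symmetric])
qed

subsection \<open>Weyl seminorms\<close>

lemma weyl_seminorm_eq:
  assumes p: "seminorm scale p" and "finite N" "\<And>n. degree_part n t \<noteq> 0 \<Longrightarrow> n \<in> N"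
  shows "weyl_seminorm R p t = (\<Sum>n\<in>N. proj_seminorm p n (degree_part n t) * fact n powr R)"
  unfolding weyl_seminorm_def
  by (rule sum.mono_neutral_left) (use assms in \<open>auto simp: proj_seminorm_zero[OF p]\<close>)

lemma weyl_seminorm_nonneg: "seminorm scale p \<Longrightarrow> t \<in> tensors \<Longrightarrow> weyl_seminorm R p t \<ge> 0"
  unfolding weyl_seminorm_def
  by (intro sum_nonneg mult_nonneg_nonneg proj_seminorm_nonneg degree_part_in_tensor_power) auto

lemma weyl_seminorm_mono:
  assumes "seminorm scale p" "seminorm scale q" "\<And>v. p v \<le> q v" "t \<in> tensors"
  shows "weyl_seminorm R p t \<le> weyl_seminorm R q t"
  unfolding weyl_seminorm_def using assms
  by (intro sum_mono mult_right_mono proj_seminorm_mono degree_part_in_tensor_power) auto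

lemma weyl_seminorm_add:
  assumes p: "seminorm scale p" and s: "s \<in> tensors" and t: "t \<in> tensors"
  shows "weyl_seminorm R p (s + t) \<le> weyl_seminorm R p s + weyl_seminorm R p t"
proof -
  let ?N = "{n. degree_part n s \<noteq> 0} \<union> {n. degree_part n t \<noteq> 0}"
  have fin: "finite ?N" using s t by (simp add: finite_degree_support)
  have "weyl_seminorm R p (s + t) = (\<Sum>n\<in>?N. proj_seminorm p n (degree_part n s + degree_part n t) * fact n powr R)"
    by (subst weyl_seminorm_eq[OF p fin]) (auto simp: flinear_add[OF flinear_degree_part])
  also have "\<dots> \<le> (\<Sum>n\<in>?N. (proj_seminorm p n (degree_part n s) + proj_seminorm p n (degree_part n t)) * fact n powr R)"
    using s t by (intro sum_mono mult_right_mono proj_seminorm_add p degree_part_in_tensor_power) auto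
  also have "\<dots> = weyl_seminorm R p s + weyl_seminorm R p t"
    by (subst (1 2) weyl_seminorm_eq[OF p fin]) (auto simp: distrib_right sum.distrib)
  finally show ?thesis .
qed

lemma weyl_seminorm_scale:
  assumes p: "seminorm scale p" and t: "t \<in> tensors"
  shows "weyl_seminorm R p (fscale c t) \<le> norm c * weyl_seminorm R p t"
proof -
  let ?N = "{n. degree_part n t \<noteq> 0}"
  have fin: "finite ?N" using t by (simp add: finite_degree_support)
  have "weyl_seminorm R p (fscale c t) = (\<Sum>n\<in>?N. proj_seminorm p n (fscale c (degree_part n t)) * fact n powr R)"
    by (subst weyl_seminorm_eq[OF p fin]) (auto simp: flinear_scale[OF flinear_degree_part])
  also have "\<dots> \<le> (\<Sum>n\<in>?N. (norm c * proj_seminorm p n (degree_part n t)) * fact n powr R)"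
    using t by (intro sum_mono mult_right_mono proj_seminorm_scale p degree_part_in_tensor_power) auto
  also have "\<dots> = norm c * weyl_seminorm R p t"
    by (subst weyl_seminorm_eq[OF p fin]) (auto simp: sum_distrib_left mult.assoc)
  finally show ?thesis .
qed

lemma weyl_seminorm_zero: "weyl_seminorm R p 0 = 0"
  by (simp add: weyl_seminorm_def flinear_0[OF flinear_degree_part])

lemma weyl_seminorm_sum:
  assumes p: "seminorm scale p" and "finite I" "\<And>i. i \<in> I \<Longrightarrow> f i \<in> tensors"
  shows "weyl_seminorm R p (\<Sum>i\<in>I. f i) \<le> (\<Sum>i\<in>I. weyl_seminorm R p (f i))"
  using assms(2,3)
proof (induction I)
  case (insert i I)
  then have "weyl_seminorm R p (f i + (\<Sum>i\<in>I. f i)) \<le> weyl_seminorm R p (f i) + weyl_seminorm R p (\<Sum>i\<in>I. f i)"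
    by (intro weyl_seminorm_add p tensors_sum) auto
  then show ?case using insert by force
qed (simp add: weyl_seminorm_zero)

lemma weyl_seminorm_tensor_power:
  assumes "seminorm scale p" "t \<in> tensor_power n"
  shows "weyl_seminorm R p t = proj_seminorm p n t * fact n powr R"
  by (subst weyl_seminorm_eq[OF assms(1), of "{n}"])
    (auto simp: degree_part_tensor_power[OF assms(2)] split: if_splits)

subsection \<open>Continuous seminorms\<close>

lemma continuous_scale_left: "continuous_on UNIV (\<lambda>c. scale c v)"
proof -
  have "continuous_on UNIV (\<lambda>c::'k. (c, v))"
    by (intro continuous_on_Pair continuous_on_id continuous_on_const)
  then show ?thesis
    using continuous_on_compose[OF _ continuous_on_subset[OF continuous_scale], of UNIV "\<lambda>c::'k. (c, v)"]
    by (simp add: comp_def)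
qed

lemma continuous_scale_right: "continuous_on UNIV (scale c)"
proof -
  have "continuous_on UNIV (\<lambda>v::'v. (c, v))"
    by (intro continuous_on_Pair continuous_on_id continuous_on_const)
  then show ?thesis
    using continuous_on_compose[OF _ continuous_on_subset[OF continuous_scale], of UNIV "\<lambda>v::'v. (c, v)"]
    by (simp add: comp_def)
qed

lemma absorbing:
  assumes "open U" "0 \<in> U"
  obtains t where "t > 0" "scale (of_real t) v \<in> U"
proof -
  have "continuous_on UNIV (\<lambda>t. scale (of_real t :: 'k) v)"
    by (rule continuous_on_compose2[OF continuous_scale_left, of UNIV of_real]) (auto intro: continuous_intros)
  then have "open ((\<lambda>t. scale (of_real t) v) -` U)"
    using assms(1) by (simp add: continuous_on_open_vimage)
  moreover have "0 \<in> (\<lambda>t. scale (of_real t) v) -` U" using assms(2) by simp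
  ultimately obtain e where "e > 0" "ball 0 e \<subseteq> (\<lambda>t. scale (of_real t) v) -` U"
    by (meson open_contains_ball)
  moreover have "e / 2 \<in> ball 0 e" using \<open>e > 0\<close> by simp
  ultimately have "e / 2 \<in> (\<lambda>t. scale (of_real t) v) -` U" by blast
  then show thesis using that[of "e / 2"] \<open>e > 0\<close> by simp
qed

lemma seminorm_continuousI:
  assumes p: "seminorm scale p" and U: "open U" "0 \<in> U" and bound: "\<And>v. v \<in> U \<Longrightarrow> p v \<le> 1"
  shows "continuous_on UNIV p"
proof -
  have "isCont p x" for x
    unfolding isCont_def tendsto_iff
  proof (intro allI impI)
    fix e :: real assume "e > 0"
    \<comment> \<open>The factor \<open>2 / e\<close> yields \<open>p (y - x) \<le> e / 2\<close>,
      hence the strict inequality.\<close>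
    define T where "T = {y. scale (of_real (2 / e)) (y - x) \<in> U}"
    have "continuous_on UNIV (\<lambda>y. scale (of_real (2 / e)) (y - x))"
      by (rule continuous_on_compose2[OF continuous_scale_right, of UNIV]) (auto intro: continuous_intros)
    then have "open T" unfolding T_def using U(1) continuous_on_open_vimage[of UNIV] by (force simp: vimage_def)
    moreover have "x \<in> T" using U(2) by (simp add: T_def)
    moreover have "dist (p y) (p x) < e" if "y \<in> T" for y
    proof -
      have "norm (of_real (2 / e) :: 'k) * p (y - x) \<le> 1"
        using bound[of "scale (of_real (2 / e)) (y - x)"] that
        by (simp only: T_def seminorm_scale[OF p, symmetric] mem_Collect_eq)
      then have "p (y - x) < e" using \<open>e > 0\<close> by (simp add: norm_divide field_simps)
      then show ?thesis
        using seminorm_add[OF p, of "y - x" x] seminorm_add[OF p, of "x - y" y] seminorm_minus[OF p, of x y]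
        by (simp add: dist_real_def)
    qed
    ultimately show "eventually (\<lambda>y. dist (p y) (p x) < e) (at x)"
      unfolding eventually_at_topological by blast
  qed
  then show ?thesis by (simp add: continuous_at_imp_continuous_on)
qed

text \<open>The supremum of the moduli of a family of functionals that is bounded by 1 on
  \<open>U\<close>. It is finite because \<open>U\<close> absorbs every vector, and continuous
  because it is at most 1 on \<open>U\<close>. It takes the place of a Minkowski functional.\<close>

lemma polar_seminorm:
  assumes lin: "\<And>f. f \<in> \<Phi> \<Longrightarrow> Vector_Spaces.linear scale (*) f"
    and U: "open U" "0 \<in> U" and bound: "\<And>f v. f \<in> \<Phi> \<Longrightarrow> v \<in> U \<Longrightarrow> norm (f v) \<le> 1"
  obtains p where "seminorm scale p" "continuous_on UNIV p" "\<And>f v. f \<in> \<Phi> \<Longrightarrow> norm (f v) \<le> p v"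
    "\<And>v. v \<in> U \<Longrightarrow> p v \<le> 1"
proof -
  \<comment> \<open>The inserted 0 makes the supremum meaningful and nonnegative also for an empty
    family.\<close>
  define p where "p v = Sup (insert 0 ((\<lambda>f. norm (f v)) ` \<Phi>))" for v
  have add: "f (u + v) = f u + f v" and sc: "f (scale c v) = c * f v" if "f \<in> \<Phi>" for f u v c
    using lin[OF that] by (auto simp: Vector_Spaces.linear_iff)
  have bdd: "bdd_above (insert 0 ((\<lambda>f. norm (f v)) ` \<Phi>))" for v
  proof -
    obtain t where t: "t > 0" "scale (of_real t) v \<in> U" using absorbing[OF U] by blast
    have "norm (f v) \<le> 1 / t" if "f \<in> \<Phi>" for f
      using bound[OF that t(2)] t(1) by (simp add: sc[OF that] norm_mult field_simps)
    then show ?thesis using t(1) by (intro bdd_aboveI[of _ "1 / t"]) auto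
  qed
  have le: "norm (f v) \<le> p v" if "f \<in> \<Phi>" for f v
    unfolding p_def using that bdd by (intro cSup_upper) auto
  have nonneg: "p v \<ge> 0" for v unfolding p_def using bdd by (intro cSup_upper) auto
  have least: "p v \<le> b" if "b \<ge> 0" "\<And>f. f \<in> \<Phi> \<Longrightarrow> norm (f v) \<le> b" for b v
    unfolding p_def using that by (intro cSup_least) auto
  have add_le: "p (u + v) \<le> p u + p v" for u v
    using nonneg[of u] nonneg[of v]
    by (intro least) (auto simp: add intro!: order_trans[OF norm_triangle_ineq] add_mono le)
  have scale_le: "p (scale c v) \<le> norm c * p v" for c v
    using nonneg[of v] by (intro least) (auto simp: sc norm_mult intro!: mult_left_mono le)
  have scale_eq: "p (scale c v) = norm c * p v" for c v
  proof (cases "c = 0")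
    case True
    then show ?thesis using scale_le[of c v] nonneg[of "scale c v"] by simp
  next
    case False
    have "p v \<le> norm (inverse c) * p (scale c v)"
      using scale_le[of "inverse c" "scale c v"] False by simp
    then have "norm c * p v \<le> p (scale c v)" using False by (simp add: norm_inverse norm_divide field_simps)
    then show ?thesis using scale_le[of c v] by simp
  qed
  have p: "seminorm scale p" using add_le scale_eq by (simp add: seminorm_def)
  have U1: "p v \<le> 1" if "v \<in> U" for v using bound that by (intro least) auto
  have "continuous_on UNIV p" by (rule seminorm_continuousI[OF p U U1])
  then show thesis using that[of p] p le U1 by blast
qed

text \<open>Every continuous seminorm is dominated by one that is additive along the grading; its
  continuity rests on that of the two projections.\<close>

lemma graded_seminorm:
  assumes p: "seminorm scale p" "continuous_on UNIV p"
  defines "q \<equiv> \<lambda>v. p (proj0 v) + p (proj1 v)"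
  shows "seminorm scale q" "continuous_on UNIV q" "p v \<le> q v" "q v = q (proj0 v) + q (proj1 v)"
proof -
  show "seminorm scale q"
    unfolding seminorm_def q_def
  proof (intro conjI allI)
    show "p (proj0 (x + y)) + p (proj1 (x + y)) \<le> p (proj0 x) + p (proj1 x) + (p (proj0 y) + p (proj1 y))" for x y
      using seminorm_add[OF p(1), of "proj0 x" "proj0 y"] seminorm_add[OF p(1), of "proj1 x" "proj1 y"]
      by (simp add: proj_add)
    show "p (proj0 (scale c x)) + p (proj1 (scale c x)) = norm c * (p (proj0 x) + p (proj1 x))" for c x
      by (simp add: proj_scale seminorm_scale[OF p(1)] distrib_left)
  qed
  show "continuous_on UNIV q" unfolding q_def
    by (intro continuous_on_add continuous_on_compose2[OF p(2) continuous_proj0]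
        continuous_on_compose2[OF p(2) continuous_proj1]) auto
  show "p v \<le> q v" using seminorm_add[OF p(1), of "proj0 v" "proj1 v"] by (simp add: q_def proj_sum)
  show "q v = q (proj0 v) + q (proj1 v)" by (simp add: q_def seminorm_0[OF p(1)])
qed

end

section \<open>Continuity estimates\<close>

text \<open>The combinatorial core: here \<open>R \<ge> 1/2\<close> is needed.\<close>

lemma falling_factorial_bound:
  fixes R :: real
  assumes R: "R \<ge> 1 / 2" and k: "k \<le> n" "k \<le> m"
  shows "(fact n / fact (n - k)) * (fact m / fact (m - k)) * fact (n - k + (m - k)) powr R
    \<le> fact k * (2 powr (R + 1)) ^ n * (2 powr (R + 1)) ^ m * fact n powr R * fact m powr R"
proof -
  define a b where "a = n - k" and "b = m - k"
  \<comment> \<open>The product of the two falling factorials \<open>fact n / fact a\<close> and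
    \<open>fact m / fact b\<close>, written with binomial coefficients in order to isolate its size
    in \<open>k\<close>.\<close>
  define X :: real where "X = real (n choose k) * real (m choose k) * (fact k)\<^sup>2"
  have n: "fact n / fact a = real (n choose k) * fact k"
    unfolding a_def using binomial_fact_lemma[OF k(1)]
    by (simp add: field_simps) (metis (mono_tags, lifting) mult.assoc mult.commute of_nat_fact of_nat_mult)
  have m: "fact m / fact b = real (m choose k) * fact k"
    unfolding b_def using binomial_fact_lemma[OF k(2)]
    by (simp add: field_simps) (metis (mono_tags, lifting) mult.assoc mult.commute of_nat_fact of_nat_mult)
  have ch: "real (j choose i) \<le> 2 ^ j" for i j
  proof -
    have "(j choose i) \<le> 2 ^ j" by (rule binomial_le_pow2)
    then show ?thesis by (metis of_nat_le_iff of_nat_numeral of_nat_power)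
  qed
  have ch1: "real (n choose k) \<ge> 1" "real (m choose k) \<ge> 1"
    using k by (simp_all add: Suc_le_eq)
  have fk: "(fact k :: real) \<ge> 1" by simp
  have X1: "X \<ge> 1"
    unfolding X_def using ch1 fk by (metis mult_ge1_I one_le_power)
  have X: "fact n * fact m = X * (fact a * fact b)"
    using n m by (simp add: X_def field_simps power2_eq_square)
  have ab: "(fact (a + b) :: real) \<le> 2 ^ (n + m) * (fact a * fact b)"
  proof -
    have "(fact (a + b) :: real) = real ((a + b) choose a) * (fact a * fact b)"
    proof -
      have "real (fact a * fact b * ((a + b) choose a)) = real (fact (a + b))"
        using binomial_fact_lemma[of a "a + b"] by simp
      then show ?thesis by (simp add: mult_ac)
    qed
    also have "\<dots> \<le> 2 ^ (a + b) * (fact a * fact b)" by (intro mult_right_mono ch) simp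
    also have "\<dots> \<le> 2 ^ (n + m) * (fact a * fact b)"
      by (intro mult_right_mono power_increasing) (auto simp: a_def b_def)
    finally show ?thesis .
  qed
  \<comment> \<open>The weights of the two factors account for the power \<open>R\<close> of
    \<open>X\<close>, so the power \<open>1 - R\<close> remains. Up to exponential factors
    \<open>X\<close> is at most the square of \<open>fact k\<close>; a power of at most 1/2
    therefore costs a single \<open>fact k\<close>.\<close>
  have XR: "X powr (1 - R) \<le> 2 ^ (n + m) * fact k"
  proof -
    have "X powr (1 - R) \<le> X powr (1 / 2)" using X1 R by (intro powr_mono) auto
    also have "\<dots> = sqrt X" using X1 by (simp add: powr_half_sqrt)
    also have "\<dots> \<le> sqrt ((2 ^ (n + m) * fact k)\<^sup>2)"
    proof (rule real_sqrt_le_mono)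
      have "real (n choose k) * real (m choose k) \<le> 2 ^ n * 2 ^ m"
        by (intro mult_mono ch) auto
      also have "\<dots> \<le> (2 ^ (n + m))\<^sup>2"
        by (simp add: power_add power2_eq_square mult_ge1_I)
      finally show "X \<le> (2 ^ (n + m) * fact k)\<^sup>2"
        unfolding X_def power_mult_distrib by (intro mult_right_mono) auto
    qed
    finally show ?thesis by simp
  qed
  have "(fact n / fact a) * (fact m / fact b) * fact (a + b) powr R = X * fact (a + b) powr R"
    by (simp add: n m X_def power2_eq_square)
  also have "\<dots> \<le> X * (2 ^ (n + m) * (fact a * fact b)) powr R"
    using X1 R ab by (intro mult_left_mono powr_mono2) auto
  also have "\<dots> = X powr (1 - R) * ((2 ^ (n + m)) powr R * (X * (fact a * fact b)) powr R)"
    using X1 by (simp add: powr_mult powr_diff)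
  also have "\<dots> \<le> (2 ^ (n + m) * fact k) * ((2 ^ (n + m)) powr R * (X * (fact a * fact b)) powr R)"
    by (intro mult_right_mono XR) simp
  also have "\<dots> = fact k * (2 ^ (n + m) * (2 ^ (n + m)) powr R) * (fact n powr R * fact m powr R)"
    by (simp add: X[symmetric] powr_mult)
  \<comment> \<open>One power of 2 comes from bounding \<open>X\<close>, another \<open>R\<close>
    from bounding \<open>fact (a + b)\<close>: this is the origin of the constant
    \<open>2 powr (R + 1)\<close>.\<close>
  also have "2 ^ (n + m) * (2 ^ (n + m)) powr R = ((2::real) powr (R + 1)) ^ n * (2 powr (R + 1)) ^ m"
    by (simp add: powr_realpow[symmetric] powr_powr powr_add[symmetric] algebra_simps)
  finally show ?thesis unfolding a_def b_def by (simp add: mult_ac)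
qed

context graded_form
begin

text \<open>\<open>mcontr k a b\<close> is \<open>\<mu> (P\<^sup>k (a \<otimes> b))\<close> on the symmetric algebra.\<close>

definition mcontr :: "nat \<Rightarrow> ('k, 'v) tensor \<Rightarrow> ('k, 'v) tensor \<Rightarrow> ('k, 'v) tensor" where
  "mcontr k a b = mult ((Pc ^^ k) (a \<otimes> b))"

lemma fbilinear_mcontr: "fbilinear (mcontr k)"
  unfolding mcontr_def[abs_def]
  by (rule fbilinear_compose[OF flinear_compose[OF flinear_mult flinear_funpow[OF flinear_Pc]] fbilinear_tensor_prod])

text \<open>\<open>Pc\<close> contracts a single pair of letters, so a pair of words stays a
  multiple of one pair of words. The degree factors accumulate to falling factorials, which vanish
  by truncated subtraction as soon as a word is exhausted.\<close>

lemma Pc_funpow_tens: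
  assumes p: "seminorm scale p" and \<Lambda>: "\<And>v w. norm (\<Lambda> v w) \<le> \<epsilon> * p v * p w" and \<epsilon>: "\<epsilon> \<ge> 0"
  shows "\<exists>\<gamma> vs' ws'. (Pc ^^ k) (tens vs \<otimes> tens ws) = fscale \<gamma> (tens vs' \<otimes> tens ws') \<and>
    length vs' = length vs - k \<and> length ws' = length ws - k \<and>
    norm \<gamma> * prod_list (map p vs') * prod_list (map p ws') \<le>
      \<epsilon> ^ k * (\<Prod>i<k. real (length vs - i)) * (\<Prod>i<k. real (length ws - i)) *
      prod_list (map p vs) * prod_list (map p ws)"
proof (induction k)
  case 0
  show ?case by (intro exI[of _ 1] exI[of _ vs] exI[of _ ws]) simp
next
  case (Suc k)
  let ?B = "\<epsilon> ^ k * (\<Prod>i<k. real (length vs - i)) * (\<Prod>i<k. real (length ws - i)) *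
      prod_list (map p vs) * prod_list (map p ws)"
  let ?B' = "\<epsilon> ^ Suc k * (\<Prod>i<Suc k. real (length vs - i)) * (\<Prod>i<Suc k. real (length ws - i)) *
      prod_list (map p vs) * prod_list (map p ws)"
  note pn = prod_list_nonneg[OF p]
  obtain \<gamma> vs' ws' where IH: "(Pc ^^ k) (tens vs \<otimes> tens ws) = fscale \<gamma> (tens vs' \<otimes> tens ws')"
    "length vs' = length vs - k" "length ws' = length ws - k"
    "norm \<gamma> * prod_list (map p vs') * prod_list (map p ws') \<le> ?B"
    using Suc by blast
  have step: "(Pc ^^ Suc k) (tens vs \<otimes> tens ws) = fscale \<gamma> (Pc (tens vs' \<otimes> tens ws'))"
    using IH(1) by (simp add: flinear_scale[OF flinear_Pc])
  have B': "?B' \<ge> 0" using \<epsilon> by (intro mult_nonneg_nonneg pn prod_nonneg zero_le_power) auto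
  show ?case
  proof (cases "vs' = [] \<or> ws' = []")
    case True
    \<comment> \<open>With coefficient 0 any words of the right lengths will do.\<close>
    then have "(Pc ^^ Suc k) (tens vs \<otimes> tens ws) = fscale 0 (tens (butlast vs') \<otimes> tens (tl ws'))"
      unfolding step by (auto simp: Pc_tens)
    then show ?thesis
      using B' IH(2,3)
      by (intro exI[of _ 0] exI[of _ "butlast vs'"] exI[of _ "tl ws'"]) auto
  next
    case False
    define \<gamma>' where "\<gamma>' = \<gamma> * (of_nat (length vs') * of_nat (length ws') * \<Lambda> (last vs') (hd ws'))"
    have eq: "(Pc ^^ Suc k) (tens vs \<otimes> tens ws) = fscale \<gamma>' (tens (butlast vs') \<otimes> tens (tl ws'))"
      unfolding step using False by (simp add: Pc_tens \<gamma>'_def)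
    have vs': "prod_list (map p vs') = prod_list (map p (butlast vs')) * p (last vs')"
      using False by (subst append_butlast_last_id[symmetric, of vs']) (simp_all del: append_butlast_last_id)
    have ws': "prod_list (map p ws') = p (hd ws') * prod_list (map p (tl ws'))"
      using False by (cases ws') auto
    have "norm \<gamma>' * prod_list (map p (butlast vs')) * prod_list (map p (tl ws')) =
        norm \<gamma> * real (length vs') * real (length ws') * norm (\<Lambda> (last vs') (hd ws')) *
        (prod_list (map p (butlast vs')) * prod_list (map p (tl ws')))"
      by (simp add: \<gamma>'_def norm_mult)
    also have "\<dots> \<le> norm \<gamma> * real (length vs') * real (length ws') * (\<epsilon> * p (last vs') * p (hd ws')) *
        (prod_list (map p (butlast vs')) * prod_list (map p (tl ws')))"
      by (intro mult_right_mono mult_left_mono \<Lambda> mult_nonneg_nonneg pn) auto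
    also have "\<dots> = \<epsilon> * real (length vs') * real (length ws') *
        (norm \<gamma> * prod_list (map p vs') * prod_list (map p ws'))"
      by (simp add: vs' ws')
    also have "\<dots> \<le> \<epsilon> * real (length vs') * real (length ws') * ?B"
      using \<epsilon> by (intro mult_left_mono IH) auto
    also have "\<dots> = ?B'" by (simp add: IH(2,3))
    finally show ?thesis
      using eq IH(2,3) by (intro exI[of _ \<gamma>'] exI[of _ "butlast vs'"] exI[of _ "tl ws'"]) auto
  qed
qed

lemma mcontr_proj_bound:
  assumes p: "seminorm scale p" and graded: "\<And>v. p v = p (proj0 v) + p (proj1 v)"
    and \<Lambda>: "\<And>v w. norm (\<Lambda> v w) \<le> \<epsilon> * p v * p w" and \<epsilon>: "\<epsilon> \<ge> 0"
    and a: "a \<in> tensor_power n" and b: "b \<in> tensor_power m"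
  shows "mcontr k a b \<in> tensor_power (n - k + (m - k)) \<and> proj_seminorm p (n - k + (m - k)) (mcontr k a b) \<le>
    (\<epsilon> ^ k * (\<Prod>i<k. real (n - i)) * (\<Prod>i<k. real (m - i))) * proj_seminorm p n a * proj_seminorm p m b"
proof (rule proj_seminorm_bilinear[OF p p _ fbilinear_mcontr a b])
  show "0 \<le> \<epsilon> ^ k * (\<Prod>i<k. real (n - i)) * (\<Prod>i<k. real (m - i))"
    using \<epsilon> by (intro mult_nonneg_nonneg prod_nonneg zero_le_power) auto
  fix vs ws :: "'v list" assume len: "length vs = n" "length ws = m"
  from Pc_funpow_tens[OF p \<Lambda> \<epsilon>, of k vs ws]
  obtain \<gamma> vs' ws' where 1: "(Pc ^^ k) (tens vs \<otimes> tens ws) = fscale \<gamma> (tens vs' \<otimes> tens ws')"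
    "length vs' = n - k" "length ws' = m - k"
    "norm \<gamma> * prod_list (map p vs') * prod_list (map p ws') \<le>
      \<epsilon> ^ k * (\<Prod>i<k. real (n - i)) * (\<Prod>i<k. real (m - i)) * prod_list (map p vs) * prod_list (map p ws)"
    unfolding len by blast
  let ?l = "n - k + (m - k)"
  have eq: "mcontr k (tens vs) (tens ws) = fscale \<gamma> (Sym (tens (vs' @ ws')))"
    unfolding mcontr_def 1(1) flinear_scale[OF flinear_mult]
    by (simp add: mult_def tconc_tens[unfolded tconc_def])
  have t: "tens (vs' @ ws') \<in> tensor_power ?l" using 1 by (intro tens_in_tensor_power) simp
  note S = proj_seminorm_Sym[OF p graded t]
  have "proj_seminorm p ?l (mcontr k (tens vs) (tens ws)) \<le> norm \<gamma> * proj_seminorm p ?l (Sym (tens (vs' @ ws')))"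
    unfolding eq using S by (intro proj_seminorm_scale p) blast
  also have "\<dots> \<le> norm \<gamma> * prod_list (map p (vs' @ ws'))"
    using S proj_seminorm_tens[OF p, of "vs' @ ws'" ?l] 1 by (intro mult_left_mono) auto
  also have "\<dots> \<le> \<epsilon> ^ k * (\<Prod>i<k. real (n - i)) * (\<Prod>i<k. real (m - i)) * prod_list (map p vs) * prod_list (map p ws)"
    using 1 by (simp add: mult.assoc)
  finally show "mcontr k (tens vs) (tens ws) \<in> tensor_power ?l \<and>
    proj_seminorm p ?l (mcontr k (tens vs) (tens ws)) \<le>
      \<epsilon> ^ k * (\<Prod>i<k. real (n - i)) * (\<Prod>i<k. real (m - i)) * prod_list (map p vs) * prod_list (map p ws)"
    unfolding eq using S tensor_power_scale by blast
qed

lemma prod_falling: "(\<Prod>i<k. real (n - i)) = (if k \<le> n then fact n / fact (n - k) else 0)"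
proof (cases "k \<le> n")
  case True
  then show ?thesis
  proof (induction k)
    case (Suc k)
    obtain j where j: "n - k = Suc j" using Suc.prems by (metis Suc_diff_Suc Suc_le_eq)
    then have "n - Suc k = j" by simp
    moreover have "(\<Prod>i<k. real (n - i)) = fact n / fact (Suc j)"
      using Suc.IH Suc.prems j by simp
    then have "(\<Prod>i<Suc k. real (n - i)) = fact n / fact (Suc j) * real (Suc j)"
      by (simp only: prod.lessThan_Suc j)
    ultimately show ?case using Suc.prems by (simp del: of_nat_Suc prod.lessThan_Suc)
  qed simp
next
  case False
  then show ?thesis by (auto intro!: prod_zero bexI[of _ n])
qed

text \<open>The exponential factors of \<open>falling_factorial_bound\<close> grow with the degrees.
  They are absorbed by rescaling \<open>p\<close> on the right hand side, since the seminorm on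
  tensors of degree \<open>n\<close> scales with the \<open>n\<close>-th power. Only
  \<open>\<epsilon> ^ k * fact k\<close> remains.\<close>

lemma mcontr_weyl_bound_hom:
  assumes R: "R \<ge> 1 / 2" and p: "seminorm scale p" and graded: "\<And>v. p v = p (proj0 v) + p (proj1 v)"
    and \<Lambda>: "\<And>v w. norm (\<Lambda> v w) \<le> \<epsilon> * p v * p w" and \<epsilon>: "\<epsilon> \<ge> 0"
    and a: "a \<in> tensor_power n" and b: "b \<in> tensor_power m"
  shows "weyl_seminorm R p (mcontr k a b) \<le> \<epsilon> ^ k * fact k *
    (proj_seminorm (\<lambda>v. 2 powr (R + 1) * p v) n a * fact n powr R) *
    (proj_seminorm (\<lambda>v. 2 powr (R + 1) * p v) m b * fact m powr R)"
proof -
  let ?l = "n - k + (m - k)"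
  let ?c = "2 powr (R + 1) :: real"
  define A B where "A = proj_seminorm p n a" and "B = proj_seminorm p m b"
  have AB: "A \<ge> 0" "B \<ge> 0" unfolding A_def B_def using a b by (auto intro: proj_seminorm_nonneg p)
  note bd = mcontr_proj_bound[OF p graded \<Lambda> \<epsilon> a b, of k]
  have "weyl_seminorm R p (mcontr k a b) = proj_seminorm p ?l (mcontr k a b) * fact ?l powr R"
    using bd by (intro weyl_seminorm_tensor_power p) blast
  also have "\<dots> \<le> (\<epsilon> ^ k * (\<Prod>i<k. real (n - i)) * (\<Prod>i<k. real (m - i))) * A * B * fact ?l powr R"
    unfolding A_def B_def using bd by (intro mult_right_mono) auto
  also have "\<dots> = \<epsilon> ^ k * A * B * ((\<Prod>i<k. real (n - i)) * (\<Prod>i<k. real (m - i)) * fact ?l powr R)"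
    by (simp add: mult_ac)
  also have "\<dots> \<le> \<epsilon> ^ k * A * B * (fact k * ?c ^ n * ?c ^ m * fact n powr R * fact m powr R)"
  proof (rule mult_left_mono)
    show "(\<Prod>i<k. real (n - i)) * (\<Prod>i<k. real (m - i)) * fact ?l powr R \<le>
        fact k * ?c ^ n * ?c ^ m * fact n powr R * fact m powr R"
      using falling_factorial_bound[OF R, of k n m] by (auto simp: prod_falling)
  qed (use AB \<epsilon> in simp)
  also have "\<dots> = \<epsilon> ^ k * fact k * ((?c ^ n * A) * fact n powr R) * ((?c ^ m * B) * fact m powr R)"
    by (simp add: mult_ac)
  also have "\<dots> \<le> \<epsilon> ^ k * fact k * (proj_seminorm (\<lambda>v. ?c * p v) n a * fact n powr R) *
      (proj_seminorm (\<lambda>v. ?c * p v) m b * fact m powr R)"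
    using \<epsilon> AB proj_seminorm_mult[OF p _ a, of ?c] proj_seminorm_mult[OF p _ b, of ?c]
      proj_seminorm_nonneg[OF seminorm_mult[OF p, of ?c] a]
      proj_seminorm_nonneg[OF seminorm_mult[OF p, of ?c] b]
    unfolding A_def[symmetric] B_def[symmetric]
    by (intro mult_mono mult_nonneg_nonneg) auto
  finally show ?thesis .
qed

lemma mcontr_weyl_bound:
  assumes R: "R \<ge> 1 / 2" and p: "seminorm scale p" and graded: "\<And>v. p v = p (proj0 v) + p (proj1 v)"
    and \<Lambda>: "\<And>v w. norm (\<Lambda> v w) \<le> \<epsilon> * p v * p w" and \<epsilon>: "\<epsilon> \<ge> 0"
    and a: "a \<in> tensors" and b: "b \<in> tensors"
  shows "weyl_seminorm R p (mcontr k a b) \<le> \<epsilon> ^ k * fact k *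
    weyl_seminorm R (\<lambda>v. 2 powr (R + 1) * p v) a * weyl_seminorm R (\<lambda>v. 2 powr (R + 1) * p v) b"
proof -
  let ?q = "\<lambda>v. 2 powr (R + 1) * p v"
  have q: "seminorm scale ?q" by (rule seminorm_mult[OF p]) simp
  obtain N where N: "\<And>M. M \<ge> N \<Longrightarrow> a = (\<Sum>n<M. degree_part n a)" "\<And>n. n \<ge> N \<Longrightarrow> degree_part n a = 0"
    using degree_part_bound[OF a] by blast
  obtain M where M: "\<And>N. N \<ge> M \<Longrightarrow> b = (\<Sum>n<N. degree_part n b)" "\<And>n. n \<ge> M \<Longrightarrow> degree_part n b = 0"
    using degree_part_bound[OF b] by blast
  let ?a = "\<lambda>n. degree_part n a" and ?b = "\<lambda>m. degree_part m b"
  note dp = degree_part_in_tensor_power[OF a] degree_part_in_tensor_power[OF b]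
  have in_tensors: "mcontr k (?a n) (?b m) \<in> tensors" for n m
    using mcontr_proj_bound[OF p graded \<Lambda> \<epsilon> dp] tensor_power_subset by blast
  have wa: "weyl_seminorm R ?q a = (\<Sum>n<N. proj_seminorm ?q n (?a n) * fact n powr R)"
    by (rule weyl_seminorm_eq[OF q]) (use N(2) in \<open>auto simp flip: not_le\<close>)
  have wb: "weyl_seminorm R ?q b = (\<Sum>m<M. proj_seminorm ?q m (?b m) * fact m powr R)"
    by (rule weyl_seminorm_eq[OF q]) (use M(2) in \<open>auto simp flip: not_le\<close>)
  have "mcontr k a b = (\<Sum>n<N. \<Sum>m<M. mcontr k (?a n) (?b m))"
    using fbilinear_sum[OF fbilinear_mcontr, of k ?a "{..<N}" ?b "{..<M}"] N(1)[of N] M(1)[of M] by simp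
  then have "weyl_seminorm R p (mcontr k a b) \<le> (\<Sum>n<N. weyl_seminorm R p (\<Sum>m<M. mcontr k (?a n) (?b m)))"
    using in_tensors by (simp only:) (intro weyl_seminorm_sum p tensors_sum; simp)
  also have "\<dots> \<le> (\<Sum>n<N. \<Sum>m<M. weyl_seminorm R p (mcontr k (?a n) (?b m)))"
    using in_tensors by (intro sum_mono weyl_seminorm_sum p) auto
  also have "\<dots> \<le> (\<Sum>n<N. \<Sum>m<M. \<epsilon> ^ k * fact k * (proj_seminorm ?q n (?a n) * fact n powr R) *
      (proj_seminorm ?q m (?b m) * fact m powr R))"
    by (intro sum_mono mcontr_weyl_bound_hom[OF R p graded \<Lambda> \<epsilon>] dp)
  also have "\<dots> = \<epsilon> ^ k * fact k * weyl_seminorm R ?q a * weyl_seminorm R ?q b"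
    unfolding wa wb by (simp only: sum_distrib_left[symmetric] sum_distrib_right[symmetric])
  finally show ?thesis .
qed

lemma Pc_in_pairs: "x \<in> pairs \<Longrightarrow> Pc x \<in> pairs"
proof -
  have "0 \<in> pairs" unfolding pairs_def by (rule fs.span_zero)
  moreover have "fscale c y \<in> pairs" if "y \<in> pairs" for c y
    using that unfolding pairs_def by (rule fs.span_scale)
  ultimately have "Pc (tens vs \<otimes> tens ws) \<in> pairs" for vs ws
    using tensor_prod_in_pairs[OF tens_in_tensors tens_in_tensors] by (auto simp: Pc_tens)
  then show "x \<in> pairs \<Longrightarrow> Pc x \<in> pairs"
    unfolding pairs_def
    using flinear_span_into[OF flinear_Pc, of "\<Union>vs ws. {tens vs \<otimes> tens ws}" "\<Union>vs ws. {tens vs \<otimes> tens ws}" x]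
    by blast
qed

lemma Sym_in_tensors: "t \<in> tensors \<Longrightarrow> Sym t \<in> tensors"
proof -
  have "Sym (tens vs) \<in> tensors" for vs
    \<comment> \<open>The zero seminorm is additive along the grading, so this extracts the
      membership part of \<open>proj_seminorm_Sym\<close>.\<close>
    using proj_seminorm_Sym[of "\<lambda>_. 0", OF _ _ tens_in_tensor_power[OF refl]] tensor_power_subset
    by (auto simp: seminorm_def)
  then show "t \<in> tensors \<Longrightarrow> Sym t \<in> tensors"
    unfolding tensors_def using flinear_span_into[OF flinear_Sym, of "range tens" "range tens" t] by blast
qed

lemma mcontr_in_tensors:
  assumes "a \<in> tensors" "b \<in> tensors"
  shows "mcontr k a b \<in> tensors"
proof -
  have "(Pc ^^ k) (a \<otimes> b) \<in> pairs"
    by (induction k) (auto intro: Pc_in_pairs tensor_prod_in_pairs assms)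
  then show ?thesis by (simp add: mcontr_def mult_def Sym_in_tensors concat_in_tensors)
qed

text \<open>Continuity at the origin bounds \<open>\<Lambda>\<close> by 1 on some
  \<open>A \<times> B\<close>. The forms with second argument in \<open>B\<close> give the polar
  seminorm \<open>p1\<close>; those with first argument in the unit ball of \<open>p1\<close> give
  \<open>p2\<close>. Scaling \<open>v\<close> yields the bound by \<open>p1 v * p2 w\<close>, and
  the sum of both seminorms serves in both arguments.\<close>

lemma ex_form_seminorm:
  assumes cont: "continuous_on UNIV (\<lambda>(v, w). \<Lambda> v w)"
  obtains p where "seminorm scale p" "continuous_on UNIV p" "\<And>v w. norm (\<Lambda> v w) \<le> p v * p w"
proof -
  have open1: "open ((\<lambda>(v, w). \<Lambda> v w) -` ball 0 1)"
    using cont by (simp add: continuous_on_open_vimage)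
  have "(0, 0) \<in> (\<lambda>(v, w). \<Lambda> v w) -` ball 0 1"
    using form_bilinear(2)[of 0 0 0] by simp
  with open1 obtain A B where AB: "open A" "open B" "0 \<in> A" "0 \<in> B" "A \<times> B \<subseteq> (\<lambda>(v, w). \<Lambda> v w) -` ball 0 1"
    by (rule open_prod_elim) auto
  have bd: "norm (\<Lambda> v w) \<le> 1" if "v \<in> A" "w \<in> B" for v w
    using AB(5) that by (force simp: subset_eq)
  have k: "vector_space ((*) :: 'k \<Rightarrow> 'k \<Rightarrow> 'k)" by standard (auto simp: algebra_simps)
  have lin: "Vector_Spaces.linear scale (*) (\<Lambda> v)" "Vector_Spaces.linear scale (*) (\<lambda>v. \<Lambda> v w)" for v w
    using bil by (auto simp: bilinear_map_def)
  obtain p1 where p1: "seminorm scale p1" "continuous_on UNIV p1"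
    "\<And>f v. f \<in> (\<lambda>w v. \<Lambda> v w) ` B \<Longrightarrow> norm (f v) \<le> p1 v" "\<And>v. v \<in> A \<Longrightarrow> p1 v \<le> 1"
    by (rule polar_seminorm[of "(\<lambda>w v. \<Lambda> v w) ` B" A]) (use lin AB bd in auto)
  have p1B: "norm (\<Lambda> v w) \<le> p1 v" if "w \<in> B" for v w using p1(3)[of "\<lambda>v. \<Lambda> v w" v] that by auto
  have bd2: "norm (\<Lambda> v w) \<le> 1" if "p1 v \<le> 1" "w \<in> B" for v w
    using p1B[OF that(2)] that(1) by (rule order_trans)
  obtain p2 where p2: "seminorm scale p2" "continuous_on UNIV p2"
    "\<And>f w. f \<in> \<Lambda> ` {v. p1 v \<le> 1} \<Longrightarrow> norm (f w) \<le> p2 w" "\<And>w. w \<in> B \<Longrightarrow> p2 w \<le> 1"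
    by (rule polar_seminorm[of "\<Lambda> ` {v. p1 v \<le> 1}" B]) (use lin AB bd2 in auto)
  have main: "norm (\<Lambda> v w) \<le> p1 v * p2 w" for v w
  proof (cases "p1 v = 0")
    \<comment> \<open>Here \<open>v\<close> cannot be normalised; instead \<open>w\<close> is scaled
      into \<open>B\<close>, where \<open>p1 v = 0\<close> forces the form to vanish.\<close>
    case True
    obtain t where "t > 0" "scale (of_real t) w \<in> B" using absorbing[OF AB(2,4)] by blast
    then show ?thesis
      using p1B[of "scale (of_real t) w" v] True by (simp add: form_bilinear)
  next
    case False
    then have pos: "p1 v > 0" using seminorm_nonneg[OF p1(1), of v] by simp
    have "p1 (scale (of_real (1 / p1 v)) v) \<le> 1"
      using pos by (simp add: seminorm_scale[OF p1(1)] norm_divide)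
    then have "norm (\<Lambda> (scale (of_real (1 / p1 v)) v) w) \<le> p2 w" using p2(3) by auto
    then show ?thesis using pos by (simp add: form_bilinear norm_divide norm_mult field_simps)
  qed
  show thesis
  proof
    show "seminorm scale (\<lambda>v. p1 v + p2 v)"
      using p1(1) p2(1) by (auto simp: seminorm_def distrib_left intro: add_mono order_trans)
        (smt (verit))
    show "continuous_on UNIV (\<lambda>v. p1 v + p2 v)" by (intro continuous_intros p1 p2)
    show "norm (\<Lambda> v w) \<le> (p1 v + p2 v) * (p1 w + p2 w)" for v w
      using main[of v w] seminorm_nonneg[OF p1(1)] seminorm_nonneg[OF p2(1)]
      by (intro order_trans[OF main] mult_mono) auto
  qed
qed

lemma seminorm_plus: "seminorm scale p \<Longrightarrow> seminorm scale q \<Longrightarrow> seminorm scale (\<lambda>v. p v + q v)"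
  unfolding seminorm_def by (smt (verit) distrib_left)

text \<open>Rescaling the dominating seminorm makes the contractions decay at any geometric rate.\<close>

theorem mcontr_estimate:
  assumes R: "R \<ge> 1 / 2" and cont: "continuous_on UNIV (\<lambda>(v, w). \<Lambda> v w)"
    and p: "seminorm scale p" "continuous_on UNIV p" and r: "r \<ge> 0"
  obtains q where "seminorm scale q" "continuous_on UNIV q"
    "\<And>k a b. a \<in> tensors \<Longrightarrow> b \<in> tensors \<Longrightarrow>
      r ^ k * weyl_seminorm R p (mcontr k a b) \<le> fact k * (weyl_seminorm R q a * weyl_seminorm R q b)"
proof -
  obtain p0 where p0: "seminorm scale p0" "continuous_on UNIV p0" "\<And>v w. norm (\<Lambda> v w) \<le> p0 v * p0 w"
    using ex_form_seminorm[OF cont] by blast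
  define p1 where "p1 = (\<lambda>v. p v + p0 v)"
  have p1: "seminorm scale p1" "continuous_on UNIV p1"
    unfolding p1_def using p p0 by (auto intro: seminorm_plus continuous_intros)
  define p2 where "p2 = (\<lambda>v. p1 (proj0 v) + p1 (proj1 v))"
  have p2: "seminorm scale p2" "continuous_on UNIV p2" "p1 v \<le> p2 v" "p2 v = p2 (proj0 v) + p2 (proj1 v)" for v
    unfolding p2_def by (rule graded_seminorm[OF p1])+
  have nn: "p v \<ge> 0" "p0 v \<ge> 0" "p2 v \<ge> 0" for v
    using seminorm_nonneg p p0 p2 by blast+
  have le: "p v \<le> p2 v" "p0 v \<le> p2 v" for v
    using p2(3)[of v] nn[of v] by (auto simp: p1_def)
  \<comment> \<open>\<open>s \<ge> 1\<close> keeps \<open>p3\<close> above \<open>p\<close>, and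
    \<open>r\<close> is at most the square of \<open>s\<close>, which is what the last estimate
    needs.\<close>
  define s where "s = 1 + r"
  define p3 where "p3 = (\<lambda>v. s * p2 v)"
  have s: "s \<ge> 1" "s > 0" using r by (auto simp: s_def)
  have p3: "seminorm scale p3" unfolding p3_def using seminorm_mult[OF p2(1)] s by simp
  have graded: "p3 v = p3 (proj0 v) + p3 (proj1 v)" for v
    unfolding p3_def using p2(4)[of v] by (simp add: distrib_left)
  \<comment> \<open>Scaling the seminorm by \<open>s\<close> improves the constant of the form by
    the square of \<open>s\<close>, as \<open>\<Lambda>\<close> is bounded by a product of two
    values.\<close>
  have \<Lambda>: "norm (\<Lambda> v w) \<le> (1 / s\<^sup>2) * p3 v * p3 w" for v w
  proof -
    have "norm (\<Lambda> v w) \<le> p2 v * p2 w"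
      by (rule order_trans[OF p0(3)]) (intro mult_mono le nn)
    then show ?thesis using s by (simp add: p3_def power2_eq_square)
  qed
  define q where "q = (\<lambda>v. 2 powr (R + 1) * p3 v)"
  show thesis
  proof
    show q: "seminorm scale q" unfolding q_def by (rule seminorm_mult[OF p3]) simp
    show "continuous_on UNIV q" unfolding q_def p3_def by (intro continuous_intros p2)
    fix k a b assume a: "a \<in> tensors" and b: "b \<in> tensors"
    have le3: "p v \<le> p3 v" for v
      unfolding p3_def using le(1)[of v] mult_right_mono[OF s(1) nn(3)[of v]] by simp
    have "weyl_seminorm R p (mcontr k a b) \<le> weyl_seminorm R p3 (mcontr k a b)"
      by (rule weyl_seminorm_mono[OF p(1) p3 le3 mcontr_in_tensors[OF a b]])
    also have "\<dots> \<le> (1 / s\<^sup>2) ^ k * fact k * weyl_seminorm R q a * weyl_seminorm R q b"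
      unfolding q_def by (rule mcontr_weyl_bound[OF R p3 graded \<Lambda> _ a b]) simp
    finally have "r ^ k * weyl_seminorm R p (mcontr k a b) \<le>
        r ^ k * ((1 / s\<^sup>2) ^ k * fact k * weyl_seminorm R q a * weyl_seminorm R q b)"
      using r by (intro mult_left_mono) auto
    also have "\<dots> = (r / s\<^sup>2) ^ k * (fact k * (weyl_seminorm R q a * weyl_seminorm R q b))"
      by (simp add: power_divide mult_ac)
    also have "\<dots> \<le> 1 * (fact k * (weyl_seminorm R q a * weyl_seminorm R q b))"
    proof (rule mult_right_mono)
      have "r \<le> s\<^sup>2" using r by (simp add: s_def power2_eq_square algebra_simps)
      then show "(r / s\<^sup>2) ^ k \<le> 1" using r s by (intro power_le_one) auto
    qed (use weyl_seminorm_nonneg[OF q] a b in simp)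
    finally show "r ^ k * weyl_seminorm R p (mcontr k a b) \<le>
        fact k * (weyl_seminorm R q a * weyl_seminorm R q b)" by simp
  qed
qed

end

section \<open>Extension to the completion\<close>

text \<open>Regularity of a topological group: if \<open>y + A - B\<close> lies in \<open>V\<close>,
  then the closure of \<open>y + A\<close> does too, because each of its points differs by an
  element of \<open>B\<close> from a point of \<open>y + A\<close>.\<close>

lemma closed_neighbourhood:
  fixes y :: "'y::topological_ab_group_add"
  assumes "open V" "y \<in> V"
  obtains V' where "open V'" "y \<in> V'" "closure V' \<subseteq> V"
proof -
  have "continuous_on UNIV (\<lambda>(a, b). y + a - b)"
    by (simp add: split_def) (intro continuous_intros)
  then have "open ((\<lambda>(a, b). y + a - b) -` V)"
    using assms(1) by (simp add: continuous_on_open_vimage)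
  moreover have "(0, 0) \<in> (\<lambda>(a, b). y + a - b) -` V" using assms(2) by simp
  ultimately obtain A B where AB: "open A" "open B" "0 \<in> A" "0 \<in> B" "A \<times> B \<subseteq> (\<lambda>(a, b). y + a - b) -` V"
    by (rule open_prod_elim) auto
  have shift: "open {x. x - z \<in> C}" if "open C" for C and z :: 'y
  proof -
    have "continuous_on UNIV (\<lambda>x. x - z)" by (intro continuous_intros)
    then show ?thesis using that continuous_on_open_vimage[of UNIV "\<lambda>x. x - z"] by (simp add: vimage_def)
  qed
  show thesis
  proof
    show "open {x. x - y \<in> A}" "y \<in> {x. x - y \<in> A}" using shift[OF AB(1)] AB(3) by auto
    show "closure {x. x - y \<in> A} \<subseteq> V"
    proof
      fix x assume x: "x \<in> closure {x. x - y \<in> A}"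
      have "x \<in> {x'. x' - x \<in> B}" using AB(4) by simp
      then have "{x'. x' - x \<in> B} \<inter> {x. x - y \<in> A} \<noteq> {}"
        using x open_Int_closure_eq_empty[OF shift[OF AB(2), of x], of "{x. x - y \<in> A}"] by blast
      then obtain x' where "x' - x \<in> B" "x' - y \<in> A" by blast
      then have "(x' - y, x' - x) \<in> A \<times> B" by blast
      from subsetD[OF AB(5) this] have "y + (x' - y) - (x' - x) \<in> V" by simp
      moreover have "y + (x' - y) - (x' - x) = x" by simp
      ultimately show "x \<in> V" by (simp only:)
    qed
  qed
qed

text \<open>Allows real-valued seminorms to be extended by the same lemma as the products.\<close>

lemma uniformity_real_diff: "(uniformity :: (real \<times> real) filter) = filtercomap (\<lambda>(x, y). x - y) (nhds 0)"
proof (rule filter_eqI)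
  fix Q :: "real \<times> real \<Rightarrow> bool"
  have "eventually Q uniformity \<longleftrightarrow> (\<exists>e>0. \<forall>x y. dist x y < e \<longrightarrow> Q (x, y))"
    by (rule eventually_uniformity_metric)
  also have "\<dots> \<longleftrightarrow> eventually Q (filtercomap (\<lambda>(x, y). x - y) (nhds 0))"
  proof
    assume "\<exists>e>0. \<forall>x y. dist x y < e \<longrightarrow> Q (x, y)"
    then obtain e where e: "e > 0" "\<And>x y. dist x y < e \<Longrightarrow> Q (x, y)" by blast
    then have "eventually (\<lambda>d. \<bar>d\<bar> < e) (nhds (0::real))"
      by (auto simp: eventually_nhds_metric dist_real_def)
    then show "eventually Q (filtercomap (\<lambda>(x, y). x - y) (nhds 0))"
      unfolding eventually_filtercomap using e(2)
      by (intro exI[of _ "\<lambda>d. \<bar>d\<bar> < e"]) (auto simp: dist_real_def)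
  next
    assume "eventually Q (filtercomap (\<lambda>(x, y). x - y) (nhds 0))"
    then obtain R where R: "eventually R (nhds (0::real))" "\<And>x y. R (x - y) \<Longrightarrow> Q (x, y)"
      unfolding eventually_filtercomap by auto
    then obtain e where "e > 0" "\<And>d. dist d 0 < e \<Longrightarrow> R d" by (auto simp: eventually_nhds_metric)
    then show "\<exists>e>0. \<forall>x y. dist x y < e \<longrightarrow> Q (x, y)"
      using R(2) by (intro exI[of _ e]) (auto simp: dist_real_def)
  qed
  finally show "eventually Q uniformity = eventually Q (filtercomap (\<lambda>(x, y). x - y) (nhds 0))" .
qed

text \<open>The filter \<open>F x\<close> is the trace on \<open>S\<close> of the neighbourhoods of
  \<open>x\<close>. Density makes it proper, the hypothesis makes its image under \<open>g\<close>
  Cauchy, and completeness provides the value at \<open>x\<close>; regularity of the target gives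
  continuity. The Cauchy condition is local at each \<open>x\<close>, because bilinear maps are in
  general not uniformly continuous.\<close>

lemma dense_extension:
  fixes j :: "'a \<Rightarrow> 'x::topological_space"
    and g :: "'a \<Rightarrow> 'y::{uniform_space, topological_ab_group_add, t2_space}"
  assumes unif: "(uniformity :: ('y \<times> 'y) filter) = filtercomap (\<lambda>(x, y). x - y) (nhds 0)"
    and compl: "complete (UNIV :: 'y set)"
    and dense: "closure (j ` S) = UNIV"
    and cauchy: "\<And>x U. open U \<Longrightarrow> 0 \<in> U \<Longrightarrow>
      \<exists>O'. open O' \<and> x \<in> O' \<and> (\<forall>a\<in>S. \<forall>b\<in>S. j a \<in> O' \<longrightarrow> j b \<in> O' \<longrightarrow> g a - g b \<in> U)"
  obtains h where "continuous_on UNIV h" "\<And>a. a \<in> S \<Longrightarrow> h (j a) = g a"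
proof -
  define F where "F x = inf (filtercomap j (nhds x)) (principal S)" for x
  have ev: "eventually Q (F x) \<longleftrightarrow> (\<exists>O'. open O' \<and> x \<in> O' \<and> (\<forall>a\<in>S. j a \<in> O' \<longrightarrow> Q a))" for Q x
  proof
    assume "eventually Q (F x)"
    then obtain R where "eventually R (nhds x)" "\<And>a. R (j a) \<Longrightarrow> a \<in> S \<longrightarrow> Q a"
      unfolding F_def eventually_inf_principal eventually_filtercomap by auto
    then show "\<exists>O'. open O' \<and> x \<in> O' \<and> (\<forall>a\<in>S. j a \<in> O' \<longrightarrow> Q a)"
      unfolding eventually_nhds by blast
  next
    assume "\<exists>O'. open O' \<and> x \<in> O' \<and> (\<forall>a\<in>S. j a \<in> O' \<longrightarrow> Q a)"
    then obtain O' where O': "open O'" "x \<in> O'" "\<forall>a\<in>S. j a \<in> O' \<longrightarrow> Q a" by blast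
    then have "eventually (\<lambda>y. y \<in> O') (nhds x)" by (intro eventually_nhds_in_open)
    then show "eventually Q (F x)"
      unfolding F_def eventually_inf_principal eventually_filtercomap using O'(3) by blast
  qed
  have nb: "F x \<noteq> bot" for x
  proof
    assume "F x = bot"
    then have "eventually (\<lambda>_. False) (F x)" by simp
    then obtain O' where "open O'" "x \<in> O'" "\<forall>a\<in>S. j a \<notin> O'" unfolding ev by blast
    moreover have "x \<in> closure (j ` S)" using dense by simp
    ultimately show False using open_Int_closure_eq_empty[of O' "j ` S"] by blast
  qed
  have "\<exists>y. filterlim g (nhds y) (F x)" for x
  proof -
    have "cauchy_filter (filtermap g (F x))"
      unfolding cauchy_filter_def unif le_filter_def
    proof (intro allI impI)
      fix Q assume "eventually Q (filtercomap (\<lambda>(x, y). x - y) (nhds (0::'y)))"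
      then obtain R where R: "eventually R (nhds 0)" "\<And>a b. R (a - b) \<Longrightarrow> Q (a, b)"
        unfolding eventually_filtercomap by auto
      then obtain U where U: "open U" "0 \<in> U" "\<And>a b. a - b \<in> U \<Longrightarrow> Q (a, b)"
        unfolding eventually_nhds by blast
      obtain O' where O': "open O'" "x \<in> O'" "\<forall>a\<in>S. \<forall>b\<in>S. j a \<in> O' \<longrightarrow> j b \<in> O' \<longrightarrow> g a - g b \<in> U"
        using cauchy[OF U(1,2), of x] by blast
      have "eventually (\<lambda>y. y \<in> g ` {a \<in> S. j a \<in> O'}) (filtermap g (F x))"
        unfolding eventually_filtermap ev using O' by blast
      then show "eventually Q (filtermap g (F x) \<times>\<^sub>F filtermap g (F x))"
        unfolding eventually_prod_same
        by (intro exI[of _ "\<lambda>y. y \<in> g ` {a \<in> S. j a \<in> O'}"]) (use O'(3) U(3) in blast)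
    qed
    moreover have "filtermap g (F x) \<noteq> bot" using nb by (simp add: filtermap_bot_iff)
    ultimately obtain y where "filtermap g (F x) \<le> nhds y"
      using cauchy_filter_complete_converges[OF _ compl, of "filtermap g (F x)"] by auto
    then show ?thesis by (auto simp: filterlim_def)
  qed
  then obtain h where h: "\<And>x. filterlim g (nhds (h x)) (F x)" by metis
  have h_ev: "\<exists>O'. open O' \<and> x \<in> O' \<and> (\<forall>a\<in>S. j a \<in> O' \<longrightarrow> g a \<in> V)" if "open V" "h x \<in> V" for x V
    using topological_tendstoD[OF h that] unfolding ev .
  show thesis
  proof
    show "h (j a) = g a" if "a \<in> S" for a
    proof (rule ccontr)
      assume "h (j a) \<noteq> g a"
      then obtain V where "open V" "h (j a) \<in> V" "g a \<notin> V" by (metis t1_space)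
      then show False using h_ev[of V "j a"] that by blast
    qed
    show "continuous_on UNIV h"
      unfolding continuous_on_topological
    proof (intro ballI allI impI)
      fix x V assume "open V" "h x \<in> V"
      then obtain V' where V': "open V'" "h x \<in> V'" "closure V' \<subseteq> V" by (rule closed_neighbourhood)
      obtain O' where O': "open O'" "x \<in> O'" "\<forall>a\<in>S. j a \<in> O' \<longrightarrow> g a \<in> V'" using h_ev[OF V'(1,2)] by blast
      have "h x' \<in> V" if "x' \<in> O'" for x'
      proof -
        have "eventually (\<lambda>a. g a \<in> closure V') (F x')"
          unfolding ev using O' that closure_subset by blast
        then have "h x' \<in> closure V'" by (rule Lim_in_closed_set[OF closed_closure _ nb h])
        then show ?thesis using V'(3) by blast
      qed
      then show "\<exists>A. open A \<and> x \<in> A \<and> (\<forall>y\<in>UNIV. y \<in> A \<longrightarrow> h y \<in> V)" using O' by blast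
    qed
  qed
qed

text \<open>What the passage to the completion uses of the symmetric algebra. The laws of the
  seminorms are demanded on \<open>S\<close> only, as the ambient type contains more than tensors.
  \<open>nhd1\<close> and \<open>nhd2\<close> express that \<open>\<iota>\<close> is an embedding
  near 0; one seminorm is enough in \<open>nhd1\<close> for a family in which finitely many members
  have a common upper bound.\<close>

locale dense_completion =
  fixes S :: "'a::ab_group_add set" and s :: "'k::real_normed_field \<Rightarrow> 'a \<Rightarrow> 'a"
    and PP :: "('a \<Rightarrow> real) set"
    and sW :: "'k \<Rightarrow> 'w::{uniform_space, topological_ab_group_add, t2_space} \<Rightarrow> 'w"
    and \<iota> :: "'a \<Rightarrow> 'w"
  assumes S_add: "x \<in> S \<Longrightarrow> y \<in> S \<Longrightarrow> x + y \<in> S" and S_diff: "x \<in> S \<Longrightarrow> y \<in> S \<Longrightarrow> x - y \<in> S"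
    and S_scale: "x \<in> S \<Longrightarrow> s c x \<in> S" and S_zero: "0 \<in> S"
    and p_add: "p \<in> PP \<Longrightarrow> x \<in> S \<Longrightarrow> y \<in> S \<Longrightarrow> p (x + y) \<le> p x + p y"
    and p_scale: "p \<in> PP \<Longrightarrow> x \<in> S \<Longrightarrow> p (s c x) \<le> norm c * p x"
    and p_nonneg: "p \<in> PP \<Longrightarrow> x \<in> S \<Longrightarrow> p x \<ge> 0"
    and p_minus: "p \<in> PP \<Longrightarrow> x \<in> S \<Longrightarrow> y \<in> S \<Longrightarrow> p (x - y) = p (y - x)"
    and \<iota>_add: "x \<in> S \<Longrightarrow> y \<in> S \<Longrightarrow> \<iota> (x + y) = \<iota> x + \<iota> y"
    and \<iota>_scale: "x \<in> S \<Longrightarrow> \<iota> (s c x) = sW c (\<iota> x)"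
    and unif: "(uniformity :: ('w \<times> 'w) filter) = filtercomap (\<lambda>(x, y). x - y) (nhds 0)"
    and compl: "complete (UNIV :: 'w set)"
    and dense: "closure (\<iota> ` S) = UNIV"
    and nhd1: "open U \<Longrightarrow> 0 \<in> U \<Longrightarrow> \<exists>p\<in>PP. \<exists>e>0. \<forall>x\<in>S. p x < e \<longrightarrow> \<iota> x \<in> U"
    and nhd2: "p \<in> PP \<Longrightarrow> e > 0 \<Longrightarrow> \<exists>U. open U \<and> 0 \<in> U \<and> (\<forall>x\<in>S. \<iota> x \<in> U \<longrightarrow> p x < e)"
    and lcs: "locally_convex_space sW"
begin

lemma \<iota>_diff: "x \<in> S \<Longrightarrow> y \<in> S \<Longrightarrow> \<iota> (x - y) = \<iota> x - \<iota> y"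
  using \<iota>_add[of "x - y" y] S_diff by simp

lemma p_abs_diff: "p \<in> PP \<Longrightarrow> x \<in> S \<Longrightarrow> y \<in> S \<Longrightarrow> \<bar>p x - p y\<bar> \<le> p (x - y)"
  using p_add[of p "x - y" y] p_add[of p "y - x" x] p_minus[of p x y] S_diff by force

lemma near:
  assumes "open U" "(0::'w) \<in> U"
  obtains O' where "open O'" "w \<in> O'" "\<And>x y. x \<in> O' \<Longrightarrow> y \<in> O' \<Longrightarrow> x - y \<in> U"
proof -
  have "continuous_on UNIV (\<lambda>(a, b). a - b :: 'w)"
    by (simp add: split_def) (intro continuous_intros)
  then have "open ((\<lambda>(a, b). a - b) -` U)"
    using assms(1) by (simp add: continuous_on_open_vimage)
  moreover have "(w, w) \<in> (\<lambda>(a, b). a - b) -` U" using assms(2) by simp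
  ultimately obtain A B where AB: "open A" "open B" "w \<in> A" "w \<in> B" "A \<times> B \<subseteq> (\<lambda>(a, b). a - b) -` U"
    by (rule open_prod_elim) auto
  then show thesis using that[of "A \<inter> B"] by (auto simp: subset_eq)
qed

section \<open>Extended seminorms and the topology of the completion\<close>

definition hat :: "('a \<Rightarrow> real) \<Rightarrow> 'w \<Rightarrow> real" where
  "hat p = (SOME h. continuous_on UNIV h \<and> (\<forall>a\<in>S. h (\<iota> a) = p a))"

lemma
  assumes p: "p \<in> PP"
  shows continuous_hat: "continuous_on UNIV (hat p)" and hat_\<iota>: "a \<in> S \<Longrightarrow> hat p (\<iota> a) = p a"
proof -
  have "\<exists>h. continuous_on UNIV h \<and> (\<forall>a\<in>S. h (\<iota> a) = p a)"
  proof (rule dense_extension[OF uniformity_real_diff complete_UNIV dense, of p])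
    fix w :: 'w and U :: "real set" assume "open U" "0 \<in> U"
    then obtain e where e: "e > 0" "ball 0 e \<subseteq> U" by (meson open_contains_ball)
    obtain V where V: "open V" "0 \<in> V" "\<forall>x\<in>S. \<iota> x \<in> V \<longrightarrow> p x < e" using nhd2[OF p e(1)] by blast
    obtain O' where O': "open O'" "w \<in> O'" "\<And>x y. x \<in> O' \<Longrightarrow> y \<in> O' \<Longrightarrow> x - y \<in> V"
      using near[OF V(1,2), of w] by blast
    have "p a - p b \<in> U" if "a \<in> S" "b \<in> S" "\<iota> a \<in> O'" "\<iota> b \<in> O'" for a b
    proof -
      have "p (a - b) < e" using O'(3)[OF that(3,4)] V(3) that S_diff by (simp add: \<iota>_diff)
      then have "\<bar>p a - p b\<bar> < e" using p_abs_diff[OF p that(1,2)] by simp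
      then show ?thesis using e(2) by (auto simp: subset_eq dist_real_def)
    qed
    then show "\<exists>O'. open O' \<and> w \<in> O' \<and> (\<forall>a\<in>S. \<forall>b\<in>S. \<iota> a \<in> O' \<longrightarrow> \<iota> b \<in> O' \<longrightarrow> p a - p b \<in> U)"
      using O' by blast
  qed blast
  then have "continuous_on UNIV (hat p) \<and> (\<forall>a\<in>S. hat p (\<iota> a) = p a)"
    unfolding hat_def by (rule someI_ex)
  then show "continuous_on UNIV (hat p)" "a \<in> S \<Longrightarrow> hat p (\<iota> a) = p a" by auto
qed

lemma dense2: "closure (\<iota> ` S \<times> \<iota> ` S) = UNIV"
  by (simp add: closure_Times dense)

lemma dense3: "closure (\<iota> ` S \<times> \<iota> ` S \<times> \<iota> ` S) = UNIV"
  by (simp add: closure_Times dense)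

text \<open>A closed condition holds everywhere once it holds on the dense image; equations and weak
  inequalities between continuous maps are of this kind.\<close>

lemma dense_induct2:
  assumes "closed {z :: 'w \<times> 'w. Q (fst z) (snd z)}" "\<And>x y. x \<in> S \<Longrightarrow> y \<in> S \<Longrightarrow> Q (\<iota> x) (\<iota> y)"
  shows "Q a b"
proof -
  have "closure (\<iota> ` S \<times> \<iota> ` S) \<subseteq> {z. Q (fst z) (snd z)}"
    by (rule closure_minimal[OF _ assms(1)]) (auto intro: assms(2))
  from subsetD[OF this, of "(a, b)"] show ?thesis by (simp add: dense2)
qed

lemma dense_induct3:
  assumes "closed {z :: 'w \<times> 'w \<times> 'w. Q (fst z) (fst (snd z)) (snd (snd z))}"
    "\<And>x y z. x \<in> S \<Longrightarrow> y \<in> S \<Longrightarrow> z \<in> S \<Longrightarrow> Q (\<iota> x) (\<iota> y) (\<iota> z)"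
  shows "Q a b c"
proof -
  have "closure (\<iota> ` S \<times> \<iota> ` S \<times> \<iota> ` S) \<subseteq> {z. Q (fst z) (fst (snd z)) (snd (snd z))}"
    by (rule closure_minimal[OF _ assms(1)]) (auto intro: assms(2))
  from subsetD[OF this, of "(a, b, c)"] show ?thesis by (simp add: dense3)
qed

text \<open>A ball of the extended seminorm is open, so each of its points is a limit of points
  \<open>\<iota> x\<close> in the same ball. These lie in \<open>V\<close>, whose closure is still
  inside \<open>U\<close>.\<close>

lemma hat_nhd:
  assumes "open U" "0 \<in> U"
  obtains p e where "p \<in> PP" "e > 0" "\<And>w. hat p w < e \<Longrightarrow> w \<in> U"
proof -
  obtain V where V: "open V" "0 \<in> V" "closure V \<subseteq> U" using closed_neighbourhood[OF assms] by blast
  obtain p e where p: "p \<in> PP" "e > 0" "\<forall>x\<in>S. p x < e \<longrightarrow> \<iota> x \<in> V" using nhd1[OF V(1,2)] by blast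
  have op: "open {w. hat p w < e}"
    using continuous_hat[OF p(1)] by (intro open_Collect_less) (auto intro: continuous_intros)
  have "w \<in> U" if w: "hat p w < e" for w
  proof -
    have "w \<in> closure ({w. hat p w < e} \<inter> \<iota> ` S)"
      using open_Int_closure_subset[OF op, of "\<iota> ` S"] w by (auto simp: dense)
    also have "\<dots> \<subseteq> closure V" using p hat_\<iota> by (intro closure_mono) auto
    finally have "w \<in> closure V" .
    then show ?thesis using V(3) by blast
  qed
  then show thesis using that p by blast
qed

lemma tendsto_hatI:
  assumes "\<And>p. p \<in> PP \<Longrightarrow> ((\<lambda>x. hat p (l - f x)) \<longlongrightarrow> 0) F"
  shows "(f \<longlongrightarrow> l) F"
proof (rule topological_tendstoI)
  fix U :: "'w set" assume U: "open U" "l \<in> U"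
  have "open ((\<lambda>w. l - w) -` U)"
    using U continuous_on_open_vimage[of UNIV "\<lambda>w. l - w"] by (auto intro: continuous_intros)
  then obtain p e where p: "p \<in> PP" "e > 0" "\<And>w. hat p w < e \<Longrightarrow> w \<in> (\<lambda>w. l - w) -` U"
    using hat_nhd[of "(\<lambda>w. l - w) -` U"] U by auto
  have "eventually (\<lambda>x. hat p (l - f x) < e) F"
    using assms[OF p(1)] p(2) by (rule order_tendstoD)
  then show "eventually (\<lambda>x. f x \<in> U) F"
    by (rule eventually_mono) (use p(3) in fastforce)
qed

subsection \<open>Bounded bilinear operations\<close>

definition bounded_op :: "('a \<Rightarrow> 'a \<Rightarrow> 'a) \<Rightarrow> bool" where
  "bounded_op B \<longleftrightarrow>
    (\<forall>x\<in>S. \<forall>y\<in>S. B x y \<in> S) \<and>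
    (\<forall>x\<in>S. \<forall>y\<in>S. \<forall>z\<in>S. B (x + y) z = B x z + B y z \<and> B z (x + y) = B z x + B z y) \<and>
    (\<forall>c. \<forall>x\<in>S. \<forall>y\<in>S. B (s c x) y = s c (B x y) \<and> B x (s c y) = s c (B x y)) \<and>
    (\<forall>p\<in>PP. \<exists>q\<in>PP. \<exists>C\<ge>0. \<forall>x\<in>S. \<forall>y\<in>S. p (B x y) \<le> C * (q x * q y))"

lemma bounded_op_in: "bounded_op B \<Longrightarrow> x \<in> S \<Longrightarrow> y \<in> S \<Longrightarrow> B x y \<in> S"
  unfolding bounded_op_def by blast

lemma bounded_opI:
  assumes "\<And>x y. x \<in> S \<Longrightarrow> y \<in> S \<Longrightarrow> B x y \<in> S"
    and "\<And>x y c. x \<in> S \<Longrightarrow> y \<in> S \<Longrightarrow> B (s c x) y = s c (B x y)"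
    and "\<And>x y c. x \<in> S \<Longrightarrow> y \<in> S \<Longrightarrow> B x (s c y) = s c (B x y)"
    and "\<And>x y z. x \<in> S \<Longrightarrow> y \<in> S \<Longrightarrow> z \<in> S \<Longrightarrow> B (x + y) z = B x z + B y z"
    and "\<And>x y z. x \<in> S \<Longrightarrow> y \<in> S \<Longrightarrow> z \<in> S \<Longrightarrow> B z (x + y) = B z x + B z y"
    and "\<And>p. p \<in> PP \<Longrightarrow> \<exists>q\<in>PP. \<exists>C\<ge>0. \<forall>x\<in>S. \<forall>y\<in>S. p (B x y) \<le> C * (q x * q y)"
  shows "bounded_op B"
  unfolding bounded_op_def by (intro conjI ballI allI assms)

lemma bounded_op_add:
  assumes "bounded_op B" "x \<in> S" "y \<in> S" "z \<in> S"
  shows "B (x + y) z = B x z + B y z" "B z (x + y) = B z x + B z y"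
  using assms unfolding bounded_op_def by blast+

lemma bounded_op_scale:
  assumes "bounded_op B" "x \<in> S" "y \<in> S"
  shows "B (s c x) y = s c (B x y)" "B x (s c y) = s c (B x y)"
  using assms unfolding bounded_op_def by blast+

lemma bounded_op_bound:
  assumes "bounded_op B" "p \<in> PP"
  obtains q C where "q \<in> PP" "C \<ge> 0" "\<And>x y. x \<in> S \<Longrightarrow> y \<in> S \<Longrightarrow> p (B x y) \<le> C * (q x * q y)"
proof -
  have "\<exists>q\<in>PP. \<exists>C\<ge>0. \<forall>x\<in>S. \<forall>y\<in>S. p (B x y) \<le> C * (q x * q y)"
    using assms unfolding bounded_op_def by blast
  then show thesis using that by blast
qed

lemma bounded_op_cong:
  assumes B: "bounded_op B" and eq: "\<And>x y. x \<in> S \<Longrightarrow> y \<in> S \<Longrightarrow> B x y = B' x y"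
  shows "bounded_op B'"
  using B unfolding bounded_op_def by (simp add: eq S_add S_scale cong: ball_cong)

text \<open>The same description as in \<open>extension\<close>, with \<open>S\<close> for the
  symmetric algebra, so that the two agree by unfolding.\<close>

definition ext :: "('a \<Rightarrow> 'a \<Rightarrow> 'a) \<Rightarrow> 'w \<Rightarrow> 'w \<Rightarrow> 'w" where
  "ext B = (THE F. continuous_on UNIV (\<lambda>(a, b). F a b) \<and>
     (\<forall>x\<in>S. \<forall>y\<in>S. F (\<iota> x) (\<iota> y) = \<iota> (B x y)))"

lemma extI:
  assumes "continuous_on UNIV (\<lambda>(a, b). F a b)" "\<And>x y. x \<in> S \<Longrightarrow> y \<in> S \<Longrightarrow> F (\<iota> x) (\<iota> y) = \<iota> (B x y)"
  shows "ext B = F"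
  unfolding ext_def
proof (rule the_equality)
  fix G assume G: "continuous_on UNIV (\<lambda>(a, b). G a b) \<and> (\<forall>x\<in>S. \<forall>y\<in>S. G (\<iota> x) (\<iota> y) = \<iota> (B x y))"
  have "G a b = F a b" for a b
    by (rule dense_induct2[of "\<lambda>a b. G a b = F a b"])
      (use assms G in \<open>auto simp: split_def intro!: closed_Collect_eq\<close>)
  then show "G = F" by blast
qed (use assms in blast)

text \<open>The difference \<open>B x y - B x' y'\<close> splits into \<open>B (x - x') y\<close>
  and \<open>B x' (y - y')\<close>. Both are small near a given point if the arguments also stay in
  the open region \<open>T\<close> where the extended seminorm is below \<open>M\<close>; this is
  the local Cauchy condition of \<open>dense_extension\<close>.\<close>

lemma
  assumes B: "bounded_op B"
  shows continuous_ext: "continuous_on UNIV (\<lambda>(a, b). ext B a b)"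
    and ext_\<iota>: "x \<in> S \<Longrightarrow> y \<in> S \<Longrightarrow> ext B (\<iota> x) (\<iota> y) = \<iota> (B x y)"
proof -
  have B_in: "B x y \<in> S" if "x \<in> S" "y \<in> S" for x y
    using B that unfolding bounded_op_def by blast
  have B_add: "B (x + y) z = B x z + B y z" "B z (x + y) = B z x + B z y"
    if "x \<in> S" "y \<in> S" "z \<in> S" for x y z
    using B that unfolding bounded_op_def by blast+
  have diff: "B x y - B x' y' = B (x - x') y + B x' (y - y')"
    if "x \<in> S" "y \<in> S" "x' \<in> S" "y' \<in> S" for x y x' y'
    using B_add(1)[of "x - x'" x' y] B_add(2)[of "y - y'" y' x'] that S_diff by simp
  obtain h where h: "continuous_on UNIV h" "\<And>a. a \<in> S \<times> S \<Longrightarrow> h (map_prod \<iota> \<iota> a) = \<iota> (B (fst a) (snd a))"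
  proof (rule dense_extension[OF unif compl, of "map_prod \<iota> \<iota>" "S \<times> S" "\<lambda>a. \<iota> (B (fst a) (snd a))"])
    have "map_prod \<iota> \<iota> ` (S \<times> S) = \<iota> ` S \<times> \<iota> ` S" by auto
    then show "closure (map_prod \<iota> \<iota> ` (S \<times> S)) = UNIV" by (simp add: dense2)
    fix w :: "'w \<times> 'w" and U :: "'w set" assume "open U" "0 \<in> U"
    then obtain p e where p: "p \<in> PP" "e > 0" "\<forall>x\<in>S. p x < e \<longrightarrow> \<iota> x \<in> U" using nhd1 by blast
    obtain q C where q: "q \<in> PP" "C \<ge> 0" "\<forall>x\<in>S. \<forall>y\<in>S. p (B x y) \<le> C * (q x * q y)"
      using B p(1) unfolding bounded_op_def by blast
    \<comment> \<open>\<open>M\<close> is positive and exceeds the seminorm at both coordinates of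
      \<open>w\<close>; the summand 1 in the denominator of \<open>d\<close> keeps
      \<open>2 * C * M * d\<close> strictly below \<open>e\<close> also when \<open>C\<close> is
      zero.\<close>
    define M where "M = max 0 (max (hat q (fst w)) (hat q (snd w))) + 1"
    define d where "d = e / (2 * C * M + 1)"
    have M: "M > 0" "hat q (fst w) < M" "hat q (snd w) < M" by (auto simp: M_def)
    then have den: "2 * C * M + 1 > 0" using q(2) by (simp add: add_nonneg_pos)
    then have d: "d > 0" using p(2) by (simp add: d_def)
    obtain V where V: "open V" "0 \<in> V" "\<forall>x\<in>S. \<iota> x \<in> V \<longrightarrow> q x < d" using nhd2[OF q(1) d] by blast
    obtain O1 where O1: "open O1" "fst w \<in> O1" "\<And>x y. x \<in> O1 \<Longrightarrow> y \<in> O1 \<Longrightarrow> x - y \<in> V"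
      using near[OF V(1,2), of "fst w"] by blast
    obtain O2 where O2: "open O2" "snd w \<in> O2" "\<And>x y. x \<in> O2 \<Longrightarrow> y \<in> O2 \<Longrightarrow> x - y \<in> V"
      using near[OF V(1,2), of "snd w"] by blast
    define T where "T = {w. hat q w < M}"
    have T: "open T" unfolding T_def
      using continuous_hat[OF q(1)] by (intro open_Collect_less) (auto intro: continuous_intros)
    have "\<iota> (B x y) - \<iota> (B x' y') \<in> U"
      if xy: "x \<in> S" "y \<in> S" "x' \<in> S" "y' \<in> S" and O: "\<iota> x \<in> O1 \<inter> T" "\<iota> x' \<in> O1 \<inter> T" "\<iota> y \<in> O2 \<inter> T" "\<iota> y' \<in> O2 \<inter> T"
      for x y x' y'
    proof -
      have small: "q (x - x') < d" "q (y - y') < d"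
        using V(3) O1(3)[of "\<iota> x" "\<iota> x'"] O2(3)[of "\<iota> y" "\<iota> y'"] O xy S_diff by (auto simp: \<iota>_diff)
      have big: "q y < M" "q x' < M" using O hat_\<iota>[OF q(1)] xy by (auto simp: T_def)
      have "p (B x y - B x' y') \<le> p (B (x - x') y) + p (B x' (y - y'))"
        unfolding diff[OF xy] by (intro p_add p(1) B_in S_diff xy)
      also have "\<dots> \<le> C * (q (x - x') * q y) + C * (q x' * q (y - y'))"
        by (intro add_mono q(3)[rule_format] S_diff xy)
      also have "\<dots> \<le> C * (d * M) + C * (M * d)"
        using small big d M by (intro add_mono mult_left_mono mult_mono q(2) p_nonneg[OF q(1)] S_diff xy) auto
      also have "\<dots> = (2 * C * M) * d" by simp
      also have "\<dots> < (2 * C * M + 1) * d" using d by simp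
      also have "\<dots> = e" using den by (simp add: d_def)
      finally show ?thesis
        using p(3) xy B_in S_diff by (simp flip: \<iota>_diff)
    qed
    then have "\<forall>a\<in>S \<times> S. \<forall>b\<in>S \<times> S. map_prod \<iota> \<iota> a \<in> (O1 \<inter> T) \<times> (O2 \<inter> T) \<longrightarrow>
        map_prod \<iota> \<iota> b \<in> (O1 \<inter> T) \<times> (O2 \<inter> T) \<longrightarrow> \<iota> (B (fst a) (snd a)) - \<iota> (B (fst b) (snd b)) \<in> U"
      by auto
    moreover have "open ((O1 \<inter> T) \<times> (O2 \<inter> T))" using O1 O2 T by (intro open_Times open_Int)
    moreover have "w \<in> (O1 \<inter> T) \<times> (O2 \<inter> T)" using O1 O2 M by (auto simp: T_def mem_Times_iff)
    ultimately show "\<exists>O'. open O' \<and> w \<in> O' \<and> (\<forall>a\<in>S \<times> S. \<forall>b\<in>S \<times> S. map_prod \<iota> \<iota> a \<in> O' \<longrightarrow>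
        map_prod \<iota> \<iota> b \<in> O' \<longrightarrow> \<iota> (B (fst a) (snd a)) - \<iota> (B (fst b) (snd b)) \<in> U)"
      by blast
  qed blast
  have h': "h (\<iota> x, \<iota> y) = \<iota> (B x y)" if "x \<in> S" "y \<in> S" for x y
    using h(2)[of "(x, y)"] that by simp
  have "ext B = (\<lambda>a b. h (a, b))"
    by (rule extI) (use h(1) h' in \<open>auto simp: split_def\<close>)
  then show "continuous_on UNIV (\<lambda>(a, b). ext B a b)"
    "x \<in> S \<Longrightarrow> y \<in> S \<Longrightarrow> ext B (\<iota> x) (\<iota> y) = \<iota> (B x y)"
    using h(1) h' by (auto simp: split_def)
qed

lemma continuous_ext_comp:
  assumes "bounded_op B" "continuous_on UNIV f" "continuous_on UNIV g"
  shows "continuous_on UNIV (\<lambda>z. ext B (f z) (g z))"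
proof -
  have "continuous_on UNIV (\<lambda>z. (f z, g z))" using assms(2,3) by (rule continuous_on_Pair)
  from continuous_on_compose[OF this continuous_on_subset[OF continuous_ext[OF assms(1)]]]
  show ?thesis by (simp add: comp_def)
qed

lemma continuous_hat_comp:
  assumes "p \<in> PP" "continuous_on UNIV f"
  shows "continuous_on UNIV (\<lambda>z. hat p (f z))"
  using continuous_on_compose[OF assms(2) continuous_on_subset[OF continuous_hat[OF assms(1)]]]
  by (simp add: comp_def)

lemma continuous_sW: "continuous_on UNIV f \<Longrightarrow> continuous_on UNIV (\<lambda>z. sW c (f z))"
proof -
  assume f: "continuous_on UNIV f"
  interpret locally_convex_space sW by (rule lcs)
  have "continuous_on UNIV (\<lambda>z. (c, f z))" using f by (intro continuous_on_Pair continuous_on_const)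
  from continuous_on_compose[OF this continuous_on_subset[OF continuous_scale]]
  show ?thesis by (simp add: comp_def)
qed

lemma ext_bilinear:
  assumes B: "bounded_op B"
  shows "bilinear_map sW sW sW (ext B)"
proof -
  interpret locally_convex_space sW by (rule lcs)
  note cont = continuous_ext_comp[OF B] continuous_on_add continuous_on_fst continuous_on_snd continuous_on_id
  have 1: "ext B (x + y) z = ext B x z + ext B y z" for x y z
  proof (rule dense_induct3[of "\<lambda>x y z. ext B (x + y) z = ext B x z + ext B y z"])
    show "closed {z. ext B (fst z + fst (snd z)) (snd (snd z)) = ext B (fst z) (snd (snd z)) + ext B (fst (snd z)) (snd (snd z))}"
      by (intro closed_Collect_eq cont)
  next
    fix x y z assume xyz: "x \<in> S" "y \<in> S" "z \<in> S"
    then have "B (x + y) z = B x z + B y z" "B x z \<in> S" "B y z \<in> S"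
      using B unfolding bounded_op_def by blast+
    then show "ext B (\<iota> x + \<iota> y) (\<iota> z) = ext B (\<iota> x) (\<iota> z) + ext B (\<iota> y) (\<iota> z)"
      using xyz by (simp add: ext_\<iota>[OF B] \<iota>_add S_add flip: \<iota>_add)
  qed
  have 2: "ext B z (x + y) = ext B z x + ext B z y" for x y z
  proof (rule dense_induct3[of "\<lambda>x y z. ext B z (x + y) = ext B z x + ext B z y"])
    show "closed {z. ext B (snd (snd z)) (fst z + fst (snd z)) = ext B (snd (snd z)) (fst z) + ext B (snd (snd z)) (fst (snd z))}"
      by (intro closed_Collect_eq cont)
  next
    fix x y z assume xyz: "x \<in> S" "y \<in> S" "z \<in> S"
    then have "B z (x + y) = B z x + B z y" "B z x \<in> S" "B z y \<in> S"
      using B unfolding bounded_op_def by blast+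
    then show "ext B (\<iota> z) (\<iota> x + \<iota> y) = ext B (\<iota> z) (\<iota> x) + ext B (\<iota> z) (\<iota> y)"
      using xyz by (simp add: ext_\<iota>[OF B] \<iota>_add S_add flip: \<iota>_add)
  qed
  have 3: "ext B (sW c x) y = sW c (ext B x y)" "ext B x (sW c y) = sW c (ext B x y)" for c x y
  proof -
    have S3: "B (s c x) y = s c (B x y)" "B x (s c y) = s c (B x y)" "B x y \<in> S" if "x \<in> S" "y \<in> S" for x y
      using B that unfolding bounded_op_def by blast+
    have e: "ext B (sW c (\<iota> x)) (\<iota> y) = sW c (ext B (\<iota> x) (\<iota> y))"
      "ext B (\<iota> x) (sW c (\<iota> y)) = sW c (ext B (\<iota> x) (\<iota> y))" if xy: "x \<in> S" "y \<in> S" for x y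
      using ext_\<iota>[OF B S_scale[OF xy(1), of c] xy(2)] ext_\<iota>[OF B xy(1) S_scale[OF xy(2), of c]] ext_\<iota>[OF B xy] S3[OF xy]
      by (simp_all add: \<iota>_scale xy)
    show "ext B (sW c x) y = sW c (ext B x y)"
      by (rule dense_induct2[of "\<lambda>x y. ext B (sW c x) y = sW c (ext B x y)"])
        (intro closed_Collect_eq continuous_sW cont, rule e)
    show "ext B x (sW c y) = sW c (ext B x y)"
      by (rule dense_induct2[of "\<lambda>x y. ext B x (sW c y) = sW c (ext B x y)"])
        (intro closed_Collect_eq continuous_sW cont, rule e)
  qed
  show ?thesis
    unfolding bilinear_map_def Vector_Spaces.linear_iff using 1 2 3 vector_space_axioms by blast
qed

lemma ext_assoc:
  assumes B: "bounded_op B"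
    and assoc: "\<And>x y z. x \<in> S \<Longrightarrow> y \<in> S \<Longrightarrow> z \<in> S \<Longrightarrow> B (B x y) z = B x (B y z)"
  shows "ext B (ext B a b) c = ext B a (ext B b c)"
proof (rule dense_induct3[of "\<lambda>a b c. ext B (ext B a b) c = ext B a (ext B b c)"])
  show "closed {z. ext B (ext B (fst z) (fst (snd z))) (snd (snd z)) = ext B (fst z) (ext B (fst (snd z)) (snd (snd z)))}"
    by (intro closed_Collect_eq continuous_ext_comp[OF B] continuous_on_fst continuous_on_snd continuous_on_id)
next
  fix x y z assume xyz: "x \<in> S" "y \<in> S" "z \<in> S"
  then have "B x y \<in> S" "B y z \<in> S" using B unfolding bounded_op_def by blast+
  then show "ext B (ext B (\<iota> x) (\<iota> y)) (\<iota> z) = ext B (\<iota> x) (ext B (\<iota> y) (\<iota> z))"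
    using xyz assoc by (simp add: ext_\<iota>[OF B])
qed

lemma ext_cong:
  assumes "\<And>x y. x \<in> S \<Longrightarrow> y \<in> S \<Longrightarrow> B x y = B' x y"
  shows "ext B = ext B'"
proof -
  have "(\<forall>x\<in>S. \<forall>y\<in>S. F (\<iota> x) (\<iota> y) = \<iota> (B x y)) \<longleftrightarrow> (\<forall>x\<in>S. \<forall>y\<in>S. F (\<iota> x) (\<iota> y) = \<iota> (B' x y))" for F
    using assms by metis
  then show ?thesis unfolding ext_def by (simp only:)
qed

section \<open>Uniform bounds on the completion\<close>

lemma \<iota>_sum: "(\<And>i. i \<in> I \<Longrightarrow> f i \<in> S) \<Longrightarrow> (\<Sum>i\<in>I. f i) \<in> S \<and> \<iota> (\<Sum>i\<in>I. f i) = (\<Sum>i\<in>I. \<iota> (f i))"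
proof (induction I rule: infinite_finite_induct)
  case (insert i I)
  then show ?case by (simp add: S_add \<iota>_add)
qed (use \<iota>_diff[OF S_zero S_zero] S_zero in auto)

text \<open>Both sides are continuous in \<open>(a, b)\<close>, so the inequality passes from the
  dense image to the completion. Partial sums of Taylor series and difference quotients, which have
  two terms, are both instances.\<close>

lemma ext_difference_bound:
  assumes B: "bounded_op B" and Bk: "\<And>k. bounded_op (Bk k)" and p: "p \<in> PP" "q \<in> PP"
    and bound: "\<And>x y. x \<in> S \<Longrightarrow> y \<in> S \<Longrightarrow> p (B x y - (\<Sum>k\<in>I. s (c k) (Bk k x y))) \<le> C * (q x * q y)"
  shows "hat p (ext B a b - (\<Sum>k\<in>I. sW (c k) (ext (Bk k) a b))) \<le> C * (hat q a * hat q b)"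
proof (rule dense_induct2[of "\<lambda>a b. hat p (ext B a b - (\<Sum>k\<in>I. sW (c k) (ext (Bk k) a b))) \<le> C * (hat q a * hat q b)"])
  show "closed {z. hat p (ext B (fst z) (snd z) - (\<Sum>k\<in>I. sW (c k) (ext (Bk k) (fst z) (snd z))))
      \<le> C * (hat q (fst z) * hat q (snd z))}"
    by (intro closed_Collect_le continuous_hat_comp[OF p(1)] continuous_ext_comp[OF B] continuous_ext_comp[OF Bk]
        continuous_on_diff continuous_on_sum continuous_sW
        continuous_on_mult continuous_on_const continuous_hat_comp[OF p(2)] continuous_on_fst
        continuous_on_snd continuous_on_id)
  fix x y assume xy: "x \<in> S" "y \<in> S"
  note in_S = bounded_op_in[OF B xy] bounded_op_in[OF Bk xy]
  have sum_S: "(\<Sum>k\<in>I. s (c k) (Bk k x y)) \<in> S"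
    and sum_\<iota>: "\<iota> (\<Sum>k\<in>I. s (c k) (Bk k x y)) = (\<Sum>k\<in>I. sW (c k) (\<iota> (Bk k x y)))"
  proof -
    have *: "s (c k) (Bk k x y) \<in> S" for k by (rule S_scale[OF in_S(2)])
    show "(\<Sum>k\<in>I. s (c k) (Bk k x y)) \<in> S" by (rule conjunct1[OF \<iota>_sum]) (rule *)
    have "\<iota> (\<Sum>k\<in>I. s (c k) (Bk k x y)) = (\<Sum>k\<in>I. \<iota> (s (c k) (Bk k x y)))"
      by (rule conjunct2[OF \<iota>_sum]) (rule *)
    then show "\<iota> (\<Sum>k\<in>I. s (c k) (Bk k x y)) = (\<Sum>k\<in>I. sW (c k) (\<iota> (Bk k x y)))"
      by (simp only: \<iota>_scale[OF in_S(2)])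
  qed
  have "ext B (\<iota> x) (\<iota> y) - (\<Sum>k\<in>I. sW (c k) (ext (Bk k) (\<iota> x) (\<iota> y))) =
      \<iota> (B x y - (\<Sum>k\<in>I. s (c k) (Bk k x y)))"
    by (simp only: ext_\<iota>[OF B xy] ext_\<iota>[OF Bk xy] \<iota>_diff[OF in_S(1) sum_S] sum_\<iota>)
  moreover have "B x y - (\<Sum>k\<in>I. s (c k) (Bk k x y)) \<in> S"
    by (rule S_diff[OF in_S(1) sum_S])
  ultimately show "hat p (ext B (\<iota> x) (\<iota> y) - (\<Sum>k\<in>I. sW (c k) (ext (Bk k) (\<iota> x) (\<iota> y))))
      \<le> C * (hat q (\<iota> x) * hat q (\<iota> y))"
    using bound[OF xy] xy by (simp add: hat_\<iota>[OF p(1)] hat_\<iota>[OF p(2)])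
qed

lemma hat_nonneg:
  assumes p: "p \<in> PP"
  shows "hat p a \<ge> 0"
proof -
  have "closed {a. 0 \<le> hat p a}"
    using continuous_hat[OF p] by (intro closed_Collect_le continuous_on_const)
  then have "closure (\<iota> ` S) \<subseteq> {a. 0 \<le> hat p a}"
    by (rule closure_minimal[rotated]) (auto simp: hat_\<iota>[OF p] p_nonneg[OF p])
  then show ?thesis by (auto simp: dense)
qed

text \<open>The geometric rate is uniform in \<open>x\<close> and \<open>y\<close> up to the factor
  \<open>q x * q y\<close>, and in this form it survives on the completion, where convergence at the
  points of \<open>S\<close> alone would give nothing.\<close>

lemma ext_sums:
  assumes B: "bounded_op B" and Bk: "\<And>k. bounded_op (Bk k)"
    and bound: "\<And>p. p \<in> PP \<Longrightarrow> \<exists>q\<in>PP. \<exists>C. \<forall>n. \<forall>x\<in>S. \<forall>y\<in>S.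
      p (B x y - (\<Sum>k<n. s (c k) (Bk k x y))) \<le> C * (1 / 2) ^ n * (q x * q y)"
  shows "(\<lambda>k. sW (c k) (ext (Bk k) a b)) sums ext B a b"
  unfolding sums_def
proof (rule tendsto_hatI)
  fix p assume p: "p \<in> PP"
  obtain q C where q: "q \<in> PP" and C: "\<And>n x y. x \<in> S \<Longrightarrow> y \<in> S \<Longrightarrow>
      p (B x y - (\<Sum>k<n. s (c k) (Bk k x y))) \<le> C * (1 / 2) ^ n * (q x * q y)"
    using bound[OF p] by metis
  have "(\<lambda>n. C * (1 / 2) ^ n * (hat q a * hat q b)) \<longlonglongrightarrow> C * 0 * (hat q a * hat q b)"
    by (intro tendsto_intros LIMSEQ_power_zero) simp
  then have lim: "(\<lambda>n. C * (1 / 2) ^ n * (hat q a * hat q b)) \<longlonglongrightarrow> 0" by simp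
  show "(\<lambda>n. hat p (ext B a b - (\<Sum>k<n. sW (c k) (ext (Bk k) a b)))) \<longlonglongrightarrow> 0"
    by (rule tendsto_sandwich[OF _ _ tendsto_const lim])
      (auto intro!: always_eventually hat_nonneg[OF p] ext_difference_bound[OF B Bk p q] C)
qed

text \<open>The quotient is written as a sum of two scaled products, which makes it an instance of
  \<open>ext_difference_bound\<close>. The bound is linear in \<open>norm h\<close> with
  \<open>q\<close> and \<open>C\<close> independent of \<open>h\<close>, so the limit can be taken
  for fixed \<open>a\<close> and \<open>b\<close>.\<close>

lemma ext_difference_quotient:
  fixes z0 :: 'k
  assumes B: "\<And>z. bounded_op (B z)" and D: "bounded_op D"
    and bound: "\<And>p. p \<in> PP \<Longrightarrow> \<exists>q\<in>PP. \<exists>C. \<forall>h. h \<noteq> 0 \<longrightarrow> norm h < 1 \<longrightarrow> (\<forall>x\<in>S. \<forall>y\<in>S.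
      p (D x y - (s (1 / h) (B (z0 + h) x y) + s (- (1 / h)) (B z0 x y))) \<le> C * norm h * (q x * q y))"
  shows "((\<lambda>z. sW (1 / (z - z0)) (ext (B z) a b - ext (B z0) a b)) \<longlongrightarrow> ext D a b) (at z0)"
proof (rule tendsto_hatI)
  interpret locally_convex_space sW by (rule lcs)
  fix p assume p: "p \<in> PP"
  obtain q where q: "q \<in> PP" and "\<exists>C. \<forall>h. h \<noteq> 0 \<longrightarrow> norm h < 1 \<longrightarrow> (\<forall>x\<in>S. \<forall>y\<in>S.
      p (D x y - (s (1 / h) (B (z0 + h) x y) + s (- (1 / h)) (B z0 x y))) \<le> C * norm h * (q x * q y))"
    using bound[OF p] by (rule bexE)
  then obtain C where C: "\<forall>h. h \<noteq> 0 \<longrightarrow> norm h < 1 \<longrightarrow> (\<forall>x\<in>S. \<forall>y\<in>S.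
      p (D x y - (s (1 / h) (B (z0 + h) x y) + s (- (1 / h)) (B z0 x y))) \<le> C * norm h * (q x * q y))"
    by (elim exE)
  let ?d = "\<lambda>z. ext D a b - sW (1 / (z - z0)) (ext (B z) a b - ext (B z0) a b)"
  have le: "hat p (?d z) \<le> C * norm (z - z0) * (hat q a * hat q b)" if "z \<noteq> z0" "norm (z - z0) < 1" for z
  proof -
    define c where "c k = (if k = 0 then 1 / (z - z0) else - (1 / (z - z0)))" for k :: nat
    define Bk where "Bk k = B (if k = 0 then z else z0)" for k :: nat
    have two: "{..<2::nat} = {0, 1}" by auto
    have "hat p (ext D a b - (\<Sum>k<2. sW (c k) (ext (Bk k) a b))) \<le> C * norm (z - z0) * (hat q a * hat q b)"
    proof (rule ext_difference_bound[OF D _ p q])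
      show "bounded_op (Bk k)" for k unfolding Bk_def by (rule B)
      fix x y assume "x \<in> S" "y \<in> S"
      then show "p (D x y - (\<Sum>k<2. s (c k) (Bk k x y))) \<le> C * norm (z - z0) * (q x * q y)"
        using C[rule_format, of "z - z0" x y] that by (simp add: two c_def Bk_def)
    qed
    moreover have "ext D a b - (\<Sum>k<2. sW (c k) (ext (Bk k) a b)) = ?d z"
      by (simp add: two c_def Bk_def scale_right_diff_distrib scale_minus_left)
    ultimately show ?thesis by simp
  qed
  have "((\<lambda>z. C * norm (z - z0) * (hat q a * hat q b)) \<longlongrightarrow> C * norm (z0 - z0) * (hat q a * hat q b)) (at z0)"
    by (intro tendsto_intros)
  then have lim: "((\<lambda>z. C * norm (z - z0) * (hat q a * hat q b)) \<longlongrightarrow> 0) (at z0)" by simp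
  show "((\<lambda>z. hat p (?d z)) \<longlongrightarrow> 0) (at z0)"
  proof (rule tendsto_sandwich[OF _ _ tendsto_const lim])
    show "eventually (\<lambda>z. hat p (?d z) \<le> C * norm (z - z0) * (hat q a * hat q b)) (at z0)"
      unfolding eventually_at using le by (intro exI[of _ 1]) (auto simp: dist_norm)
  qed (auto intro!: always_eventually hat_nonneg[OF p])
qed

end

lemma sum_half_powers: "(\<Sum>j\<in>{n..<K}. (1 / 2 :: real) ^ j) \<le> 2 * (1 / 2) ^ n"
proof (cases "n \<le> K")
  case True
  then have "(\<Sum>j\<in>{n..<K}. (1 / 2 :: real) ^ j) = 2 * (1 / 2) ^ n - 2 * (1 / 2) ^ K"
  proof (induction K rule: dec_induct)
    case (step K)
    have "(1 / 2 :: real) ^ Suc K = (1 / 2) ^ K / 2" by simp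
    then show ?case using step by (simp only: sum.atLeastLessThan_Suc)
  qed simp
  then show ?thesis by simp
qed simp

context graded_form
begin

subsection \<open>Power series expansion of the star product\<close>

text \<open>\<open>taylor j z a b\<close> is the \<open>j\<close>-th Taylor coefficient of the star product at \<open>z\<close>.\<close>

definition taylor :: "nat \<Rightarrow> 'k \<Rightarrow> ('k, 'v) tensor \<Rightarrow> ('k, 'v) tensor \<Rightarrow> ('k, 'v) tensor" where
  "taylor j z a b = (\<Sum>k | (Pc ^^ (k + j)) (a \<otimes> b) \<noteq> 0.
     fscale (of_nat (k + j choose j) * z ^ k / fact (k + j)) (mcontr (k + j) a b))"

lemma mcontr_zero: "(Pc ^^ k) (a \<otimes> b) = 0 \<Longrightarrow> mcontr k a b = 0"
  by (simp add: mcontr_def flinear_0[OF flinear_mult])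

lemma taylor_eq:
  assumes "\<And>k. k \<ge> K \<Longrightarrow> (Pc ^^ k) (a \<otimes> b) = 0"
  shows "taylor j z a b = (\<Sum>k<K. fscale (of_nat (k + j choose j) * z ^ k / fact (k + j)) (mcontr (k + j) a b))"
  unfolding taylor_def
proof (rule sum.mono_neutral_left)
  show "{k. (Pc ^^ (k + j)) (a \<otimes> b) \<noteq> 0} \<subseteq> {..<K}"
  proof
    fix k assume "k \<in> {k. (Pc ^^ (k + j)) (a \<otimes> b) \<noteq> 0}"
    then have "\<not> k + j \<ge> K" using assms by blast
    then show "k \<in> {..<K}" by simp
  qed
qed (auto simp: mcontr_zero)

lemma sprod_eq:
  assumes "\<And>k. k \<ge> K \<Longrightarrow> (Pc ^^ k) (a \<otimes> b) = 0"
  shows "sprod z a b = (\<Sum>k<K. fscale (z ^ k / fact k) (mcontr k a b))"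
proof -
  have "expo z (a \<otimes> b) = (\<Sum>k<K. fscale (z ^ k / fact k) ((Pc ^^ k) (a \<otimes> b)))"
    by (rule expo_eq) (rule assms)
  then show ?thesis
    by (simp add: sprod_def mcontr_def flinear_sum[OF flinear_mult] flinear_scale[OF flinear_mult])
qed

lemma taylor_0: "a \<in> tensors \<Longrightarrow> b \<in> tensors \<Longrightarrow> taylor 0 z a b = sprod z a b"
proof -
  assume "a \<in> tensors" "b \<in> tensors"
  then obtain K where K: "\<And>k. k \<ge> K \<Longrightarrow> (Pc ^^ k) (a \<otimes> b) = 0"
    using Pc_nilpotent[OF tensor_prod_in_pairs] by blast
  show ?thesis by (simp add: taylor_eq[OF K] sprod_eq[OF K])
qed

lemma taylor_at_0: "a \<in> tensors \<Longrightarrow> b \<in> tensors \<Longrightarrow> taylor j 0 a b = fscale (1 / fact j) (mcontr j a b)"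
proof -
  assume "a \<in> tensors" "b \<in> tensors"
  then obtain K where "\<And>k. k \<ge> K \<Longrightarrow> (Pc ^^ k) (a \<otimes> b) = 0"
    using Pc_nilpotent[OF tensor_prod_in_pairs] by blast
  then have K: "\<And>k. k \<ge> Suc K \<Longrightarrow> (Pc ^^ k) (a \<otimes> b) = 0" by simp
  have "taylor j 0 a b = (\<Sum>k<Suc K. fscale (of_nat (k + j choose j) * 0 ^ k / fact (k + j)) (mcontr (k + j) a b))"
    by (rule taylor_eq) (rule K)
  then show ?thesis by (simp add: sum.lessThan_Suc_shift del: sum.lessThan_Suc)
qed

text \<open>The binomial theorem in each power of \<open>z + h\<close>, with the terms collected by
  powers of \<open>h\<close>. All sums are finite, with the nilpotency bound \<open>K\<close> as
  common range.\<close>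

lemma sprod_expansion:
  assumes K: "\<And>k. k \<ge> K \<Longrightarrow> (Pc ^^ k) (a \<otimes> b) = 0"
  shows "sprod (z + h) a b = (\<Sum>j<K. fscale (h ^ j) (taylor j z a b))"
proof -
  define T where "T j k = fscale (of_nat (k + j choose j) * (h ^ j * z ^ k) / fact (k + j)) (mcontr (k + j) a b)" for j k
  have T0: "T j k = 0" if "j + k \<ge> K" for j k
    using K[of "k + j"] that by (simp add: T_def mcontr_zero)
  have "(\<Sum>j<K. fscale (h ^ j) (taylor j z a b)) = (\<Sum>j<K. \<Sum>k<K. T j k)"
    by (simp add: taylor_eq[OF K] T_def fs.scale_sum_right mult_ac)
  also have "\<dots> = (\<Sum>(j, k)\<in>{..<K} \<times> {..<K}. T j k)" by (rule sum.cartesian_product)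
  \<comment> \<open>Terms with \<open>j + k \<ge> K\<close> vanish, so the square may be cut down to
    the triangle that is summed along its diagonals.\<close>
  also have "\<dots> = (\<Sum>(j, k)\<in>{(j, k). j + k < K}. T j k)"
  proof (rule sum.mono_neutral_right)
    have "T j k = 0" if "\<not> j + k < K" for j k using T0[of j k] that by simp
    then show "\<forall>i\<in>{..<K} \<times> {..<K} - {(j, k). j + k < K}. (case i of (j, k) \<Rightarrow> T j k) = 0" by auto
  qed auto
  also have "\<dots> = (\<Sum>n<K. \<Sum>j\<le>n. T j (n - j))" by (rule sum.triangle_reindex)
  also have "\<dots> = (\<Sum>n<K. fscale ((z + h) ^ n / fact n) (mcontr n a b))"
  proof (rule sum.cong[OF refl])
    fix n
    have "(\<Sum>j\<le>n. T j (n - j)) = (\<Sum>j\<le>n. fscale (of_nat (n choose j) * h ^ j * z ^ (n - j) / fact n) (mcontr n a b))"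
      by (rule sum.cong[OF refl]) (simp add: T_def mult.assoc)
    also have "\<dots> = fscale ((\<Sum>j\<le>n. of_nat (n choose j) * h ^ j * z ^ (n - j)) / fact n) (mcontr n a b)"
      by (simp add: sum_divide_distrib fs.scale_sum_left)
    also have "(\<Sum>j\<le>n. of_nat (n choose j) * h ^ j * z ^ (n - j)) = (z + h) ^ n"
      by (simp add: binomial_ring[of h z n] add.commute)
    finally show "(\<Sum>j\<le>n. T j (n - j)) = fscale ((z + h) ^ n / fact n) (mcontr n a b)" .
  qed
  finally show ?thesis using sprod_eq[OF K, where z = "z + h"] by simp
qed

lemma mcontr_in_sym: "a \<in> sym_algebra \<Longrightarrow> b \<in> sym_algebra \<Longrightarrow> mcontr k a b \<in> sym_algebra"
  unfolding mcontr_def by (intro mult_in_sym Pc_funpow_in_sym_pairs tensor_prod_in_sym_pairs)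

lemma taylor_in_sym: "a \<in> sym_algebra \<Longrightarrow> b \<in> sym_algebra \<Longrightarrow> taylor j z a b \<in> sym_algebra"
  unfolding taylor_def by (intro sym_sum sym_scale mcontr_in_sym)

lemma taylor_bilinear:
  assumes "a \<in> tensors" "a' \<in> tensors" "b \<in> tensors"
  shows "taylor j z (a + a') b = taylor j z a b + taylor j z a' b"
    "taylor j z b (a + a') = taylor j z b a + taylor j z b a'"
    "taylor j z (fscale c a) b = fscale c (taylor j z a b)"
    "taylor j z b (fscale c a) = fscale c (taylor j z b a)"
proof -
  have "\<exists>K. \<forall>k\<ge>K. (Pc ^^ k) (s \<otimes> t) = 0" if "s \<in> tensors" "t \<in> tensors" for s t
    using Pc_nilpotent[OF tensor_prod_in_pairs[OF that]] by metis
  then obtain K where K: "\<And>s t k. s \<in> tensors \<Longrightarrow> t \<in> tensors \<Longrightarrow> k \<ge> K s t \<Longrightarrow> (Pc ^^ k) (s \<otimes> t) = 0"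
    by metis
  have eq: "taylor j z s t = (\<Sum>k<M. fscale (of_nat (k + j choose j) * z ^ k / fact (k + j)) (mcontr (k + j) s t))"
    if "s \<in> tensors" "t \<in> tensors" "M \<ge> K s t" for s t M
    by (rule taylor_eq) (use K that in auto)
  note mc = fbilinear_add[OF fbilinear_mcontr] fbilinear_scale[OF fbilinear_mcontr]
  define M where "M = K a b + K a' b + K (a + a') b + K b a + K b a' + K b (a + a') + K (fscale c a) b + K b (fscale c a)"
  have M: "M \<ge> K a b" "M \<ge> K a' b" "M \<ge> K (a + a') b" "M \<ge> K b a" "M \<ge> K b a'" "M \<ge> K b (a + a')"
    "M \<ge> K (fscale c a) b" "M \<ge> K b (fscale c a)"
    unfolding M_def by simp_all
  note eqs = eq[OF assms(1,3) M(1)] eq[OF assms(2,3) M(2)] eq[OF tensors_add[OF assms(1,2)] assms(3) M(3)]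
    eq[OF assms(3,1) M(4)] eq[OF assms(3,2) M(5)] eq[OF assms(3) tensors_add[OF assms(1,2)] M(6)]
    eq[OF tensors_scale[OF assms(1)] assms(3) M(7)] eq[OF assms(3) tensors_scale[OF assms(1)] M(8)]
  show "taylor j z (a + a') b = taylor j z a b + taylor j z a' b"
    "taylor j z b (a + a') = taylor j z b a + taylor j z b a'"
    "taylor j z (fscale c a) b = fscale c (taylor j z a b)"
    "taylor j z b (fscale c a) = fscale c (taylor j z b a)"
    unfolding eqs by (simp_all add: mc fs.scale_right_distrib sum.distrib fs.scale_sum_right mult_ac)
qed

section \<open>Geometric bounds for Taylor coefficients and remainders\<close>

context
  fixes R :: real
  assumes R: "R \<ge> 1 / 2" and cont: "continuous_on UNIV (\<lambda>(v, w). \<Lambda> v w)"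
begin

text \<open>As \<open>\<rho>\<close> is arbitrary, the coefficients decay faster than any geometric
  sequence, which amounts to an infinite radius of convergence. The seminorm \<open>q\<close>
  depends on \<open>z\<close> and \<open>\<rho>\<close>, but not on \<open>j\<close>,
  \<open>a\<close> or \<open>b\<close>.\<close>

lemma taylor_estimate:
  assumes p: "seminorm scale p" "continuous_on UNIV p" and \<rho>: "\<rho> \<ge> 0"
  obtains q where "seminorm scale q" "continuous_on UNIV q"
    "\<And>j a b. a \<in> tensors \<Longrightarrow> b \<in> tensors \<Longrightarrow> weyl_seminorm R p (taylor j z a b) \<le>
      2 * (1 / (2 * (\<rho> + 1))) ^ j * (weyl_seminorm R q a * weyl_seminorm R q b)"
proof -
  \<comment> \<open>The binomial coefficient costs a factor 2 for each of the \<open>k + j\<close>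
    steps. The choice of \<open>r\<close> makes \<open>2 * norm z / r\<close> at most 1/2, for the
    sum over \<open>k\<close>, and \<open>2 / r\<close> at most
    \<open>1 / (2 * (\<rho> + 1))\<close>, for the decay in \<open>j\<close>.\<close>
  define r where "r = 4 * (norm z + \<rho> + 1)"
  have r: "r > 0" "r \<ge> 4 * norm z" "r \<ge> 4 * (\<rho> + 1)"
  proof -
    have "norm z + (\<rho> + 1) > 0" by (rule add_nonneg_pos[OF norm_ge_zero add_nonneg_pos[OF \<rho> zero_less_one]])
    then show "r > 0" by (simp add: r_def add.assoc)
    have "norm z \<le> norm z + (\<rho> + 1)" using \<rho> by simp
    then show "r \<ge> 4 * norm z" by (simp add: r_def add.assoc)
    have "\<rho> + 1 \<le> norm z + (\<rho> + 1)" by simp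
    then show "r \<ge> 4 * (\<rho> + 1)" by (simp add: r_def add.assoc)
  qed
  obtain q where q: "seminorm scale q" "continuous_on UNIV q"
    "\<And>k a b. a \<in> tensors \<Longrightarrow> b \<in> tensors \<Longrightarrow>
      r ^ k * weyl_seminorm R p (mcontr k a b) \<le> fact k * (weyl_seminorm R q a * weyl_seminorm R q b)"
    using mcontr_estimate[OF R cont p less_imp_le[OF r(1)]] by blast
  show thesis
  proof
    fix j a b assume a: "a \<in> tensors" and b: "b \<in> tensors"
    define Q where "Q = weyl_seminorm R q a * weyl_seminorm R q b"
    have Q: "Q \<ge> 0" unfolding Q_def using weyl_seminorm_nonneg[OF q(1)] a b by simp
    obtain K where K: "\<And>k. k \<ge> K \<Longrightarrow> (Pc ^^ k) (a \<otimes> b) = 0"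
      using Pc_nilpotent[OF tensor_prod_in_pairs[OF a b]] by blast
    have bnd: "weyl_seminorm R p (fscale (of_nat (k + j choose j) * z ^ k / fact (k + j)) (mcontr (k + j) a b)) \<le>
        (1 / 2) ^ k * ((1 / (2 * (\<rho> + 1))) ^ j * Q)" for k
    proof -
      let ?w = "weyl_seminorm R p (mcontr (k + j) a b)"
      have w: "?w \<ge> 0" by (intro weyl_seminorm_nonneg p mcontr_in_tensors a b)
      have "?w \<le> fact (k + j) * Q / r ^ (k + j)"
        using q(3)[OF a b, of "k + j"] r(1) unfolding Q_def by (simp add: pos_le_divide_eq mult.commute)
      then have w': "?w / fact (k + j) \<le> Q / r ^ (k + j)" by (simp add: field_simps)
      have ch: "real (k + j choose j) \<le> 2 ^ (k + j)"
        by (metis binomial_le_pow2 of_nat_le_iff of_nat_numeral of_nat_power)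
      have "weyl_seminorm R p (fscale (of_nat (k + j choose j) * z ^ k / fact (k + j)) (mcontr (k + j) a b)) \<le>
          norm (of_nat (k + j choose j) * z ^ k / fact (k + j)) * ?w"
        by (intro weyl_seminorm_scale p mcontr_in_tensors a b)
      also have "\<dots> = real (k + j choose j) * norm z ^ k * (?w / fact (k + j))"
        by (simp add: norm_mult norm_divide norm_power)
      also have "\<dots> \<le> 2 ^ (k + j) * norm z ^ k * (Q / r ^ (k + j))"
        using w by (intro mult_mono ch w' mult_nonneg_nonneg) auto
      also have "\<dots> = (2 * norm z / r) ^ k * ((2 / r) ^ j * Q)"
        by (simp add: power_add power_mult_distrib power_divide field_simps)
      also have "\<dots> \<le> (1 / 2) ^ k * ((1 / (2 * (\<rho> + 1))) ^ j * Q)"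
        using r Q \<rho> by (intro mult_mono power_mono mult_nonneg_nonneg) (auto simp: field_simps)
      finally show ?thesis .
    qed
    have "weyl_seminorm R p (taylor j z a b) =
        weyl_seminorm R p (\<Sum>k<K. fscale (of_nat (k + j choose j) * z ^ k / fact (k + j)) (mcontr (k + j) a b))"
      using taylor_eq[of K a b j z] K by simp
    also have "\<dots> \<le> (\<Sum>k<K. weyl_seminorm R p (fscale (of_nat (k + j choose j) * z ^ k / fact (k + j)) (mcontr (k + j) a b)))"
      by (rule weyl_seminorm_sum[OF p(1)]) (auto intro: tensors_scale mcontr_in_tensors a b)
    also have "\<dots> \<le> (\<Sum>k<K. (1 / 2) ^ k * ((1 / (2 * (\<rho> + 1))) ^ j * Q))"
      by (rule sum_mono) (rule bnd)
    also have "\<dots> = (\<Sum>k<K. (1 / 2) ^ k) * ((1 / (2 * (\<rho> + 1))) ^ j * Q)"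
      by (simp add: sum_distrib_right)
    also have "\<dots> \<le> 2 * ((1 / (2 * (\<rho> + 1))) ^ j * Q)"
      using sum_half_powers[of 0 K] Q \<rho> by (intro mult_right_mono) (auto simp: atLeast0LessThan)
    finally show "weyl_seminorm R p (taylor j z a b) \<le> 2 * (1 / (2 * (\<rho> + 1))) ^ j *
        (weyl_seminorm R q a * weyl_seminorm R q b)" by (simp add: Q_def mult.assoc)
  qed (rule q)+
qed

lemma taylor_in_tensors: "a \<in> tensors \<Longrightarrow> b \<in> tensors \<Longrightarrow> taylor j z a b \<in> tensors"
  unfolding taylor_def by (intro tensors_sum tensors_scale mcontr_in_tensors)

text \<open>With \<open>\<rho> = norm h\<close> the \<open>j\<close>-th term is bounded by a
  multiple of the \<open>j\<close>-th power of 1/2. Here \<open>q\<close> may depend on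
  \<open>h\<close>, since the series is summed for one \<open>h\<close> at a time.\<close>

lemma taylor_tail_estimate:
  assumes p: "seminorm scale p" "continuous_on UNIV p"
  obtains q where "seminorm scale q" "continuous_on UNIV q"
    "\<And>n a b. a \<in> tensors \<Longrightarrow> b \<in> tensors \<Longrightarrow>
      weyl_seminorm R p (sprod (z + h) a b - (\<Sum>j<n. fscale (h ^ j) (taylor j z a b))) \<le>
      4 * (1 / 2) ^ n * (weyl_seminorm R q a * weyl_seminorm R q b)"
proof -
  obtain q where q: "seminorm scale q" "continuous_on UNIV q"
    "\<And>j a b. a \<in> tensors \<Longrightarrow> b \<in> tensors \<Longrightarrow> weyl_seminorm R p (taylor j z a b) \<le>
      2 * (1 / (2 * (norm h + 1))) ^ j * (weyl_seminorm R q a * weyl_seminorm R q b)"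
    using taylor_estimate[OF p norm_ge_zero[of h]] by metis
  show thesis
  proof
    fix n a b assume a: "a \<in> tensors" and b: "b \<in> tensors"
    define Q where "Q = weyl_seminorm R q a * weyl_seminorm R q b"
    have Q: "Q \<ge> 0" unfolding Q_def using weyl_seminorm_nonneg[OF q(1)] a b by simp
    obtain K0 where K0: "\<And>k. k \<ge> K0 \<Longrightarrow> (Pc ^^ k) (a \<otimes> b) = 0"
      using Pc_nilpotent[OF tensor_prod_in_pairs[OF a b]] by blast
    \<comment> \<open>At least \<open>n\<close>, so that the finite expansion can be split at
      \<open>n\<close>.\<close>
    define K where "K = max K0 n"
    have K: "(Pc ^^ k) (a \<otimes> b) = 0" if "k \<ge> K" for k using K0 that by (simp add: K_def)
    let ?t = "\<lambda>j. fscale (h ^ j) (taylor j z a b)"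
    have "sprod (z + h) a b = (\<Sum>j<K. ?t j)" by (rule sprod_expansion) (rule K)
    also have "\<dots> = (\<Sum>j<n. ?t j) + (\<Sum>j\<in>{n..<K}. ?t j)"
    proof -
      have "{..<K} = {..<n} \<union> {n..<K}" by (auto simp: K_def)
      then show ?thesis by (simp add: sum.union_disjoint ivl_disj_int)
    qed
    finally have eq: "sprod (z + h) a b - (\<Sum>j<n. ?t j) = (\<Sum>j\<in>{n..<K}. ?t j)" by simp
    have "weyl_seminorm R p (?t j) \<le> (1 / 2) ^ j * (2 * Q)" for j
    proof -
      have "weyl_seminorm R p (?t j) \<le> norm (h ^ j) * weyl_seminorm R p (taylor j z a b)"
        by (intro weyl_seminorm_scale p taylor_in_tensors a b)
      also have "\<dots> \<le> norm (h ^ j) * (2 * (1 / (2 * (norm h + 1))) ^ j * Q)"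
        using q(3)[OF a b] by (intro mult_left_mono) (auto simp: Q_def)
      also have "\<dots> = (norm h * (1 / (2 * (norm h + 1)))) ^ j * (2 * Q)"
        by (simp only: power_mult_distrib norm_power mult_ac)
      also have "\<dots> \<le> (1 / 2) ^ j * (2 * Q)"
      proof (intro mult_right_mono power_mono)
        have "norm h + 1 > 0" using norm_ge_zero[of h] by linarith
        then show "norm h * (1 / (2 * (norm h + 1))) \<le> 1 / 2" "0 \<le> norm h * (1 / (2 * (norm h + 1)))"
          by (simp_all add: field_simps)
      qed (use Q in simp)
      finally show ?thesis .
    qed
    then have "weyl_seminorm R p (\<Sum>j\<in>{n..<K}. ?t j) \<le> (\<Sum>j\<in>{n..<K}. (1 / 2) ^ j * (2 * Q))"
      by (intro order_trans[OF weyl_seminorm_sum[OF p(1)] sum_mono])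
        (auto intro: tensors_scale taylor_in_tensors a b)
    also have "\<dots> = (\<Sum>j\<in>{n..<K}. (1 / 2) ^ j) * (2 * Q)" by (simp add: sum_distrib_right)
    also have "\<dots> \<le> (2 * (1 / 2) ^ n) * (2 * Q)" using Q by (intro mult_right_mono sum_half_powers) simp
    finally show "weyl_seminorm R p (sprod (z + h) a b - (\<Sum>j<n. ?t j)) \<le>
        4 * (1 / 2) ^ n * (weyl_seminorm R q a * weyl_seminorm R q b)"
      unfolding eq by (simp add: Q_def mult_ac)
  qed (rule q)+
qed

text \<open>In contrast to the tail estimate, \<open>q\<close> must not depend on \<open>h\<close>.
  \<open>\<rho> = 0\<close> gives coefficients bounded by multiples of powers of 1/2, which suffices
  for all \<open>h\<close> in the open unit ball.\<close>

lemma taylor_quotient_estimate: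
  assumes p: "seminorm scale p" "continuous_on UNIV p"
  obtains q where "seminorm scale q" "continuous_on UNIV q"
    "\<And>h a b. h \<noteq> 0 \<Longrightarrow> norm h < 1 \<Longrightarrow> a \<in> tensors \<Longrightarrow> b \<in> tensors \<Longrightarrow>
      weyl_seminorm R p (taylor 1 z a b - (fscale (1 / h) (sprod (z + h) a b) + fscale (- (1 / h)) (sprod z a b))) \<le>
      2 * norm h * (weyl_seminorm R q a * weyl_seminorm R q b)"
proof -
  obtain q where q: "seminorm scale q" "continuous_on UNIV q"
    "\<And>j a b. a \<in> tensors \<Longrightarrow> b \<in> tensors \<Longrightarrow> weyl_seminorm R p (taylor j z a b) \<le>
      2 * (1 / (2 * (0 + 1))) ^ j * (weyl_seminorm R q a * weyl_seminorm R q b)"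
    using taylor_estimate[OF p, of 0] by (metis order_refl)
  show thesis
  proof
    fix h :: 'k and a b assume h: "h \<noteq> 0" "norm h < 1" and a: "a \<in> tensors" and b: "b \<in> tensors"
    define Q where "Q = weyl_seminorm R q a * weyl_seminorm R q b"
    have Q: "Q \<ge> 0" unfolding Q_def using weyl_seminorm_nonneg[OF q(1)] a b by simp
    obtain K0 where K0: "\<And>k. k \<ge> K0 \<Longrightarrow> (Pc ^^ k) (a \<otimes> b) = 0"
      using Pc_nilpotent[OF tensor_prod_in_pairs[OF a b]] by blast
    \<comment> \<open>The shift by two makes room for splitting off the terms of order 0 and
      1.\<close>
    have K: "(Pc ^^ k) (a \<otimes> b) = 0" if "k \<ge> Suc (Suc K0)" for k using K0 that by simp
    have "sprod (z + h) a b = (\<Sum>j<Suc (Suc K0). fscale (h ^ j) (taylor j z a b))"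
      by (rule sprod_expansion) (rule K)
    also have "\<dots> = sprod z a b + (fscale h (taylor 1 z a b) + (\<Sum>j<K0. fscale (h ^ Suc (Suc j)) (taylor (Suc (Suc j)) z a b)))"
      by (simp only: sum.lessThan_Suc_shift power_0 fs.scale_one taylor_0[OF a b] power_one_right One_nat_def power_Suc mult_1_right)
    finally have e: "sprod (z + h) a b = sprod z a b +
      (fscale h (taylor 1 z a b) + (\<Sum>j<K0. fscale (h ^ Suc (Suc j)) (taylor (Suc (Suc j)) z a b)))" .
    let ?t = "\<lambda>j. fscale (- (h ^ Suc j)) (taylor (Suc (Suc j)) z a b)"
    have "fscale (1 / h) (sprod (z + h) a b) + fscale (- (1 / h)) (sprod z a b) =
        taylor 1 z a b - (\<Sum>j<K0. ?t j)"
      unfolding e using h(1)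
      by (simp add: fs.scale_right_distrib fs.scale_minus_left fs.scale_sum_right sum_negf)
    then have eq: "taylor 1 z a b - (fscale (1 / h) (sprod (z + h) a b) + fscale (- (1 / h)) (sprod z a b)) =
        (\<Sum>j<K0. ?t j)" by simp
    have bd: "weyl_seminorm R p (?t j) \<le> (1 / 2) ^ j * (norm h * Q)" for j
    proof -
      have "weyl_seminorm R p (?t j) \<le> norm (- (h ^ Suc j)) * weyl_seminorm R p (taylor (Suc (Suc j)) z a b)"
        by (intro weyl_seminorm_scale p taylor_in_tensors a b)
      also have "\<dots> \<le> norm h * (2 * (1 / 2) ^ Suc (Suc j) * Q)"
      proof (rule mult_mono)
        have "norm h ^ j \<le> 1" using h by (intro power_le_one) auto
        then have "norm h * norm h ^ j \<le> norm h * 1" by (intro mult_left_mono) auto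
        then show "norm (- (h ^ Suc j)) \<le> norm h" by (simp add: norm_power norm_mult)
        show "weyl_seminorm R p (taylor (Suc (Suc j)) z a b) \<le> 2 * (1 / 2) ^ Suc (Suc j) * Q"
          using q(3)[OF a b, of "Suc (Suc j)"] by (simp add: Q_def)
      qed (use weyl_seminorm_nonneg[OF p(1) taylor_in_tensors[OF a b]] in auto)
      also have "\<dots> \<le> (1 / 2) ^ j * (norm h * Q)" using Q by (simp add: mult_left_mono)
      finally show ?thesis .
    qed
    have "weyl_seminorm R p (\<Sum>j<K0. ?t j) \<le> (\<Sum>j<K0. weyl_seminorm R p (?t j))"
      by (intro weyl_seminorm_sum[OF p(1)] finite_lessThan tensors_scale taylor_in_tensors a b)
    also have "\<dots> \<le> (\<Sum>j<K0. (1 / 2) ^ j * (norm h * Q))" by (rule sum_mono) (rule bd)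
    also have "\<dots> = (\<Sum>j<K0. (1 / 2) ^ j) * (norm h * Q)" by (simp add: sum_distrib_right)
    also have "\<dots> \<le> 2 * (norm h * Q)"
      using sum_half_powers[of 0 K0] Q by (intro mult_right_mono) (auto simp: atLeast0LessThan)
    finally show "weyl_seminorm R p (taylor 1 z a b - (fscale (1 / h) (sprod (z + h) a b) + fscale (- (1 / h)) (sprod z a b))) \<le>
        2 * norm h * (weyl_seminorm R q a * weyl_seminorm R q b)"
      unfolding eq by (simp add: Q_def mult_ac)
  qed (rule q)+
qed

end

section \<open>The Weyl topology and its completion\<close>

definition weyl_seminorms :: "real \<Rightarrow> (('k, 'v) tensor \<Rightarrow> real) set" where
  "weyl_seminorms R = {weyl_seminorm R p | p. seminorm scale p \<and> continuous_on UNIV p}"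

lemma openin_weyl_ball:
  assumes p: "seminorm scale p" "continuous_on UNIV p" and x: "x \<in> sym_algebra" and e: "e > 0"
  shows "openin (weyl_topology R) {y \<in> sym_algebra. weyl_seminorm R p (y - x) < e}"
  unfolding weyl_topology_def by (rule topology_generated_by_Basis) (use assms in blast)

lemma topspace_weyl_topology: "topspace (weyl_topology R) = sym_algebra"
proof
  show "topspace (weyl_topology R) \<subseteq> sym_algebra"
    unfolding weyl_topology_def topology_generated_by_topspace by blast
  show "sym_algebra \<subseteq> topspace (weyl_topology R)"
  proof
    fix x :: "('k, 'v) tensor" assume x: "x \<in> sym_algebra"
    have "x \<in> {y \<in> sym_algebra. weyl_seminorm R (\<lambda>_. 0) (y - x) < 1}"
      using x by (simp add: weyl_seminorm_zero)
    moreover have "{y \<in> sym_algebra. weyl_seminorm R (\<lambda>_. 0) (y - x) < 1} \<subseteq> topspace (weyl_topology R)"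
      by (intro openin_subset openin_weyl_ball x) (simp_all add: seminorm_def)
    ultimately show "x \<in> topspace (weyl_topology R)" by blast
  qed
qed

text \<open>Balls with arbitrary centres only generate the topology. The triangle inequality
  recentres a ball at \<open>x\<close>, and for intersections the seminorm \<open>p + q\<close>
  dominates both given ones.\<close>

lemma openin_weyl_topologyD:
  assumes "openin (weyl_topology R) A" and "x \<in> A"
  shows "\<exists>p e. seminorm scale p \<and> continuous_on UNIV p \<and> e > 0 \<and>
    {y \<in> sym_algebra. weyl_seminorm R p (y - x) < e} \<subseteq> A"
proof -
  have "generate_topology_on {{y \<in> sym_algebra. weyl_seminorm R p (y - x) < e} | p x e.
          seminorm scale p \<and> continuous_on UNIV p \<and> x \<in> sym_algebra \<and> e > 0} A"
    using assms(1) unfolding weyl_topology_def openin_topology_generated_by_iff .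
  then show ?thesis using assms(2)
  proof (induction arbitrary: x rule: generate_topology_on.induct)
    case Empty
    then show ?case by simp
  next
    case (UN K)
    then obtain k where k: "k \<in> K" "x \<in> k" by blast
    from UN.IH[OF this] show ?case using k(1) by (meson Union_upper order_trans)
  next
    case (Int A B)
    then have xA: "x \<in> A" and xB: "x \<in> B" by auto
    obtain p d where p: "seminorm scale p" "continuous_on UNIV p" "d > 0"
      "{y \<in> sym_algebra. weyl_seminorm R p (y - x) < d} \<subseteq> A" using Int.IH(1)[OF xA] by blast
    obtain q e where q: "seminorm scale q" "continuous_on UNIV q" "e > 0"
      "{y \<in> sym_algebra. weyl_seminorm R q (y - x) < e} \<subseteq> B" using Int.IH(2)[OF xB] by blast
    have "openin (weyl_topology R) A"
      using Int.hyps(1) unfolding weyl_topology_def openin_topology_generated_by_iff .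
    from openin_subset[OF this] have x: "x \<in> sym_algebra"
      using xA unfolding topspace_weyl_topology by (rule subsetD)
    let ?r = "\<lambda>v. p v + q v"
    have r: "seminorm scale ?r" by (rule seminorm_plus[OF p(1) q(1)])
    have rc: "continuous_on UNIV ?r" by (intro continuous_intros p q)
    have "y \<in> A \<inter> B" if y: "y \<in> sym_algebra" "weyl_seminorm R ?r (y - x) < min d e" for y
    proof -
      have yx: "y - x \<in> tensors" by (intro sym_in_tensors sym_diff y x)
      have "weyl_seminorm R p (y - x) \<le> weyl_seminorm R ?r (y - x)"
        by (rule weyl_seminorm_mono[OF p(1) r _ yx]) (simp add: seminorm_nonneg[OF q(1)])
      moreover have "weyl_seminorm R q (y - x) \<le> weyl_seminorm R ?r (y - x)"
        by (rule weyl_seminorm_mono[OF q(1) r _ yx]) (simp add: seminorm_nonneg[OF p(1)])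
      ultimately show ?thesis using y p(4) q(4) by auto
    qed
    then show ?case using r rc p(3) q(3) by (intro exI[of _ ?r] exI[of _ "min d e"]) auto
  next
    case (Basis A)
    then obtain p x0 e where p: "seminorm scale p" "continuous_on UNIV p" and x0: "x0 \<in> sym_algebra"
      and A: "A = {y \<in> sym_algebra. weyl_seminorm R p (y - x0) < e}" by blast
    have x: "x \<in> sym_algebra" "weyl_seminorm R p (x - x0) < e" using Basis.prems A by auto
    have "y \<in> A" if y: "y \<in> sym_algebra" "weyl_seminorm R p (y - x) < e - weyl_seminorm R p (x - x0)" for y
    proof -
      have "weyl_seminorm R p ((y - x) + (x - x0)) \<le> weyl_seminorm R p (y - x) + weyl_seminorm R p (x - x0)"
        by (intro weyl_seminorm_add p sym_in_tensors sym_diff y x x0)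
      then show ?thesis using y unfolding A by simp
    qed
    then show ?case using p x
      by (intro exI[of _ p] exI[of _ "e - weyl_seminorm R p (x - x0)"]) auto
  qed
qed

text \<open>\<open>nhd1\<close> is continuity of \<open>\<iota>\<close> at 0. \<open>nhd2\<close>
  combines openness of \<open>\<iota>\<close> onto its image with injectivity, which recovers
  \<open>x\<close> from \<open>\<iota> x\<close>.\<close>

lemma dense_completion_weyl:
  assumes "weyl_completion R scaleW \<iota>"
  shows "dense_completion sym_algebra fscale (weyl_seminorms R) scaleW \<iota>"
proof -
  note W = assms[unfolded weyl_completion_def]
  have add: "\<iota> (x + y) = \<iota> x + \<iota> y" if "x \<in> sym_algebra" "y \<in> sym_algebra" for x y using W that by blast
  have scale: "\<iota> (fscale c x) = scaleW c (\<iota> x)" if "x \<in> sym_algebra" for c x using W that by blast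
  have zero: "\<iota> 0 = 0" using add[OF sym_zero sym_zero] by simp
  have emb: "embedding_map (weyl_topology R) euclidean \<iota>" using W by blast
  then have hom: "homeomorphic_map (weyl_topology R) (subtopology euclidean (\<iota> ` sym_algebra)) \<iota>"
    by (simp add: embedding_map_def topspace_weyl_topology)
  have inj: "inj_on \<iota> sym_algebra"
    using homeomorphic_imp_injective_map[OF hom] by (simp add: topspace_weyl_topology)
  have cts: "continuous_map (weyl_topology R) euclidean \<iota>"
    using homeomorphic_imp_continuous_map[OF hom] by (rule continuous_map_into_fulltopology)
  have opn: "open_map (weyl_topology R) (subtopology euclidean (\<iota> ` sym_algebra)) \<iota>"
    by (rule homeomorphic_imp_open_map[OF hom])
  have sc: "weyl_seminorm R p (fscale c x) \<le> norm c * weyl_seminorm R p x"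
    if "seminorm scale p" "x \<in> sym_algebra" for p c x
    by (rule weyl_seminorm_scale[OF that(1) sym_in_tensors[OF that(2)]])
  have minus: "weyl_seminorm R p (x - y) \<le> weyl_seminorm R p (y - x)"
    if "seminorm scale p" "x \<in> sym_algebra" "y \<in> sym_algebra" for p x y
  proof -
    have "fscale (- 1) (y - x) = x - y" by (simp add: fs.scale_minus_left)
    then show ?thesis using sc[OF that(1) sym_diff[OF that(3,2)], of "- 1"] by simp
  qed
  have nhd1: "\<exists>p\<in>weyl_seminorms R. \<exists>e>0. \<forall>x\<in>sym_algebra. p x < e \<longrightarrow> \<iota> x \<in> U" if U: "open U" "0 \<in> U" for U
  proof -
    have "openin (weyl_topology R) {x \<in> sym_algebra. \<iota> x \<in> U}"
      using openin_continuous_map_preimage[OF cts, of U] U by (simp add: topspace_weyl_topology)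
    moreover have "0 \<in> {x \<in> sym_algebra. \<iota> x \<in> U}" using zero U sym_zero by simp
    ultimately obtain p e where p: "seminorm scale p" "continuous_on UNIV p" "e > 0"
      "{y \<in> sym_algebra. weyl_seminorm R p (y - 0) < e} \<subseteq> {x \<in> sym_algebra. \<iota> x \<in> U}"
      using openin_weyl_topologyD by blast
    then show ?thesis
      by (intro bexI[of _ "weyl_seminorm R p"] exI[of _ e]) (auto simp: weyl_seminorms_def)
  qed
  have nhd2: "\<exists>U. open U \<and> 0 \<in> U \<and> (\<forall>x\<in>sym_algebra. \<iota> x \<in> U \<longrightarrow> p x < e)"
    if "p \<in> weyl_seminorms R" and e: "e > 0" for p e
  proof -
    obtain p' where p': "seminorm scale p'" "continuous_on UNIV p'" "p = weyl_seminorm R p'"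
      using \<open>p \<in> _\<close> unfolding weyl_seminorms_def by blast
    let ?B = "{y \<in> sym_algebra. weyl_seminorm R p' (y - 0) < e}"
    have "openin (subtopology euclidean (\<iota> ` sym_algebra)) (\<iota> ` ?B)"
      using opn openin_weyl_ball[OF p'(1,2) sym_zero e] unfolding open_map_def by blast
    then obtain U where U: "open U" "\<iota> ` ?B = U \<inter> \<iota> ` sym_algebra"
      unfolding openin_subtopology by auto
    have "0 \<in> ?B" using sym_zero e by (simp add: weyl_seminorm_zero)
    then have "\<iota> 0 \<in> \<iota> ` ?B" by (rule imageI)
    then have "0 \<in> U" using U(2) zero by auto
    moreover have "p x < e" if x: "x \<in> sym_algebra" "\<iota> x \<in> U" for x
    proof -
      have "\<iota> x \<in> \<iota> ` ?B" using x U(2) by blast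
      then obtain y where y: "y \<in> ?B" "\<iota> x = \<iota> y" by blast
      then have "x = y" using inj x(1) by (auto dest: inj_onD)
      then show ?thesis using y(1) p'(3) by simp
    qed
    ultimately show ?thesis using U(1) by blast
  qed
  show ?thesis
    apply (rule dense_completion.intro)
    subgoal by (rule sym_add)
    subgoal by (rule sym_diff)
    subgoal by (rule sym_scale)
    subgoal by (rule sym_zero)
    subgoal unfolding weyl_seminorms_def by (auto intro: weyl_seminorm_add sym_in_tensors)
    subgoal unfolding weyl_seminorms_def by (auto intro: sc)
    subgoal unfolding weyl_seminorms_def by (auto intro: weyl_seminorm_nonneg sym_in_tensors)
    subgoal unfolding weyl_seminorms_def by (auto intro: antisym minus)
    subgoal by (rule add)
    subgoal by (rule scale)
    subgoal using W by blast
    subgoal using W by blast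
    subgoal using W by blast
    subgoal by (rule nhd1)
    subgoal by (rule nhd2)
    subgoal using W by blast
    done
qed

lemma extension_eq:
  assumes "dense_completion sym_algebra fscale PP scaleW \<iota>"
  shows "extension \<iota> B = dense_completion.ext sym_algebra \<iota> B"
  unfolding extension_def dense_completion.ext_def[OF assms] ..

section \<open>The star product on the completion\<close>

context
  fixes R :: real and scaleW :: "'k \<Rightarrow> 'w::{uniform_space, topological_ab_group_add, t2_space} \<Rightarrow> 'w" and \<iota>
  assumes R: "R \<ge> 1 / 2" and cont: "continuous_on UNIV (\<lambda>(v, w). \<Lambda> v w)"
    and completion: "weyl_completion R scaleW \<iota>"
begin

interpretation dc: dense_completion sym_algebra fscale "weyl_seminorms R" scaleW \<iota>
  by (rule dense_completion_weyl[OF completion])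

lemma extension_ext: "extension \<iota> B = dc.ext B"
  by (rule extension_eq) (rule dense_completion_weyl[OF completion])

lemma bounded_op_fscale:
  assumes B: "dc.bounded_op B"
  shows "dc.bounded_op (\<lambda>a b. fscale c (B a b))"
proof (rule dc.bounded_opI)
  fix x y assume x: "x \<in> sym_algebra" and y: "y \<in> sym_algebra"
  show "fscale c (B x y) \<in> sym_algebra" by (intro sym_scale dc.bounded_op_in[OF B] x y)
  show "fscale c (B (fscale d x) y) = fscale d (fscale c (B x y))"
    "fscale c (B x (fscale d y)) = fscale d (fscale c (B x y))" for d
    unfolding dc.bounded_op_scale[OF B x y] by (simp_all add: mult.commute)
  fix z assume z: "z \<in> sym_algebra"
  show "fscale c (B (x + y) z) = fscale c (B x z) + fscale c (B y z)"
    "fscale c (B z (x + y)) = fscale c (B z x) + fscale c (B z y)"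
    unfolding dc.bounded_op_add[OF B x y z] by (rule fs.scale_right_distrib)+
next
  fix p assume p: "p \<in> weyl_seminorms R"
  obtain q C where q: "q \<in> weyl_seminorms R" "C \<ge> 0"
    "\<And>x y. x \<in> sym_algebra \<Longrightarrow> y \<in> sym_algebra \<Longrightarrow> p (B x y) \<le> C * (q x * q y)"
    using dc.bounded_op_bound[OF B p] by blast
  have "p (fscale c (B x y)) \<le> (norm c * C) * (q x * q y)"
    if "x \<in> sym_algebra" "y \<in> sym_algebra" for x y
  proof -
    have "p (fscale c (B x y)) \<le> norm c * p (B x y)"
      by (rule dc.p_scale[OF p dc.bounded_op_in[OF B that]])
    also have "\<dots> \<le> norm c * (C * (q x * q y))" by (rule mult_left_mono[OF q(3)[OF that] norm_ge_zero])
    finally show ?thesis by (simp only: mult.assoc)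
  qed
  then show "\<exists>q\<in>weyl_seminorms R. \<exists>C\<ge>0. \<forall>x\<in>sym_algebra. \<forall>y\<in>sym_algebra. p (fscale c (B x y)) \<le> C * (q x * q y)"
    using q(1,2) by (intro bexI[of _ q] exI[of _ "norm c * C"]) auto
qed

lemma bounded_op_taylor: "dc.bounded_op (taylor j z)"
proof (rule dc.bounded_opI)
  fix x y assume x: "x \<in> sym_algebra" and y: "y \<in> sym_algebra"
  note t = sym_in_tensors[OF x] sym_in_tensors[OF y]
  show "taylor j z x y \<in> sym_algebra" by (rule taylor_in_sym[OF x y])
  show "taylor j z (fscale c x) y = fscale c (taylor j z x y)" for c
    by (rule taylor_bilinear(3)[OF t(1) t(1) t(2)])
  show "taylor j z x (fscale c y) = fscale c (taylor j z x y)" for c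
    by (rule taylor_bilinear(4)[OF t(2) t(2) t(1)])
  fix w assume w: "w \<in> sym_algebra"
  show "taylor j z (x + y) w = taylor j z x w + taylor j z y w"
    "taylor j z w (x + y) = taylor j z w x + taylor j z w y"
    by (rule taylor_bilinear(1,2)[OF t sym_in_tensors[OF w]])+
next
  fix p assume "p \<in> weyl_seminorms R"
  then obtain p' where p: "seminorm scale p'" "continuous_on UNIV p'" "p = weyl_seminorm R p'"
    unfolding weyl_seminorms_def by blast
  obtain q where q: "seminorm scale q" "continuous_on UNIV q"
    "\<And>j a b. a \<in> tensors \<Longrightarrow> b \<in> tensors \<Longrightarrow> weyl_seminorm R p' (taylor j z a b) \<le>
      2 * (1 / (2 * (0 + 1))) ^ j * (weyl_seminorm R q a * weyl_seminorm R q b)"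
    using taylor_estimate[OF R cont p(1,2) order_refl] by blast
  show "\<exists>q\<in>weyl_seminorms R. \<exists>C\<ge>0. \<forall>x\<in>sym_algebra. \<forall>y\<in>sym_algebra. p (taylor j z x y) \<le> C * (q x * q y)"
    unfolding p(3)
  proof (intro bexI[of _ "weyl_seminorm R q"] exI[of _ "2 * (1 / (2 * (0 + 1))) ^ j"] conjI ballI)
    show "weyl_seminorm R q \<in> weyl_seminorms R" using q(1,2) unfolding weyl_seminorms_def by blast
    fix x y assume x: "x \<in> sym_algebra" and y: "y \<in> sym_algebra"
    show "weyl_seminorm R p' (taylor j z x y) \<le> 2 * (1 / (2 * (0 + 1))) ^ j * (weyl_seminorm R q x * weyl_seminorm R q y)"
      by (rule q(3)[OF sym_in_tensors[OF x] sym_in_tensors[OF y]])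
  qed simp
qed

text \<open>The coefficients \<open>taylor\<close> contain both given families:
  \<open>star \<Lambda> z\<close> is the coefficient of order 0 at \<open>z\<close>, and
  \<open>mu_P \<Lambda> k\<close> is, up to \<open>fact k\<close>, the coefficient of order
  \<open>k\<close> at 0. One estimate therefore yields the boundedness of both.\<close>

lemma taylor_0_star: "a \<in> sym_algebra \<Longrightarrow> b \<in> sym_algebra \<Longrightarrow> taylor 0 z a b = star \<Lambda> z a b"
  by (simp only: taylor_0[OF sym_in_tensors sym_in_tensors] star_eq_sprod)

lemma taylor_at_0_mu_P:
  "a \<in> sym_algebra \<Longrightarrow> b \<in> sym_algebra \<Longrightarrow> taylor j 0 a b = fscale (1 / fact j) (mu_P \<Lambda> j a b)"
  by (simp only: taylor_at_0[OF sym_in_tensors sym_in_tensors] mu_P_eq mcontr_def)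

lemma bounded_op_star: "dc.bounded_op (star \<Lambda> z)"
  by (rule dc.bounded_op_cong[OF bounded_op_taylor[of 0 z] taylor_0_star])

lemma bounded_op_mu_P: "dc.bounded_op (mu_P \<Lambda> k)"
  by (rule dc.bounded_op_cong[OF bounded_op_fscale[OF bounded_op_taylor[of k 0], of "fact k"]])
    (simp add: taylor_at_0_mu_P)

lemma star_tail_bound:
  assumes "p \<in> weyl_seminorms R"
  shows "\<exists>q\<in>weyl_seminorms R. \<exists>C. \<forall>n. \<forall>x\<in>sym_algebra. \<forall>y\<in>sym_algebra.
    p (star \<Lambda> (z + h) x y - (\<Sum>j<n. fscale (h ^ j) (taylor j z x y))) \<le> C * (1 / 2) ^ n * (q x * q y)"
proof -
  obtain p' where p: "seminorm scale p'" "continuous_on UNIV p'" "p = weyl_seminorm R p'"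
    using assms unfolding weyl_seminorms_def by blast
  obtain q where q: "seminorm scale q" "continuous_on UNIV q"
    "\<And>n a b. a \<in> tensors \<Longrightarrow> b \<in> tensors \<Longrightarrow>
      weyl_seminorm R p' (sprod (z + h) a b - (\<Sum>j<n. fscale (h ^ j) (taylor j z a b))) \<le>
      4 * (1 / 2) ^ n * (weyl_seminorm R q a * weyl_seminorm R q b)"
    using taylor_tail_estimate[OF R cont p(1,2)] by blast
  show ?thesis
    unfolding p(3)
  proof (intro bexI[of _ "weyl_seminorm R q"] exI[of _ 4] allI ballI)
    show "weyl_seminorm R q \<in> weyl_seminorms R" using q(1,2) unfolding weyl_seminorms_def by blast
    fix n x y assume x: "x \<in> sym_algebra" and y: "y \<in> sym_algebra"
    show "weyl_seminorm R p' (star \<Lambda> (z + h) x y - (\<Sum>j<n. fscale (h ^ j) (taylor j z x y))) \<le>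
        4 * (1 / 2) ^ n * (weyl_seminorm R q x * weyl_seminorm R q y)"
      unfolding star_eq_sprod[OF x y] by (rule q(3)[OF sym_in_tensors[OF x] sym_in_tensors[OF y]])
  qed
qed

theorem star_power_series:
  "(\<lambda>k. scaleW (h ^ k) (extension \<iota> (taylor k z) a b)) sums extension \<iota> (star \<Lambda> (z + h)) a b"
  unfolding extension_ext by (rule dc.ext_sums[OF bounded_op_star bounded_op_taylor star_tail_bound])

theorem star_taylor_expansion:
  "(\<lambda>k. scaleW (z ^ k / fact k) (extension \<iota> (mu_P \<Lambda> k) a b)) sums extension \<iota> (star \<Lambda> z) a b"
  unfolding extension_ext
proof (rule dc.ext_sums[OF bounded_op_star bounded_op_mu_P])
  fix p assume p: "p \<in> weyl_seminorms R"
  have eq: "fscale (z ^ k / fact k) (mu_P \<Lambda> k x y) = fscale (z ^ k) (taylor k 0 x y)"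
    if "x \<in> sym_algebra" "y \<in> sym_algebra" for k x y
    by (simp add: taylor_at_0_mu_P[OF that])
  show "\<exists>q\<in>weyl_seminorms R. \<exists>C. \<forall>n. \<forall>x\<in>sym_algebra. \<forall>y\<in>sym_algebra.
    p (star \<Lambda> z x y - (\<Sum>k<n. fscale (z ^ k / fact k) (mu_P \<Lambda> k x y))) \<le> C * (1 / 2) ^ n * (q x * q y)"
    using star_tail_bound[OF p, of 0 z] by (simp only: eq add_0 cong: ball_cong)
qed

theorem star_difference_quotient:
  "((\<lambda>z. scaleW (1 / (z - z0)) (extension \<iota> (star \<Lambda> z) a b - extension \<iota> (star \<Lambda> z0) a b))
    \<longlongrightarrow> extension \<iota> (taylor 1 z0) a b) (at z0)"
  unfolding extension_ext
proof (rule dc.ext_difference_quotient[OF bounded_op_star bounded_op_taylor])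
  fix p assume "p \<in> weyl_seminorms R"
  then obtain p' where p: "seminorm scale p'" "continuous_on UNIV p'" "p = weyl_seminorm R p'"
    unfolding weyl_seminorms_def by blast
  obtain q where q: "seminorm scale q" "continuous_on UNIV q"
    "\<And>h a b. h \<noteq> 0 \<Longrightarrow> norm h < 1 \<Longrightarrow> a \<in> tensors \<Longrightarrow> b \<in> tensors \<Longrightarrow>
      weyl_seminorm R p' (taylor 1 z0 a b - (fscale (1 / h) (sprod (z0 + h) a b) + fscale (- (1 / h)) (sprod z0 a b))) \<le>
      2 * norm h * (weyl_seminorm R q a * weyl_seminorm R q b)"
    using taylor_quotient_estimate[OF R cont p(1,2)] by blast
  show "\<exists>q\<in>weyl_seminorms R. \<exists>C. \<forall>h. h \<noteq> 0 \<longrightarrow> norm h < 1 \<longrightarrow>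
    (\<forall>x\<in>sym_algebra. \<forall>y\<in>sym_algebra.
      p (taylor 1 z0 x y - (fscale (1 / h) (star \<Lambda> (z0 + h) x y) + fscale (- (1 / h)) (star \<Lambda> z0 x y)))
      \<le> C * norm h * (q x * q y))"
    unfolding p(3)
  proof (intro bexI[of _ "weyl_seminorm R q"] exI[of _ 2] allI ballI impI)
    show "weyl_seminorm R q \<in> weyl_seminorms R" using q(1,2) unfolding weyl_seminorms_def by blast
    fix h :: 'k and x y assume h: "h \<noteq> 0" "norm h < 1" and x: "x \<in> sym_algebra" and y: "y \<in> sym_algebra"
    show "weyl_seminorm R p' (taylor 1 z0 x y - (fscale (1 / h) (star \<Lambda> (z0 + h) x y) + fscale (- (1 / h)) (star \<Lambda> z0 x y)))
      \<le> 2 * norm h * (weyl_seminorm R q x * weyl_seminorm R q y)"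
      unfolding star_eq_sprod[OF x y] by (rule q(3)[OF h sym_in_tensors[OF x] sym_in_tensors[OF y]])
  qed
qed

lemma extension_star_bilinear: "bilinear_map scaleW scaleW scaleW (extension \<iota> (star \<Lambda> z))"
  unfolding extension_ext by (rule dc.ext_bilinear[OF bounded_op_star])

lemma continuous_extension_star: "continuous_on UNIV (\<lambda>(a, b). extension \<iota> (star \<Lambda> z) a b)"
  unfolding extension_ext by (rule dc.continuous_ext[OF bounded_op_star])

lemma extension_star_assoc:
  "extension \<iota> (star \<Lambda> z) (extension \<iota> (star \<Lambda> z) a b) c = extension \<iota> (star \<Lambda> z) a (extension \<iota> (star \<Lambda> z) b c)"
  unfolding extension_ext
proof (rule dc.ext_assoc[OF bounded_op_star])
  fix x y w assume x: "x \<in> sym_algebra" and y: "y \<in> sym_algebra" and w: "w \<in> sym_algebra"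
  show "star \<Lambda> z (star \<Lambda> z x y) w = star \<Lambda> z x (star \<Lambda> z y w)"
    unfolding star_eq_sprod[OF x y] star_eq_sprod[OF y w] star_eq_sprod[OF sprod_in_sym[OF x y] w]
      star_eq_sprod[OF x sprod_in_sym[OF y w]]
    by (rule sprod_assoc[OF x y w])
qed

text \<open>The extension depends on an operation only through its values on the symmetric algebra,
  and there only the term without contraction remains at parameter 0.\<close>

lemma extension_star_0: "extension \<iota> (star \<Lambda> 0) = extension \<iota> (\<lambda>a b. mu (a \<otimes> b))"
  unfolding extension_ext
proof (rule dc.ext_cong)
  fix a b assume "a \<in> sym_algebra" "b \<in> sym_algebra"
  then have "star \<Lambda> 0 a b = fscale (1 / fact 0) (mu_P \<Lambda> 0 a b)"
    by (simp only: taylor_0_star[symmetric] taylor_at_0_mu_P)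
  then show "star \<Lambda> 0 a b = mu (a \<otimes> b)" by (simp add: mu_P_def)
qed

end

end

theorem proposition3p22:
  fixes R :: real
  assumes "R \<ge> 1 / 2"
  shows
    "(\<forall>(scale :: real \<Rightarrow> 'v \<Rightarrow> 'v::{topological_ab_group_add, t2_space}) V0 V1 \<Lambda>
        (scaleW :: real \<Rightarrow> 'w \<Rightarrow> 'w::{uniform_space, topological_ab_group_add, t2_space}) \<iota>.
        graded_lcs scale V0 V1 \<and>
        bilinear_map scale scale (*) \<Lambda> \<and> continuous_on UNIV (\<lambda>(v, w). \<Lambda> v w) \<and>
        graded_lcs.even_form V0 V1 \<Lambda> \<and>
        graded_lcs.weyl_completion scale V0 V1 R scaleW \<iota> \<longrightarrow>
        (\<forall>a b.
           real_analytic scaleW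
             (\<lambda>z. graded_lcs.extension scale V0 V1 \<iota> (graded_lcs.star scale V0 V1 \<Lambda> z) a b) \<and>
           (\<forall>z. (\<lambda>k. scaleW (z ^ k / fact k)
                       (graded_lcs.extension scale V0 V1 \<iota> (graded_lcs.mu_P scale V0 V1 \<Lambda> k) a b))
                sums graded_lcs.extension scale V0 V1 \<iota> (graded_lcs.star scale V0 V1 \<Lambda> z) a b)))
   \<and>
     (\<forall>(scale :: complex \<Rightarrow> 'v \<Rightarrow> 'v::{topological_ab_group_add, t2_space}) V0 V1 \<Lambda>
        (scaleW :: complex \<Rightarrow> 'w \<Rightarrow> 'w::{uniform_space, topological_ab_group_add, t2_space}) \<iota>.
        graded_lcs scale V0 V1 \<and>
        bilinear_map scale scale (*) \<Lambda> \<and> continuous_on UNIV (\<lambda>(v, w). \<Lambda> v w) \<and>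
        graded_lcs.even_form V0 V1 \<Lambda> \<and>
        graded_lcs.weyl_completion scale V0 V1 R scaleW \<iota> \<longrightarrow>
        (\<forall>a b.
           entire scaleW
             (\<lambda>z. graded_lcs.extension scale V0 V1 \<iota> (graded_lcs.star scale V0 V1 \<Lambda> z) a b) \<and>
           (\<forall>z. (\<lambda>k. scaleW (z ^ k / fact k)
                       (graded_lcs.extension scale V0 V1 \<iota> (graded_lcs.mu_P scale V0 V1 \<Lambda> k) a b))
                sums graded_lcs.extension scale V0 V1 \<iota> (graded_lcs.star scale V0 V1 \<Lambda> z) a b)) \<and>
        holomorphic_deformation scaleW
          (graded_lcs.extension scale V0 V1 \<iota> (\<lambda>a b. graded_lcs.mu scale V0 V1 (a \<otimes> b)))
          (\<lambda>z. graded_lcs.extension scale V0 V1 \<iota> (graded_lcs.star scale V0 V1 \<Lambda> z)))"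
proof (intro conjI allI impI; elim conjE)
  fix scale :: "real \<Rightarrow> 'v \<Rightarrow> 'v" and V0 V1 \<Lambda> and scaleW :: "real \<Rightarrow> 'w \<Rightarrow> 'w" and \<iota> a b and z :: real
  assume lcs: "graded_lcs scale V0 V1" and bil: "bilinear_map scale scale (*) \<Lambda>"
    and cont: "continuous_on UNIV (\<lambda>(v, w). \<Lambda> v w)"
    and even: "graded_lcs.even_form V0 V1 \<Lambda>"
    and completion: "graded_lcs.weyl_completion scale V0 V1 R scaleW \<iota>"
  interpret graded_form scale V0 V1 \<Lambda>
    by (intro graded_form.intro graded_form_axioms.intro lcs bil even)
  show "real_analytic scaleW (\<lambda>z. extension \<iota> (star \<Lambda> z) a b)"
    unfolding real_analytic_def
  \<comment> \<open>The radius 1 is arbitrary: the expansion around \<open>x0\<close> converges at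
    every \<open>x\<close>.\<close>
  proof (intro allI exI[of _ "\<lambda>k. extension \<iota> (taylor k x0) a b" for x0] exI[of _ 1] conjI impI)
    fix x0 x
    show "(\<lambda>k. scaleW ((x - x0) ^ k) (extension \<iota> (taylor k x0) a b)) sums extension \<iota> (star \<Lambda> x) a b"
      using star_power_series[OF assms cont completion, of "x - x0" x0 a b] by simp
  qed simp
  show "(\<lambda>k. scaleW (z ^ k / fact k) (extension \<iota> (mu_P \<Lambda> k) a b)) sums extension \<iota> (star \<Lambda> z) a b"
    by (rule star_taylor_expansion[OF assms cont completion])
next
  fix scale :: "complex \<Rightarrow> 'v \<Rightarrow> 'v" and V0 V1 \<Lambda> and scaleW :: "complex \<Rightarrow> 'w \<Rightarrow> 'w" and \<iota>
  assume lcs: "graded_lcs scale V0 V1" and bil: "bilinear_map scale scale (*) \<Lambda>"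
    and cont: "continuous_on UNIV (\<lambda>(v, w). \<Lambda> v w)"
    and even: "graded_lcs.even_form V0 V1 \<Lambda>"
    and completion: "graded_lcs.weyl_completion scale V0 V1 R scaleW \<iota>"
  interpret graded_form scale V0 V1 \<Lambda>
    by (intro graded_form.intro graded_form_axioms.intro lcs bil even)
  note facts = assms cont completion
  show entire: "entire scaleW (\<lambda>z. extension \<iota> (star \<Lambda> z) a b)" for a b
    unfolding entire_def by (intro allI exI) (rule star_difference_quotient[OF facts])
  show "(\<lambda>k. scaleW (z ^ k / fact k) (extension \<iota> (mu_P \<Lambda> k) a b)) sums extension \<iota> (star \<Lambda> z) a b" for a b z
    by (rule star_taylor_expansion[OF facts])
  have "locally_convex_space scaleW" using completion unfolding weyl_completion_def by blast
  then show "holomorphic_deformation scaleW (extension \<iota> (\<lambda>a b. mu (a \<otimes> b))) (\<lambda>z. extension \<iota> (star \<Lambda> z))"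
    unfolding holomorphic_deformation_def
    by (intro conjI allI extension_star_bilinear[OF facts] continuous_extension_star[OF facts]
        extension_star_assoc[OF facts] entire extension_star_0[OF facts])
qed

end
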